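(* Let $\mathcal{A}$ be a homogeneous matrix algebra over $\mathbb{Z}^d$ (with the group action $\chi$), $1\le p\le\infty$, $r>0$, and let $\{\varphi_k\}_{k\ge-1}$ be a dyadic partition of unity. Then the norm on the approximation space $\mathcal{E}^p_r(\mathcal{A})=\Lambda^p_r(\mathcal{A})$ is equivalent to $$\|A\|_{\mathcal{E}^p_r(\mathcal{A})}\asymp\Bigl(\sum_{k=-1}^\infty2^{kpr}\Bigl\|\sum_{\lfloor2^{k-1}\rfloor\le|l|_\infty<2^{k+1}}\hat\varphi_k(l)\hat A(l)\Bigr\|_{\mathcal{A}}^p\Bigr)^{1/p}.$$ If $\mathcal{A}$ is solid, then $$\|A\|_{\mathcal{E}^p_r(\mathcal{A})}\asymp\Bigl(\sum_{k=-1}^\infty2^{kpr}\Bigl\|\sum_{\lfloor2^{k}\rfloor\le|l|_\infty<2^{k+1}}\hat A(l)\Bigr\|_{\mathcal{A}}^p\Bigr)^{1/p}.$$ (For $p=\infty$ the sums over $k$ are replaced by suprema in the usual way; $l$ ranges over $\mathbb{Z}^d$.)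
   Context: Banach algebras are complex and unital. A matrix algebra over $\mathbb{Z}^d$ is a Banach algebra $\mathcal{A}$ of matrices $A:\mathbb{Z}^d\times\mathbb{Z}^d\to\mathbb{C}$ that is continuously embedded in $\mathcal{B}(\ell^2(\mathbb{Z}^d))$. It is homogeneous if the maps $\chi_t(A)(k,l)=e^{2\pi i(k-l)\cdot t}A(k,l)$, $t\in\mathbb{R}^d$, are uniformly bounded on $\mathcal{A}$; then $\chi=\{\chi_t\}$ is an automorphism group on $\mathcal{A}$. It is solid if $B\in\mathcal{A}$ and $|A(k,l)|\le|B(k,l)|$ for all $k,l$ imply $A\in\mathcal{A}$ and $\|A\|_{\mathcal{A}}\le\|B\|_{\mathcal{A}}$ (solid matrix algebras are homogeneous). The $m$-th side diagonal of $A$ is the matrix $\hat A(m)$ with $\hat A(m)(k,l)=A(k,l)$ if $k-l=m$ and $0$ otherwise. Besov spaces: with $\psi_t=\chi_t$, put $\Delta_t^k=(\psi_t-\mathrm{id})^k$, $\omega^k_h(a)=\sup_{|t|\le h}\|\Delta_t^ka\|_{\mathcal{A}}$, where $|t|=\sum_j|t_j|$ (other norms give equivalent definitions). For $l=\lfloor r\rfloor+1$, $\Lambda^p_r(\mathcal{A})$ consists of all $a\in\mathcal{A}$ with finite norm $\|a\|_{\mathcal{A}}+\bigl(\int_0^\infty(h^{-r}\omega^l_h(a))^p\frac{dh}{h}\bigr)^{1/p}$ (for $p=\infty$: $\|a\|_{\mathcal{A}}+\sup_{h>0}h^{-r}\omega^l_h(a)$, up to equivalence). Approximation spaces: let $\delta_{e_j}(a)=\lim_{h\to0}(\psi_{he_j}(a)-a)/h$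 and $\delta^\alpha=\delta_{e_1}^{\alpha_1}\cdots\delta_{e_d}^{\alpha_d}$. An element $a$ is $\sigma$-bandlimited if there is a constant $C$ (depending on $a$) such that for all multi-indices $\alpha$, $\delta^\alpha(a)$ is defined and $\|\delta^\alpha(a)\|_{\mathcal{A}}\le C(2\pi\sigma)^{|\alpha|}$, $|\alpha|=\sum_j\alpha_j$. (For homogeneous matrix algebras, a matrix is $N$-bandlimited if and only if it is banded with bandwidth $N$, i.e. $A=\sum_{|m|_\infty\le N}\hat A(m)$.) Let $X_0=\{0\}$, $X_\sigma$ the set of $\sigma$-bandlimited elements ($\sigma>0$), $E_\sigma(a)=\inf_{x\in X_\sigma}\|a-x\|_{\mathcal{A}}$. Then $\mathcal{E}^p_r(\mathcal{A})$ consists of all $a\in\mathcal{A}$ with finite norm $\bigl(\sum_{k=0}^\infty E_k(a)^p(k+1)^{rp}\frac1{k+1}\bigr)^{1/p}$ ($\sup_kE_k(a)(k+1)^r$ for $p=\infty$). One has $\mathcal{E}^p_r(\mathcal{A})=\Lambda^p_r(\mathcal{A})$ with equivalent norms. Dyadic partition of unity: the Fourier transform is $\hat f(\omega)=\int_{\mathbb{R}^d}f(x)e^{-2\pi i\omega\cdot x}dx$. Let $\varphi\in\mathscr{S}(\mathbb{R}^d)$ satisfy $\operatorname{supp}\hat\varphi\subseteq\{2^{-1}\le|\omega|_\infty\le2\}$, $\hat\varphi(\omega)>0$ for $2^{-1}<|\omega|_\infty<2$, and $\sum_{k\in\mathbb{Z}}\hat\varphi(2^{-k}\omega)=1$ for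 $\omega\ne0$. Put $\hat\varphi_k(\omega)=\hat\varphi(2^{-k}\omega)$ for $k\ge0$ and $\hat\varphi_{-1}=1-\sum_{k\ge0}\hat\varphi_k$. *)

theory Defs
  imports "HOL-Analysis.Analysis" "HOL-Library.Function_Algebras"
begin

section \<open>Matrices over the integer lattice\<close>

text \<open>
  The dimension d is the cardinality of the finite index type 'd. Addition, subtraction, zero and
  finite sums of matrices are the pointwise ones of Function_Algebras; the pointwise product of
  that theory is not the matrix product and is not used on matrices.
\<close>

type_synonym 'd zmat = "(int, 'd) vec \<Rightarrow> (int, 'd) vec \<Rightarrow> complex"

definition rvec :: "int ^ 'd \<Rightarrow> real ^ 'd" where
  "rvec m = (\<chi> j. real_of_int (m $ j))"

definition mat_scale :: "complex \<Rightarrow> 'd::finite zmat \<Rightarrow> 'd zmat" where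
  "mat_scale c A = (\<lambda>k l. c * A k l)"

definition mat_id :: "'d::finite zmat" where
  "mat_id = (\<lambda>k l. if k = l then 1 else 0)"

definition mat_mult :: "'d::finite zmat \<Rightarrow> 'd zmat \<Rightarrow> 'd zmat" where
  "mat_mult A B = (\<lambda>k l. \<Sum>\<^sub>\<infinity>m. A k m * B m l)"

definition side_diag :: "int ^ 'd \<Rightarrow> 'd::finite zmat \<Rightarrow> 'd zmat" where
  "side_diag m A = (\<lambda>k l. if k - l = m then A k l else 0)"

definition chi_act :: "real ^ 'd \<Rightarrow> 'd::finite zmat \<Rightarrow> 'd zmat" where
  "chi_act t A = (\<lambda>k l. cis (2 * pi * (rvec (k - l) \<bullet> t)) * A k l)"


section \<open>Bounded operators on the space of square-summable sequences\<close>

definition l2 :: "(int ^ 'd::finite \<Rightarrow> complex) set" where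
  "l2 = {x. (\<lambda>k. (cmod (x k))\<^sup>2) summable_on UNIV}"

definition l2_norm :: "(int ^ 'd::finite \<Rightarrow> complex) \<Rightarrow> real" where
  "l2_norm x = sqrt (\<Sum>\<^sub>\<infinity>k. (cmod (x k))\<^sup>2)"

definition mat_vec :: "'d::finite zmat \<Rightarrow> (int ^ 'd \<Rightarrow> complex) \<Rightarrow> (int ^ 'd \<Rightarrow> complex)" where
  "mat_vec A x = (\<lambda>k. \<Sum>\<^sub>\<infinity>l. A k l * x l)"

definition l2_bounded_by :: "'d::finite zmat \<Rightarrow> real \<Rightarrow> bool" where
  "l2_bounded_by A K \<longleftrightarrow>
     (\<forall>x\<in>l2. (\<forall>k. (\<lambda>l. A k l * x l) summable_on UNIV) \<and>
             mat_vec A x \<in> l2 \<and> l2_norm (mat_vec A x) \<le> K * l2_norm x)"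

text \<open>The matrices that represent bounded operators, with the operator norm.\<close>

definition l2_operators :: "'d::finite zmat set" where
  "l2_operators = {A. \<exists>K. l2_bounded_by A K}"

definition l2_opnorm :: "'d::finite zmat \<Rightarrow> real" where
  "l2_opnorm A = Inf {K. 0 \<le> K \<and> l2_bounded_by A K}"


section \<open>Matrix algebras\<close>

text \<open>
  S is the set of matrices that belong to the algebra, and N is its norm (only the values of N on S
  matter). The unit is the identity matrix; its norm need not be 1.
\<close>

locale matrix_algebra =
  fixes S :: "'d::finite zmat set" and N :: "'d zmat \<Rightarrow> real"
  assumes id_mem: "mat_id \<in> S"
    and add_mem: "A \<in> S \<Longrightarrow> B \<in> S \<Longrightarrow> A + B \<in> S"
    and scale_mem: "A \<in> S \<Longrightarrow> mat_scale c A \<in> S"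
    and mult_mem: "A \<in> S \<Longrightarrow> B \<in> S \<Longrightarrow> mat_mult A B \<in> S"
    and norm_nonneg: "A \<in> S \<Longrightarrow> 0 \<le> N A"
    and norm_eq_zero: "A \<in> S \<Longrightarrow> N A = 0 \<longleftrightarrow> A = 0"
    and norm_triangle: "A \<in> S \<Longrightarrow> B \<in> S \<Longrightarrow> N (A + B) \<le> N A + N B"
    and norm_scale: "A \<in> S \<Longrightarrow> N (mat_scale c A) = cmod c * N A"
    and norm_mult: "A \<in> S \<Longrightarrow> B \<in> S \<Longrightarrow> N (mat_mult A B) \<le> N A * N B"
    and norm_complete:
      "(\<And>n. X n \<in> S) \<Longrightarrow>
       (\<And>e. 0 < e \<Longrightarrow> \<exists>M. \<forall>m\<ge>M. \<forall>n\<ge>M. N (X m - X n) < e) \<Longrightarrow>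
       \<exists>A\<in>S. (\<lambda>n. N (X n - A)) \<longlonglongrightarrow> 0"
    and embedded: "S \<subseteq> l2_operators"
    and embedding_continuous: "\<exists>C. \<forall>A\<in>S. l2_opnorm A \<le> C * N A"

locale homogeneous_matrix_algebra = matrix_algebra +
  assumes chi_mem: "A \<in> S \<Longrightarrow> chi_act t A \<in> S"
    and chi_unif_bounded: "\<exists>M. \<forall>t. \<forall>A\<in>S. N (chi_act t A) \<le> M * N A"

definition solid :: "'d::finite zmat set \<Rightarrow> ('d zmat \<Rightarrow> real) \<Rightarrow> bool" where
  "solid S N \<longleftrightarrow>
     (\<forall>A. \<forall>B\<in>S. (\<forall>k l. cmod (A k l) \<le> cmod (B k l)) \<longrightarrow> A \<in> S \<and> N A \<le> N B)"

text \<open>The norm of the algebra, with value \<open>\<infinity>\<close> outside of the algebra.\<close>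

definition ext_norm :: "'d::finite zmat set \<Rightarrow> ('d zmat \<Rightarrow> real) \<Rightarrow> 'd zmat \<Rightarrow> ennreal" where
  "ext_norm S N A = (if A \<in> S then ennreal (N A) else \<infinity>)"

text \<open>
  The norms of the smoothness spaces are \<open>[0,\<infinity>]\<close>-valued on the algebra S, the space itself being the
  set where the norm is finite. Equivalence is two-sided comparability on all of S; in
  particular equivalent norms are finite on the same subset of S.
\<close>

definition equiv_norms ::
    "'d::finite zmat set \<Rightarrow> ('d zmat \<Rightarrow> ennreal) \<Rightarrow> ('d zmat \<Rightarrow> ennreal) \<Rightarrow> bool" where
  "equiv_norms S F G \<longleftrightarrow>
     (\<exists>c>0. \<exists>C>0. \<forall>A\<in>S. ennreal c * G A \<le> F A \<and> F A \<le> ennreal C * G A)"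

text \<open>Real powers on \<open>[0,\<infinity>]\<close>, intended for exponents \<open>s > 0\<close>.\<close>

definition epowr :: "ennreal \<Rightarrow> real \<Rightarrow> ennreal" where
  "epowr x s = (if x = \<infinity> then \<infinity> else ennreal (enn2real x powr s))"


section \<open>Besov spaces\<close>

definition norm1 :: "real ^ 'd \<Rightarrow> real" where
  "norm1 t = (\<Sum>j\<in>UNIV. \<bar>t $ j\<bar>)"

definition difference :: "nat \<Rightarrow> real ^ 'd \<Rightarrow> 'd::finite zmat \<Rightarrow> 'd zmat" where
  "difference n t = (\<lambda>B. chi_act t B - B) ^^ n"

definition modulus :: "('d::finite zmat \<Rightarrow> real) \<Rightarrow> nat \<Rightarrow> real \<Rightarrow> 'd zmat \<Rightarrow> ennreal" where
  "modulus N n h A = (SUP t\<in>{t. norm1 t \<le> h}. ennreal (N (difference n t A)))"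

definition besov_norm ::
    "('d::finite zmat \<Rightarrow> real) \<Rightarrow> ennreal \<Rightarrow> real \<Rightarrow> 'd zmat \<Rightarrow> ennreal" where
  "besov_norm N p r A = ennreal (N A) +
     (let n = nat \<lfloor>r\<rfloor> + 1; q = enn2real p in
      if p = \<infinity> then (SUP h\<in>{0<..}. ennreal (h powr (- r)) * modulus N n h A)
      else epowr (\<integral>\<^sup>+h\<in>{0<..}. epowr (ennreal (h powr (- r)) * modulus N n h A) q
                                  * ennreal (1 / h) \<partial>lborel) (1 / q))"

definition besov_space ::
    "'d::finite zmat set \<Rightarrow> ('d zmat \<Rightarrow> real) \<Rightarrow> ennreal \<Rightarrow> real \<Rightarrow> 'd zmat set" where
  "besov_space S N p r = {A \<in> S. besov_norm N p r A < \<infinity>}"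


section \<open>Approximation spaces\<close>

text \<open>
  \<open>chi_deriv S N j A B\<close>: A is in the domain of the generator \<open>\<delta>\<close> of the action in direction j, and
  B is its value there.
\<close>

definition chi_deriv ::
    "'d::finite zmat set \<Rightarrow> ('d zmat \<Rightarrow> real) \<Rightarrow> 'd \<Rightarrow> 'd zmat \<Rightarrow> 'd zmat \<Rightarrow> bool" where
  "chi_deriv S N j A B \<longleftrightarrow> A \<in> S \<and> B \<in> S \<and>
     ((\<lambda>h::real. N (mat_scale (1 / of_real h) (chi_act (h *\<^sub>R axis j 1) A - A) - B)) \<longlongrightarrow> 0) (at 0)"

text \<open>The numbering of the coordinates that fixes the order of the factors of \<open>\<delta>\<^sup>\<alpha>\<close>.\<close>

definition coords :: "'d::finite list" where
  "coords = (SOME js. distinct js \<and> set js = UNIV)"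

text \<open>
  With \<open>coords = [j\<^sub>1, \<dots>, j\<^sub>d]\<close> this says that \<open>\<delta>\<^sup>\<alpha>(A) = \<delta>\<^bsub>j1\<^esub>\<^bsup>\<alpha>1\<^esup> \<cdots> \<delta>\<^bsub>jd\<^esub>\<^bsup>\<alpha>d\<^esup>(A)\<close> is defined and equal to B, where
  the rightmost factor is applied first.
\<close>

definition chi_multideriv ::
    "'d::finite zmat set \<Rightarrow> ('d zmat \<Rightarrow> real) \<Rightarrow> ('d \<Rightarrow> nat) \<Rightarrow> 'd zmat \<Rightarrow> 'd zmat \<Rightarrow> bool" where
  "chi_multideriv S N \<alpha> = foldr (\<lambda>j R. R OO (chi_deriv S N j ^^ \<alpha> j)) coords (=)"

definition bandlimited ::
    "'d::finite zmat set \<Rightarrow> ('d zmat \<Rightarrow> real) \<Rightarrow> real \<Rightarrow> 'd zmat \<Rightarrow> bool" where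
  "bandlimited S N \<sigma> A \<longleftrightarrow> A \<in> S \<and>
     (\<exists>C. \<forall>\<alpha>. \<exists>B. chi_multideriv S N \<alpha> A B \<and> N B \<le> C * (2 * pi * \<sigma>) ^ (\<Sum>j\<in>UNIV. \<alpha> j))"

definition bandlimited_set ::
    "'d::finite zmat set \<Rightarrow> ('d zmat \<Rightarrow> real) \<Rightarrow> real \<Rightarrow> 'd zmat set" where
  "bandlimited_set S N \<sigma> = (if \<sigma> = 0 then {0} else {A. bandlimited S N \<sigma> A})"

definition approx_error ::
    "'d::finite zmat set \<Rightarrow> ('d zmat \<Rightarrow> real) \<Rightarrow> real \<Rightarrow> 'd zmat \<Rightarrow> ennreal" where
  "approx_error S N \<sigma> A = (INF X\<in>bandlimited_set S N \<sigma>. ennreal (N (A - X)))"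

definition approx_norm ::
    "'d::finite zmat set \<Rightarrow> ('d zmat \<Rightarrow> real) \<Rightarrow> ennreal \<Rightarrow> real \<Rightarrow> 'd zmat \<Rightarrow> ennreal" where
  "approx_norm S N p r A =
     (let q = enn2real p in
      if p = \<infinity> then (SUP k::nat. approx_error S N (real k) A * ennreal (real (k + 1) powr r))
      else epowr (\<Sum>k::nat. epowr (approx_error S N (real k) A) q
                      * ennreal (real (k + 1) powr (r * q)) * ennreal (1 / real (k + 1))) (1 / q))"

definition approx_space ::
    "'d::finite zmat set \<Rightarrow> ('d zmat \<Rightarrow> real) \<Rightarrow> ennreal \<Rightarrow> real \<Rightarrow> 'd zmat set" where
  "approx_space S N p r = {A \<in> S. approx_norm S N p r A < \<infinity>}"


section \<open>Schwartz functions and dyadic partitions of unity\<close>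

fun iter_partial :: "'d list \<Rightarrow> (real ^ 'd \<Rightarrow> complex) \<Rightarrow> (real ^ 'd::finite \<Rightarrow> complex)" where
  "iter_partial [] f = f"
| "iter_partial (j # js) f = (\<lambda>x. frechet_derivative (iter_partial js f) (at x) (axis j 1))"

definition schwartz :: "(real ^ 'd::finite \<Rightarrow> complex) \<Rightarrow> bool" where
  "schwartz f \<longleftrightarrow>
     (\<forall>js. (\<forall>x. iter_partial js f differentiable at x) \<and>
           (\<forall>n. bounded (range (\<lambda>x. norm x ^ n *\<^sub>R iter_partial js f x))))"

definition fourier :: "(real ^ 'd::finite \<Rightarrow> complex) \<Rightarrow> real ^ 'd \<Rightarrow> complex" where
  "fourier f \<omega> = (LINT x|lborel. f x * cis (- 2 * pi * (\<omega> \<bullet> x)))"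

definition dyadic_generator :: "(real ^ 'd::finite \<Rightarrow> complex) \<Rightarrow> bool" where
  "dyadic_generator \<phi> \<longleftrightarrow> schwartz \<phi> \<and>
     closure {\<omega>. fourier \<phi> \<omega> \<noteq> 0} \<subseteq> {\<omega>. 1 / 2 \<le> infnorm \<omega> \<and> infnorm \<omega> \<le> 2} \<and>
     (\<forall>\<omega>. 1 / 2 < infnorm \<omega> \<and> infnorm \<omega> < 2 \<longrightarrow>
          fourier \<phi> \<omega> \<in> \<real> \<and> 0 < Re (fourier \<phi> \<omega>)) \<and>
     (\<forall>\<omega>. \<omega> \<noteq> 0 \<longrightarrow> ((\<lambda>k::int. fourier \<phi> ((2 powi (- k)) *\<^sub>R \<omega>)) has_sum 1) UNIV)"

text \<open>The function \<open>\<phi>\<^sub>k\<close> of the partition, on the Fourier side; used for \<open>k \<ge> -1\<close> only.\<close>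

definition dyadic_hat :: "(real ^ 'd::finite \<Rightarrow> complex) \<Rightarrow> int \<Rightarrow> real ^ 'd \<Rightarrow> complex" where
  "dyadic_hat \<phi> k \<omega> =
     (if 0 \<le> k then fourier \<phi> ((2 powi (- k)) *\<^sub>R \<omega>)
      else 1 - (\<Sum>i::nat. fourier \<phi> ((2 powi (- int i)) *\<^sub>R \<omega>)))"


section \<open>Littlewood-Paley norms\<close>

definition smooth_block :: "(real ^ 'd \<Rightarrow> complex) \<Rightarrow> int \<Rightarrow> 'd::finite zmat \<Rightarrow> 'd zmat" where
  "smooth_block \<phi> k A =
     (\<Sum>l\<in>{l. real_of_int \<lfloor>(2::real) powi (k - 1)\<rfloor> \<le> infnorm (rvec l) \<and> infnorm (rvec l) < 2 powi (k + 1)}.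
        mat_scale (dyadic_hat \<phi> k (rvec l)) (side_diag l A))"

definition sharp_block :: "int \<Rightarrow> 'd::finite zmat \<Rightarrow> 'd zmat" where
  "sharp_block k A =
     (\<Sum>l\<in>{l. real_of_int \<lfloor>(2::real) powi k\<rfloor> \<le> infnorm (rvec l) \<and> infnorm (rvec l) < 2 powi (k + 1)}.
        side_diag l A)"

text \<open>The norm with blocks \<open>b k\<close>, \<open>k \<ge> -1\<close>; it is \<open>\<infinity>\<close> if a block does not belong to the algebra.\<close>

definition block_norm ::
    "'d::finite zmat set \<Rightarrow> ('d zmat \<Rightarrow> real) \<Rightarrow> ennreal \<Rightarrow> real \<Rightarrow> (int \<Rightarrow> 'd zmat) \<Rightarrow> ennreal" where
  "block_norm S N p r b =
     (let q = enn2real p in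
      if p = \<infinity> then (SUP k\<in>{-1..}. ennreal (2 powr (real_of_int k * r)) * ext_norm S N (b k))
      else epowr (\<Sum>\<^sub>\<infinity>k\<in>{-1..}. ennreal (2 powr (real_of_int k * q * r))
                                  * epowr (ext_norm S N (b k)) q) (1 / q))"

end

theory Submission
  imports Defs
begin

text \<open>
  All operators involved (the action, its differences, side diagonals, blocks) are Fourier multipliers
  \<open>A(k,l) \<mapsto> \<mu>(k - l) A(k,l)\<close>, and \<open>\<mu>\<close> is bounded on the algebra as soon as it is a combination of
  characters with absolutely summable coefficients. Correlations of two \<open>\<ell>\<^sup>2\<close>-sequences are such
  multipliers on banded matrices, by the discrete Parseval identity. This gives Bernstein's
  inequality and, with a Jackson-type kernel, the converse bound of a matrix without low frequencies
  by its differences.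

  The approximation norm, the Besov norm and the Littlewood-Paley norms are compared through their
  dyadic sequences. A matrix with finite Littlewood-Paley norm is the norm limit of the sums of its
  blocks, so that its approximation errors and moduli of smoothness at scale \<open>2\<^sup>-\<^sup>n\<close> are bounded by
  Hardy-type sums of the blocks. Conversely, a smooth block is bounded by the approximation error,
  since it annihilates matrices of small bandwidth, and by the modulus of smoothness, through the
  inverse Bernstein inequality; for sharp blocks solidity replaces the bound on the multiplier. The
  action need not be strongly continuous on the whole algebra: finiteness of the approximation or of
  the Besov norm must first be shown to force continuity (in the Besov case by Marchaud's argument).
\<close>

section \<open>Fourier multipliers\<close>

text \<open>A circularity shapes the order of the arguments. Side diagonals and dyadic blocks are
  obtained as integrals of characters and are controlled only for matrices on which the action is
  continuous, while banded matrices are known to be continuous only through Bernstein's inequality.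
  That inequality therefore has to do without integrals: on a finite band of frequencies a
  sufficiently fine grid of characters reproduces a correlation exactly, and finite exponential sums
  are bounded on the whole algebra. Such grids also carry the Jackson-type kernel. Integrals enter
  once continuity is available, as limits of finite sums over simple functions. Limits in the
  algebra are identified by their entries, which are continuous functionals because of the embedding
  into the bounded operators. The dyadic sequences carry the norm itself at index 0 and the k-th
  scale at index k + 1, the shift by one that also turns the block index k \<ge> -1 into a natural
  number; the remaining discrepancies between scales are finite shifts and cost only
  constants.\<close>

definition character :: "real ^ 'd \<Rightarrow> int ^ 'd \<Rightarrow> complex" where
  "character t m = cis (2 * pi * (rvec m \<bullet> t))"

definition fmult :: "(int ^ 'd \<Rightarrow> complex) \<Rightarrow> 'd::finite zmat \<Rightarrow> 'd zmat" where
  "fmult \<mu> A = (\<lambda>k l. \<mu> (k - l) * A k l)"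

definition spectrum_in :: "'d::finite zmat \<Rightarrow> (int ^ 'd) set \<Rightarrow> bool" where
  "spectrum_in A P \<longleftrightarrow> (\<forall>k l. A k l \<noteq> 0 \<longrightarrow> k - l \<in> P)"

lemma chi_act_fmult: "chi_act t A = fmult (character t) A"
  by (simp add: chi_act_def fmult_def character_def)

lemma side_diag_fmult: "side_diag m A = fmult (\<lambda>x. if x = m then 1 else 0) A"
  by (auto simp: side_diag_def fmult_def fun_eq_iff)

lemma fmult_fmult: "fmult \<mu> (fmult \<nu> A) = fmult (\<lambda>m. \<mu> m * \<nu> m) A"
  by (simp add: fmult_def mult.assoc)

lemma fmult_commute: "fmult \<mu> (fmult \<nu> A) = fmult \<nu> (fmult \<mu> A)"
  by (simp add: fmult_fmult mult.commute)

lemma fmult_one [simp]: "fmult (\<lambda>_. 1) A = A"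
  by (simp add: fmult_def)

lemma fmult_zero [simp]: "fmult (\<lambda>_. 0) A = 0" "fmult \<mu> 0 = 0"
  by (simp_all add: fmult_def fun_eq_iff)

lemma fmult_plus: "fmult (\<lambda>m. \<mu> m + \<nu> m) A = fmult \<mu> A + fmult \<nu> A"
  by (simp add: fmult_def fun_eq_iff distrib_right)

lemma fmult_minus: "fmult (\<lambda>m. \<mu> m - \<nu> m) A = fmult \<mu> A - fmult \<nu> A"
  by (simp add: fmult_def fun_eq_iff left_diff_distrib)

lemma fmult_cmult: "fmult (\<lambda>m. c * \<mu> m) A = mat_scale c (fmult \<mu> A)"
  by (simp add: fmult_def mat_scale_def mult.assoc)

lemma sum_matrix_apply: "(\<Sum>i\<in>I. F i) k l = (\<Sum>i\<in>I. F i k l)"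
  for F :: "'i \<Rightarrow> 'd::finite zmat"
  by (induction I rule: infinite_finite_induct) auto

lemma fmult_sum: "fmult (\<lambda>m. \<Sum>i\<in>I. \<mu> i m) A = (\<Sum>i\<in>I. fmult (\<mu> i) A)"
  by (simp add: fmult_def fun_eq_iff sum_matrix_apply sum_distrib_right)

lemma fmult_diff_right: "fmult \<mu> (A - B) = fmult \<mu> A - fmult \<mu> B"
  by (simp add: fmult_def fun_eq_iff right_diff_distrib)

lemma fmult_sum_right: "fmult \<mu> (\<Sum>i\<in>I. F i) = (\<Sum>i\<in>I. fmult \<mu> (F i))"
  by (simp add: fmult_def fun_eq_iff sum_matrix_apply sum_distrib_left)

text \<open>A symbol matters only on the spectrum, so that on banded matrices it may be exchanged
  for a finite exponential sum with the same values there.\<close>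

lemma fmult_cong_spectrum:
  "spectrum_in A P \<Longrightarrow> (\<And>m. m \<in> P \<Longrightarrow> \<mu> m = \<nu> m) \<Longrightarrow> fmult \<mu> A = fmult \<nu> A"
  by (force simp: fmult_def fun_eq_iff spectrum_in_def)

lemma spectrum_in_mono: "spectrum_in A P \<Longrightarrow> P \<subseteq> Q \<Longrightarrow> spectrum_in A Q"
  by (auto simp: spectrum_in_def)

lemma spectrum_in_fmult: "spectrum_in A P \<Longrightarrow> spectrum_in (fmult \<mu> A) P"
  by (auto simp: spectrum_in_def fmult_def)

lemma spectrum_in_fmult_support:
  "(\<And>m. \<mu> m \<noteq> 0 \<Longrightarrow> m \<in> P) \<Longrightarrow> spectrum_in (fmult \<mu> A) P"
  by (auto simp: spectrum_in_def fmult_def)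

lemma spectrum_in_sum:
  "(\<And>i. i \<in> I \<Longrightarrow> spectrum_in (F i) P) \<Longrightarrow> spectrum_in (\<Sum>i\<in>I. F i) P"
  unfolding spectrum_in_def sum_matrix_apply by (meson sum.not_neutral_contains_not_neutral)

lemma difference_fmult: "difference n t A = fmult (\<lambda>m. (character t m - 1) ^ n) A"
proof (induction n)
  case 0
  then show ?case by (simp add: difference_def)
next
  case (Suc n)
  have "difference (Suc n) t A = chi_act t (difference n t A) - difference n t A"
    by (simp add: difference_def)
  also have "\<dots> = fmult (\<lambda>m. character t m - 1) (difference n t A)"
    by (simp add: chi_act_fmult fmult_minus)
  finally show ?case
    by (simp add: Suc.IH fmult_fmult)
qed

section \<open>Lattice frequencies, characters and norms on the real space\<close>

lemma rvec_zero [simp]: "rvec 0 = 0"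
  by (simp add: rvec_def vec_eq_iff)

lemma rvec_nth [simp]: "rvec m $ j = real_of_int (m $ j)"
  by (simp add: rvec_def)

lemma rvec_eq_zero_iff [simp]: "rvec m = 0 \<longleftrightarrow> m = 0"
  by (simp add: rvec_def vec_eq_iff)

lemma norm_character [simp]: "cmod (character t m) = 1"
  by (simp add: character_def)

lemma character_zero [simp]: "character 0 m = 1"
  by (simp add: character_def)

lemma character_add: "character (s + t) m = character s m * character t m"
  by (simp add: character_def inner_add_right distrib_left cis_mult)

lemma character_scale_nat: "character (real n *\<^sub>R t) m = character t m ^ n"
  by (simp add: character_def Complex.DeMoivre mult_ac)

lemma character_axis: "character (s *\<^sub>R axis j 1) m = cis (2 * pi * (s * real_of_int (m $ j)))"
  by (simp add: character_def inner_axis)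

lemma norm1_nonneg: "0 \<le> norm1 t"
  by (simp add: norm1_def sum_nonneg)

lemma norm1_scale: "norm1 (c *\<^sub>R t) = \<bar>c\<bar> * norm1 t"
  by (simp add: norm1_def abs_mult sum_distrib_left)

lemma norm1_axis: "norm1 (s *\<^sub>R axis j 1 :: real ^ 'd::finite) = \<bar>s\<bar>"
proof -
  have "norm1 (s *\<^sub>R axis j 1 :: real ^ 'd) = (\<Sum>i\<in>UNIV. if i = j then \<bar>s\<bar> else 0)"
    unfolding norm1_def by (intro sum.cong) (auto simp: axis_def)
  then show ?thesis by simp
qed

lemma norm1_le_norm: "norm1 t \<le> real CARD('d) * norm t" for t :: "real ^ 'd::finite"
proof -
  have "norm1 t \<le> (\<Sum>j\<in>(UNIV::'d set). norm t)"
    unfolding norm1_def by (intro sum_mono component_le_norm_cart)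
  then show ?thesis by simp
qed

lemma infnorm_le_iff: "infnorm (x::real ^ 'd::finite) \<le> c \<longleftrightarrow> (\<forall>j. \<bar>x $ j\<bar> \<le> c)"
  unfolding infnorm_cart setcompr_eq_image by (subst cSup_le_iff) auto

lemma less_infnorm_iff: "c < infnorm (x::real ^ 'd::finite) \<longleftrightarrow> (\<exists>j. c < \<bar>x $ j\<bar>)"
  using infnorm_le_iff[of x c] by (simp flip: not_le)

lemma infnorm_less_iff: "infnorm (x::real ^ 'd::finite) < c \<longleftrightarrow> (\<forall>j. \<bar>x $ j\<bar> < c)"
  unfolding infnorm_cart setcompr_eq_image by (subst finite_Sup_less_iff) auto

section \<open>The algebra as a normed space\<close>

text \<open>Applied to the unit vector at \<open>l\<close>, the matrix returns its column
  \<open>l\<close>, whose l2 norm dominates each of its entries.\<close>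

lemma l2_bounded_by_entry:
  fixes A :: "'d::finite zmat"
  assumes "l2_bounded_by A K"
  shows "cmod (A k l) \<le> K"
proof -
  define x :: "int ^ 'd \<Rightarrow> complex" where "x = (\<lambda>m. if m = l then 1 else 0)"
  have sx: "((\<lambda>m. (cmod (x m))\<^sup>2) has_sum 1) UNIV"
    by (rule has_sum_finite_neutralI[of "{l}"]) (auto simp: x_def)
  then have "x \<in> l2" and nx: "l2_norm x = 1"
    by (auto simp: l2_def l2_norm_def has_sum_imp_summable dest: infsumI)
  have col: "mat_vec A x = (\<lambda>k. A k l)"
  proof
    fix k
    have "((\<lambda>m. A k m * x m) has_sum A k l) UNIV"
      by (rule has_sum_finite_neutralI[of "{l}"]) (auto simp: x_def)
    then show "mat_vec A x k = A k l"
      by (simp add: mat_vec_def infsumI)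
  qed
  have mem: "(\<lambda>k. A k l) \<in> l2" and le: "l2_norm (\<lambda>k. A k l) \<le> K"
    using assms \<open>x \<in> l2\<close> col nx by (fastforce simp: l2_bounded_by_def)+
  have "(\<Sum>\<^sub>\<infinity>m\<in>{k}. (cmod (A m l))\<^sup>2) \<le> (\<Sum>\<^sub>\<infinity>m. (cmod (A m l))\<^sup>2)"
    using mem by (intro infsum_mono_neutral) (auto simp: l2_def)
  then have "cmod (A k l) \<le> l2_norm (\<lambda>k. A k l)"
    unfolding l2_norm_def by (intro real_le_rsqrt) simp
  with le show ?thesis by simp
qed

context matrix_algebra
begin

lemma zero_mem [simp]: "0 \<in> S"
proof -
  have "mat_scale 0 mat_id = (0 :: 'd zmat)" by (simp add: mat_scale_def fun_eq_iff)
  then show ?thesis using scale_mem[OF id_mem, of 0] by simp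
qed

lemma uminus_eq_scale: "- A = mat_scale (- 1) A" for A :: "'d zmat"
  by (simp add: mat_scale_def fun_eq_iff)

lemma uminus_mem: "A \<in> S \<Longrightarrow> - A \<in> S"
  by (simp add: uminus_eq_scale scale_mem)

lemma diff_mem: "A \<in> S \<Longrightarrow> B \<in> S \<Longrightarrow> A - B \<in> S"
  using add_mem[of A "- B"] by (simp add: uminus_mem)

lemma sum_mem: "(\<And>i. i \<in> I \<Longrightarrow> F i \<in> S) \<Longrightarrow> (\<Sum>i\<in>I. F i) \<in> S"
  by (induction I rule: infinite_finite_induct) (auto intro: add_mem)

lemma N_zero [simp]: "N 0 = 0"
  by (simp add: norm_eq_zero)

lemma N_uminus: "A \<in> S \<Longrightarrow> N (- A) = N A"
  by (simp add: uminus_eq_scale norm_scale)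

lemma N_minus_commute: "A \<in> S \<Longrightarrow> B \<in> S \<Longrightarrow> N (A - B) = N (B - A)"
  using N_uminus[OF diff_mem[of A B]] by simp

lemma N_diff_le: "A \<in> S \<Longrightarrow> B \<in> S \<Longrightarrow> N (A - B) \<le> N A + N B"
  using norm_triangle[of A "- B"] by (simp add: uminus_mem N_uminus)

lemma N_le_add_diff: "A \<in> S \<Longrightarrow> B \<in> S \<Longrightarrow> N A \<le> N B + N (A - B)"
  using norm_triangle[of B "A - B"] by (simp add: diff_mem)

lemma N_sum_le: "(\<And>i. i \<in> I \<Longrightarrow> F i \<in> S) \<Longrightarrow> N (\<Sum>i\<in>I. F i) \<le> (\<Sum>i\<in>I. N (F i))"
proof (induction I rule: infinite_finite_induct)
  case (insert x I)
  have "N (F x + sum F I) \<le> N (F x) + N (sum F I)"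
    using insert.prems by (intro norm_triangle sum_mem) auto
  moreover have "N (sum F I) \<le> (\<Sum>i\<in>I. N (F i))"
    using insert by auto
  ultimately show ?case
    unfolding sum.insert[OF insert.hyps(1,2)] by linarith
qed auto

lemma N_scaled_sum_le:
  assumes "\<And>i. i \<in> I \<Longrightarrow> fmult (\<mu> i) A \<in> S"
  shows "fmult (\<lambda>m. \<Sum>i\<in>I. c i * \<mu> i m) A \<in> S"
    and "N (fmult (\<lambda>m. \<Sum>i\<in>I. c i * \<mu> i m) A) \<le> (\<Sum>i\<in>I. cmod (c i) * N (fmult (\<mu> i) A))"
proof -
  have eq: "fmult (\<lambda>m. \<Sum>i\<in>I. c i * \<mu> i m) A = (\<Sum>i\<in>I. mat_scale (c i) (fmult (\<mu> i) A))"
    by (simp add: fmult_sum fmult_cmult)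
  show "fmult (\<lambda>m. \<Sum>i\<in>I. c i * \<mu> i m) A \<in> S"
    unfolding eq by (intro sum_mem scale_mem assms)
  have "N (\<Sum>i\<in>I. mat_scale (c i) (fmult (\<mu> i) A)) \<le> (\<Sum>i\<in>I. N (mat_scale (c i) (fmult (\<mu> i) A)))"
    by (intro N_sum_le scale_mem assms)
  also have "\<dots> = (\<Sum>i\<in>I. cmod (c i) * N (fmult (\<mu> i) A))"
    by (intro sum.cong norm_scale assms refl)
  finally show "N (fmult (\<lambda>m. \<Sum>i\<in>I. c i * \<mu> i m) A) \<le> (\<Sum>i\<in>I. cmod (c i) * N (fmult (\<mu> i) A))"
    unfolding eq .
qed

text \<open>\<open>l2_opnorm\<close> is an infimum of bounds, each of which is at least the modulus
  of every entry. The inclusion in \<open>l2_operators\<close> makes the set of bounds nonempty,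
  without which the infimum would carry no information.\<close>

lemma entry_bound: "\<exists>C>0. \<forall>A\<in>S. \<forall>k l. cmod (A k l) \<le> C * N A"
proof -
  obtain C where C: "\<And>A. A \<in> S \<Longrightarrow> l2_opnorm A \<le> C * N A"
    using embedding_continuous by auto
  have "cmod (A k l) \<le> (\<bar>C\<bar> + 1) * N A" if A: "A \<in> S" for A k l
  proof -
    obtain K where "l2_bounded_by A K"
      using embedded A by (auto simp: l2_operators_def)
    moreover from this have "0 \<le> K"
      using l2_bounded_by_entry[of A K k l] norm_ge_zero[of "A k l"] by linarith
    ultimately have "cmod (A k l) \<le> l2_opnorm A"
      unfolding l2_opnorm_def by (intro cInf_greatest) (auto intro: l2_bounded_by_entry)
    also have "\<dots> \<le> C * N A" using C A .
    also have "\<dots> \<le> (\<bar>C\<bar> + 1) * N A"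
      using norm_nonneg[OF A] by (intro mult_right_mono) auto
    finally show ?thesis .
  qed
  then show ?thesis by (intro exI[of _ "\<bar>C\<bar> + 1"]) auto
qed

text \<open>The filter is arbitrary because both sequences and difference quotients for h tending to
  0 have their limits identified in this way.\<close>

lemma entry_tendsto:
  assumes "\<And>n. X n \<in> S" and "A \<in> S" and "((\<lambda>n. N (X n - A)) \<longlongrightarrow> 0) F"
  shows "((\<lambda>n. X n k l) \<longlongrightarrow> A k l) F"
proof -
  obtain C where C: "\<And>A k l. A \<in> S \<Longrightarrow> cmod (A k l) \<le> C * N A"
    using entry_bound by auto
  have "((\<lambda>n. X n k l - A k l) \<longlongrightarrow> 0) F"
  proof (rule Lim_null_comparison)
    show "\<forall>\<^sub>F n in F. norm (X n k l - A k l) \<le> C * N (X n - A)"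
      using C[OF diff_mem[OF assms(1,2)]] by (intro always_eventually) auto
    show "((\<lambda>n. C * N (X n - A)) \<longlongrightarrow> 0) F"
      using tendsto_mult_left[OF assms(3), of C] by simp
  qed
  then show ?thesis by (simp add: LIM_zero_iff)
qed

text \<open>Completeness provides some limit, and convergence of entries shows that it is the given
  matrix. This is how membership is proved for a matrix that is known by its entries only.\<close>

lemma limit_in_algebra:
  assumes "\<And>n. X n \<in> S"
    and "\<And>e. 0 < e \<Longrightarrow> \<exists>M. \<forall>m\<ge>M. \<forall>n\<ge>M. N (X m - X n) < e"
    and "\<And>k l. (\<lambda>n. X n k l) \<longlonglongrightarrow> A k l"
  shows "A \<in> S" and "(\<lambda>n. N (X n - A)) \<longlonglongrightarrow> 0"
proof -
  obtain B where B: "B \<in> S" "(\<lambda>n. N (X n - B)) \<longlonglongrightarrow> 0"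
    using norm_complete[of X] assms(1,2) by blast
  have "A = B"
    using LIMSEQ_unique[OF assms(3) entry_tendsto[OF assms(1) B]] by (simp add: fun_eq_iff)
  with B show "A \<in> S" and "(\<lambda>n. N (X n - A)) \<longlonglongrightarrow> 0" by auto
qed

lemma N_le_of_tendsto:
  assumes "\<And>n. X n \<in> S" and "A \<in> S" and "(\<lambda>n. N (X n - A)) \<longlonglongrightarrow> 0"
    and "\<And>n. N (X n) \<le> K"
  shows "N A \<le> K"
proof (rule LIMSEQ_le_const)
  show "(\<lambda>n. K + N (X n - A)) \<longlonglongrightarrow> K"
    using tendsto_add[OF tendsto_const assms(3), of K] by simp
  have "N A \<le> K + N (X n - A)" for n
    using N_le_add_diff[OF assms(2) assms(1)[of n]] assms(4)[of n] N_minus_commute[OF assms(1)[of n] assms(2)]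
    by linarith
  then show "\<exists>M. \<forall>n\<ge>M. N A \<le> K + N (X n - A)" by blast
qed

end

section \<open>Bounded multipliers\<close>

context homogeneous_matrix_algebra
begin

text \<open>The bound in the locale may be any real number; requiring at least 1 makes the constant
  positive, as the monotonicity steps below need.\<close>

definition action_bound :: real where
  "action_bound = (SOME M. 1 \<le> M \<and> (\<forall>t. \<forall>A\<in>S. N (chi_act t A) \<le> M * N A))"

lemma action_bound: "1 \<le> action_bound" "A \<in> S \<Longrightarrow> N (chi_act t A) \<le> action_bound * N A"
proof -
  obtain M where M: "\<And>t A. A \<in> S \<Longrightarrow> N (chi_act t A) \<le> M * N A"
    using chi_unif_bounded by auto
  have "N (chi_act t A) \<le> max 1 M * N A" if "A \<in> S" for t A
    using M[OF that, of t] norm_nonneg[OF that] by (meson max.cobounded2 mult_right_mono order_trans)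
  then have "\<exists>M. 1 \<le> M \<and> (\<forall>t. \<forall>A\<in>S. N (chi_act t A) \<le> M * N A)"
    by (intro exI[of _ "max 1 M"]) auto
  from someI_ex[OF this]
  show "1 \<le> action_bound" "A \<in> S \<Longrightarrow> N (chi_act t A) \<le> action_bound * N A"
    unfolding action_bound_def by blast+
qed

lemma action_bound_pos: "0 < action_bound"
  using action_bound(1) by linarith

lemma character_mem: "A \<in> S \<Longrightarrow> fmult (character t) A \<in> S"
  using chi_mem by (simp add: chi_act_fmult)

lemma character_bound: "A \<in> S \<Longrightarrow> N (fmult (character t) A) \<le> action_bound * N A"
  using action_bound(2) by (simp add: chi_act_fmult)

text \<open>Only the l1 norm of the coefficients enters, and no continuity of the action. The
  correlation multipliers below are reduced to this bound.\<close>

lemma exp_sum_bound: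
  assumes "A \<in> S"
  shows "fmult (\<lambda>m. \<Sum>i\<in>I. c i * character (t i) m) A \<in> S"
    and "N (fmult (\<lambda>m. \<Sum>i\<in>I. c i * character (t i) m) A) \<le> action_bound * (\<Sum>i\<in>I. cmod (c i)) * N A"
proof -
  have "(\<Sum>i\<in>I. cmod (c i) * N (fmult (character (t i)) A)) \<le> (\<Sum>i\<in>I. cmod (c i) * (action_bound * N A))"
    by (intro sum_mono mult_left_mono character_bound assms) auto
  also have "\<dots> = action_bound * (\<Sum>i\<in>I. cmod (c i)) * N A"
    by (simp add: sum_distrib_left sum_distrib_right mult_ac)
  finally show "N (fmult (\<lambda>m. \<Sum>i\<in>I. c i * character (t i) m) A) \<le> action_bound * (\<Sum>i\<in>I. cmod (c i)) * N A"
    using N_scaled_sum_le(2)[of I "\<lambda>i. character (t i)" A c] character_mem[OF assms] by force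
qed (intro N_scaled_sum_le character_mem assms)

lemma diff1_mem: "A \<in> S \<Longrightarrow> fmult (\<lambda>m. character t m - 1) A \<in> S"
  by (simp add: fmult_minus diff_mem character_mem)

lemma diff1_bound: "A \<in> S \<Longrightarrow> N (fmult (\<lambda>m. character t m - 1) A) \<le> (action_bound + 1) * N A"
  using N_diff_le[OF character_mem[of A t], of A] character_bound[of A t]
  by (simp add: fmult_minus distrib_right)

lemma difference_mem: "A \<in> S \<Longrightarrow> difference n t A \<in> S"
proof (induction n)
  case (Suc n)
  have "difference (Suc n) t A = fmult (\<lambda>m. character t m - 1) (difference n t A)"
    by (simp add: difference_fmult fmult_fmult)
  with Suc show ?case by (simp add: diff1_mem)
qed (simp add: difference_def)

lemma difference_bound: "A \<in> S \<Longrightarrow> N (difference n t A) \<le> (action_bound + 1) ^ n * N A"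
proof (induction n)
  case (Suc n)
  have "difference (Suc n) t A = fmult (\<lambda>m. character t m - 1) (difference n t A)"
    by (simp add: difference_fmult fmult_fmult)
  then have "N (difference (Suc n) t A) \<le> (action_bound + 1) * N (difference n t A)"
    using diff1_bound difference_mem Suc by simp
  also have "\<dots> \<le> (action_bound + 1) * ((action_bound + 1) ^ n * N A)"
    using Suc action_bound_pos by (intro mult_left_mono) auto
  finally show ?case by simp
qed (simp add: difference_def)

text \<open>Telescoping over the coordinates: e(u + v) - 1 = e(u) (e(v) - 1) + (e(u) - 1). The
  factor e(u) acts on an increment already formed, so that \<open>action_bound\<close> enters once
  and is not raised to the number of coordinates.\<close>

lemma diff1_coordinatewise:
  assumes "A \<in> S"
  shows "N (fmult (\<lambda>m. character t m - 1) A)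
         \<le> action_bound * (\<Sum>j\<in>UNIV. N (fmult (\<lambda>m. character ((t $ j) *\<^sub>R axis j 1) m - 1) A))"
proof -
  have "N (fmult (\<lambda>m. character (\<Sum>j\<in>J. (t $ j) *\<^sub>R axis j 1) m - 1) A)
         \<le> action_bound * (\<Sum>j\<in>J. N (fmult (\<lambda>m. character ((t $ j) *\<^sub>R axis j 1) m - 1) A))"
    if "finite J" for J :: "'a set"
    using that
  proof induction
    case empty
    have "fmult (\<lambda>m. character (\<Sum>j\<in>{}. (t $ j) *\<^sub>R axis j 1) m - 1) A = 0"
      by simp
    then show ?case by (simp only: N_zero) simp
  next
    case (insert j J)
    let ?u = "\<Sum>j\<in>J. (t $ j) *\<^sub>R axis j 1" and ?v = "(t $ j) *\<^sub>R axis j (1::real)"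
    have "fmult (\<lambda>m. character (?v + ?u) m - 1) A
        = fmult (character ?u) (fmult (\<lambda>m. character ?v m - 1) A) + fmult (\<lambda>m. character ?u m - 1) A"
      unfolding fmult_fmult by (subst fmult_plus[symmetric]) (simp add: character_add algebra_simps)
    then have "N (fmult (\<lambda>m. character (?v + ?u) m - 1) A)
        \<le> action_bound * N (fmult (\<lambda>m. character ?v m - 1) A) + N (fmult (\<lambda>m. character ?u m - 1) A)"
      using norm_triangle[OF character_mem[OF diff1_mem[OF assms]] diff1_mem[OF assms], of ?u ?v ?u]
        character_bound[OF diff1_mem[OF assms], of ?u ?v] by simp
    with insert show ?case by (simp add: distrib_left)
  qed
  from this[of UNIV] show ?thesis
    by (simp add: basis_expansion scalar_mult_eq_scaleR[symmetric])
qed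

end

section \<open>Multipliers from correlations of finite sequences\<close>

lemma norm_cis_minus_one: "cmod (cis t - 1) = 2 * \<bar>sin (t / 2)\<bar>"
  using dist_exp_i_1[of t] by (simp add: cis_conv_exp)

lemma norm_cis_minus_one_le: "cmod (cis t - 1) \<le> \<bar>t\<bar>"
  using abs_sin_x_le_abs_x[of "t / 2"] by (simp add: norm_cis_minus_one)

lemma sum_roots_of_unity:
  fixes x :: int
  assumes "0 < G"
  shows "(\<Sum>g<G. cis (2 * pi * (real g / real G * of_int x))) = (if int G dvd x then of_nat G else 0)"
proof -
  define z where "z = cis (2 * pi * (of_int x / real G))"
  have z: "cis (2 * pi * (real g / real G * of_int x)) = z ^ g" for g
    by (simp add: z_def Complex.DeMoivre mult_ac)
  have "z ^ G = cis (2 * pi * of_int x)"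
    using assms by (simp add: z_def Complex.DeMoivre)
  then have zG: "z ^ G = 1" by (simp add: cis_multiple_2pi)
  have "z = 1 \<longleftrightarrow> int G dvd x"
  proof
    assume "z = 1"
    then obtain n :: int where "2 * pi * (of_int x / real G) = of_int (2 * n) * pi"
      by (auto simp: z_def cis_conv_exp exp_eq_1)
    then have "of_int x = real_of_int (n * int G)"
      using assms by (simp add: field_simps)
    then have "x = n * int G" by (simp only: of_int_eq_iff)
    then show "int G dvd x" by simp
  next
    assume "int G dvd x"
    then obtain n where "x = int G * n" ..
    then show "z = 1" using assms by (simp add: z_def cis_multiple_2pi)
  qed
  then show ?thesis
    unfolding z sum_gp_strict using zG by simp
qed

text \<open>The cross-correlation at lag x, possibly negative, of two sequences cut off to [0, L);
  the double sum avoids indices i' + x outside the naturals.\<close>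

definition correlation :: "nat \<Rightarrow> (nat \<Rightarrow> complex) \<Rightarrow> (nat \<Rightarrow> complex) \<Rightarrow> int \<Rightarrow> complex" where
  "correlation L a b x = (\<Sum>i<L. \<Sum>i'<L. if int i = int i' + x then a i * cnj (b i') else 0)"

text \<open>For L \<le> G this is the discrete Fourier transform on G points of the first L terms of
  \<open>a\<close>, continued by zero.\<close>

definition grid_transform :: "nat \<Rightarrow> nat \<Rightarrow> (nat \<Rightarrow> complex) \<Rightarrow> nat \<Rightarrow> complex" where
  "grid_transform G L a g = (\<Sum>i<L. a i * cis (- (2 * pi * (real g / real G * real i))))"

text \<open>The convolution theorem on a grid. Expanding both transforms leaves roots of unity at x
  - i + i'; by the assumption this integer has modulus less than G, so that G divides it only if it
  is 0 and no aliasing occurs.\<close>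

lemma grid_correlation:
  assumes "0 < G" and "\<bar>x\<bar> + int L \<le> int G"
  shows "(\<Sum>g<G. grid_transform G L a g * cnj (grid_transform G L b g) / of_nat G
            * cis (2 * pi * (real g / real G * of_int x))) = correlation L a b x"
proof -
  let ?e = "\<lambda>g y. cis (2 * pi * (real g / real G * y))"
  have expand: "grid_transform G L a g * cnj (grid_transform G L b g) / of_nat G * ?e g (of_int x)
     = (\<Sum>i<L. \<Sum>i'<L. a i * cnj (b i') / of_nat G * ?e g (of_int (x - int i + int i')))" for g
  proof -
    have cis3: "cis (- (2 * pi * (real g / real G * real i))) * cis (2 * pi * (real g / real G * real i'))
            * ?e g (of_int x) = ?e g (of_int (x - int i + int i'))" for i i'
      by (simp add: cis_mult algebra_simps add_divide_distrib diff_divide_distrib)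
    have *: "a i * cnj (b i') / of_nat G * ?e g (of_int (x - int i + int i'))
       = (a i * cis (- (2 * pi * (real g / real G * real i))))
         * (cnj (b i') * cis (2 * pi * (real g / real G * real i'))) / of_nat G * ?e g (of_int x)" for i i'
      unfolding cis3[symmetric] by simp
    show ?thesis
      unfolding * grid_transform_def
      by (simp only: cnj_sum complex_cnj_mult cis_cnj minus_minus sum_product) (simp only: sum_distrib_right sum_divide_distrib)
  qed
  have "(\<Sum>g<G. grid_transform G L a g * cnj (grid_transform G L b g) / of_nat G * ?e g (of_int x))
    = (\<Sum>i<L. \<Sum>g<G. \<Sum>i'<L. a i * cnj (b i') / of_nat G * ?e g (of_int (x - int i + int i')))"
    unfolding expand by (rule sum.swap)
  also have "\<dots> = (\<Sum>i<L. \<Sum>i'<L. \<Sum>g<G. a i * cnj (b i') / of_nat G * ?e g (of_int (x - int i + int i')))"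
    by (intro sum.cong refl sum.swap)
  also have "\<dots> = correlation L a b x"
    unfolding correlation_def
  proof (intro sum.cong refl)
    fix i i' assume i: "i \<in> {..<L}" "i' \<in> {..<L}"
    have "\<bar>x - int i + int i'\<bar> < int G" using i assms(2) by auto
    then have "int G dvd x - int i + int i' \<longleftrightarrow> int i = int i' + x"
      using zdvd_not_zless[of "\<bar>x - int i + int i'\<bar>" "int G"] by (cases "x - int i + int i' = 0") auto
    then show "(\<Sum>g<G. a i * cnj (b i') / of_nat G * ?e g (of_int (x - int i + int i')))
       = (if int i = int i' + x then a i * cnj (b i') else 0)"
      unfolding sum_distrib_left[symmetric] sum_roots_of_unity[OF assms(1)] using assms(1) by simp
  qed
  finally show ?thesis .
qed

lemma correlation_self: "correlation L a a 0 = of_real (\<Sum>i<L. (cmod (a i))\<^sup>2)"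
proof -
  have "correlation L a a 0 = (\<Sum>i<L. a i * cnj (a i))"
    by (simp add: correlation_def)
  then show ?thesis by (simp add: complex_norm_square del: of_real_power)
qed

text \<open>The case of equal sequences at lag 0.\<close>

lemma grid_parseval:
  assumes "0 < G" and "L \<le> G"
  shows "(\<Sum>g<G. (cmod (grid_transform G L a g))\<^sup>2) = real G * (\<Sum>i<L. (cmod (a i))\<^sup>2)"
proof -
  have "complex_of_real ((\<Sum>g<G. (cmod (grid_transform G L a g))\<^sup>2) / real G)
      = (\<Sum>g<G. grid_transform G L a g * cnj (grid_transform G L a g) / of_nat G
            * cis (2 * pi * (real g / real G * of_int 0)))"
    by (simp add: complex_norm_square sum_divide_distrib del: of_real_power)
  also have "\<dots> = of_real (\<Sum>i<L. (cmod (a i))\<^sup>2)"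
    using grid_correlation[OF assms(1), of 0 L a a] assms(2) by (simp add: correlation_self)
  finally have "(\<Sum>g<G. (cmod (grid_transform G L a g))\<^sup>2) / real G = (\<Sum>i<L. (cmod (a i))\<^sup>2)"
    by (simp only: of_real_eq_iff)
  then show ?thesis
    using assms(1) by (simp add: field_simps)
qed

context homogeneous_matrix_algebra
begin

text \<open>The grid representation turns the correlation into an exponential sum whose coefficients
  are products of two transforms, divided by G. Cauchy-Schwarz and Parseval bound their l1 norm
  independently of G, hence of the bandwidth W.\<close>

lemma correlation_multiplier:
  assumes "A \<in> S" and A: "spectrum_in A {m. \<bar>m $ j\<bar> \<le> int W}"
  shows "fmult (\<lambda>m. correlation L a b (m $ j)) A \<in> S"
    and "N (fmult (\<lambda>m. correlation L a b (m $ j)) A)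
         \<le> action_bound * (sqrt (\<Sum>i<L. (cmod (a i))\<^sup>2) * sqrt (\<Sum>i<L. (cmod (b i))\<^sup>2)) * N A"
proof -
  \<comment> \<open>Lags up to W do not alias on this grid, and the summand 1 keeps it
    nonempty.\<close>
  define G where "G = L + W + 1"
  have G: "0 < G" "L \<le> G" by (auto simp: G_def)
  define c where "c g = grid_transform G L a g * cnj (grid_transform G L b g) / of_nat G" for g
  have eq: "fmult (\<lambda>m. correlation L a b (m $ j)) A
          = fmult (\<lambda>m. \<Sum>g<G. c g * character ((real g / real G) *\<^sub>R axis j 1) m) A"
  proof (rule fmult_cong_spectrum[OF A])
    fix m :: "int ^ 'a" assume "m \<in> {m. \<bar>m $ j\<bar> \<le> int W}"
    then show "correlation L a b (m $ j) = (\<Sum>g<G. c g * character ((real g / real G) *\<^sub>R axis j 1) m)"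
      using grid_correlation[OF G(1), of "m $ j" L a b]
      by (simp add: c_def character_axis G_def)
  qed
  show "fmult (\<lambda>m. correlation L a b (m $ j)) A \<in> S"
    unfolding eq by (rule exp_sum_bound[OF assms(1)])
  have "(\<Sum>g<G. cmod (c g))
      = (\<Sum>g<G. \<bar>cmod (grid_transform G L a g)\<bar> * \<bar>cmod (grid_transform G L b g)\<bar>) / real G"
    by (simp add: c_def Real_Vector_Spaces.norm_mult norm_divide sum_divide_distrib)
  also have "\<dots> \<le> L2_set (\<lambda>g. cmod (grid_transform G L a g)) {..<G}
                 * L2_set (\<lambda>g. cmod (grid_transform G L b g)) {..<G} / real G"
    by (intro divide_right_mono L2_set_mult_ineq) simp
  also have "\<dots> = sqrt (\<Sum>i<L. (cmod (a i))\<^sup>2) * sqrt (\<Sum>i<L. (cmod (b i))\<^sup>2)"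
    using G(1) by (simp add: L2_set_def grid_parseval[OF G] real_sqrt_mult field_simps)
  finally have "(\<Sum>g<G. cmod (c g)) \<le> sqrt (\<Sum>i<L. (cmod (a i))\<^sup>2) * sqrt (\<Sum>i<L. (cmod (b i))\<^sup>2)" .
  then have "action_bound * (\<Sum>g<G. cmod (c g)) * N A
      \<le> action_bound * (sqrt (\<Sum>i<L. (cmod (a i))\<^sup>2) * sqrt (\<Sum>i<L. (cmod (b i))\<^sup>2)) * N A"
    using norm_nonneg[OF assms(1)] action_bound_pos by (intro mult_right_mono mult_left_mono) auto
  then show "N (fmult (\<lambda>m. correlation L a b (m $ j)) A)
         \<le> action_bound * (sqrt (\<Sum>i<L. (cmod (a i))\<^sup>2) * sqrt (\<Sum>i<L. (cmod (b i))\<^sup>2)) * N A"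
    unfolding eq by (rule order_trans[OF exp_sum_bound(2)[OF assms(1)]])
qed

text \<open>
  Bernstein's inequality. On frequencies \<open>\<bar>x\<bar> \<le> W\<close> the correlation of the indicator a of \<open>[0,3W)\<close> with
  the normalized indicator b of \<open>[W,2W)\<close> is 1, so \<open>e(x) - 1\<close> is a correlation of modulated versions
  of a and b, whose \<open>\<ell>\<^sup>2\<close>-norms are small for small s.
\<close>

lemma bernstein_axis:
  assumes "A \<in> S" and A: "spectrum_in A {m. \<bar>m $ j\<bar> \<le> int W}" and W: "1 \<le> W"
  shows "N (fmult (\<lambda>m. character (s *\<^sub>R axis j 1) m - 1) A) \<le> 20 * pi * action_bound * real W * \<bar>s\<bar> * N A"
proof -
  define e where "e y = cis (2 * pi * (s * y))" for y
  define a b where "a = (\<lambda>i::nat. 1 :: complex)"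
    and "b = (\<lambda>i::nat. if W \<le> i \<and> i < 2 * W then 1 / of_nat W else 0 :: complex)"
  define a1 b1 b2 where "a1 = (\<lambda>i::nat. e i - 1)" and "b1 = (\<lambda>i::nat. b i * e i)"
    and "b2 = (\<lambda>i::nat. b i * (e i - 1))"
  have e_diff: "cmod (e y - 1) \<le> 2 * pi * \<bar>s\<bar> * \<bar>y\<bar>" for y
    using norm_cis_minus_one_le[of "2 * pi * (s * y)"] by (simp add: e_def abs_mult mult_ac)
  \<comment> \<open>For i' in [W, 2W) and |x| \<le> W the partner i = i' + x stays inside [0, 3W),
    so that each such i' contributes exactly 1 / W.\<close>
  have ab: "correlation (3 * W) a b x = 1" if "\<bar>x\<bar> \<le> int W" for x
  proof -
    have "correlation (3 * W) a b x
        = (\<Sum>i'<3*W. \<Sum>i<3*W. if int i = int i' + x then a i * cnj (b i') else 0)"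
      unfolding correlation_def by (rule sum.swap)
    also have "\<dots> = (\<Sum>i'<3*W. b i')"
    proof (rule sum.cong[OF refl])
      fix i' assume "i' \<in> {..<3 * W}"
      show "(\<Sum>i<3*W. if int i = int i' + x then a i * cnj (b i') else 0) = b i'"
      proof (cases "b i' = 0")
        case False
        then have "W \<le> i'" "i' < 2 * W" by (auto simp: b_def split: if_splits)
        then have *: "int i = int i' + x \<longleftrightarrow> i = nat (int i' + x)" and **: "nat (int i' + x) < 3 * W" for i
          using that by auto
        show ?thesis
          unfolding * using ** by (simp add: a_def b_def)
      qed (simp cong: if_cong)
    qed
    also have "\<dots> = (\<Sum>i'\<in>{W..<2*W}. 1 / of_nat W)"
      by (rule sum.mono_neutral_cong_right) (auto simp: b_def)
    also have "\<dots> = 1" using W by simp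
    finally show ?thesis .
  qed
  \<comment> \<open>With x = i - i' the factor e(x) - 1 is split as (e(i) - 1) cnj(e(i')) +
    cnj(e(i') - 1). Each of the two correlations then contains one sequence that is small for small
    s.\<close>
  have eq: "correlation (3 * W) a1 b1 x + correlation (3 * W) a b2 x = e (of_int x) - 1"
    if "\<bar>x\<bar> \<le> int W" for x
  proof -
    have "correlation (3 * W) a1 b1 x + correlation (3 * W) a b2 x
        = (e (of_int x) - 1) * correlation (3 * W) a b x"
      unfolding correlation_def sum_distrib_left sum.distrib[symmetric]
    proof (intro sum.cong refl)
      fix i i' :: nat
      show "(if int i = int i' + x then a1 i * cnj (b1 i') else 0)
          + (if int i = int i' + x then a i * cnj (b2 i') else 0)
          = (e (of_int x) - 1) * (if int i = int i' + x then a i * cnj (b i') else 0)"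
      proof (cases "int i = int i' + x")
        case True
        then have "real i = real i' + of_int x" by linarith
        then have "e i * cnj (e i') = e (of_int x)"
          by (simp add: e_def cis_cnj cis_mult algebra_simps)
        moreover have "a1 i * cnj (b1 i') + a i * cnj (b2 i') = b i' * (e i * cnj (e i') - 1)"
          by (simp add: a1_def b1_def b2_def a_def b_def algebra_simps)
        ultimately show ?thesis using True by (simp add: a_def b_def mult.commute)
      qed simp
    qed
    then show ?thesis by (simp add: ab[OF that])
  qed
  let ?q = "\<lambda>u. sqrt (\<Sum>i<3*W. (cmod (u i))\<^sup>2)"
  have qa: "?q a = sqrt (3 * real W)"
    by (simp add: a_def)
  have qa1: "?q a1 \<le> 6 * pi * \<bar>s\<bar> * real W * sqrt (3 * real W)"
  proof -
    have "(\<Sum>i<3*W. (cmod (a1 i))\<^sup>2) \<le> (\<Sum>i<3*W. (6 * pi * \<bar>s\<bar> * real W)\<^sup>2)"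
    proof (intro sum_mono power_mono)
      fix i assume "i \<in> {..<3*W}"
      then have "2 * pi * \<bar>s\<bar> * \<bar>real i\<bar> \<le> 2 * pi * \<bar>s\<bar> * (3 * real W)"
        by (intro mult_left_mono) auto
      then show "cmod (a1 i) \<le> 6 * pi * \<bar>s\<bar> * real W"
        unfolding a1_def by (intro order_trans[OF e_diff]) (simp add: mult_ac)
    qed simp
    also have "\<dots> = (6 * pi * \<bar>s\<bar> * real W)\<^sup>2 * (3 * real W)" by simp
    finally have "?q a1 \<le> sqrt ((6 * pi * \<bar>s\<bar> * real W)\<^sup>2 * (3 * real W))" by (rule real_sqrt_le_mono)
    also have "\<dots> = 6 * pi * \<bar>s\<bar> * real W * sqrt (3 * real W)"
      unfolding real_sqrt_mult by simp
    finally show ?thesis .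
  qed
  have b_sum: "(\<Sum>i<3*W. (cmod (b i))\<^sup>2) = 1 / real W"
  proof -
    have "(\<Sum>i<3*W. (cmod (b i))\<^sup>2) = (\<Sum>i\<in>{W..<2*W}. (1 / real W)\<^sup>2)"
      by (rule sum.mono_neutral_cong_right) (auto simp: b_def norm_divide)
    also have "\<dots> = 1 / real W" using W by (simp add: power2_eq_square)
    finally show ?thesis .
  qed
  have qb1: "?q b1 = sqrt (1 / real W)"
    by (simp add: b1_def Real_Vector_Spaces.norm_mult e_def b_sum)
  have qb2: "?q b2 \<le> 4 * pi * \<bar>s\<bar> * real W * sqrt (1 / real W)"
  proof -
    have "(\<Sum>i<3*W. (cmod (b2 i))\<^sup>2) \<le> (\<Sum>i<3*W. (4 * pi * \<bar>s\<bar> * real W)\<^sup>2 * (cmod (b i))\<^sup>2)"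
    proof (intro sum_mono)
      fix i
      show "(cmod (b2 i))\<^sup>2 \<le> (4 * pi * \<bar>s\<bar> * real W)\<^sup>2 * (cmod (b i))\<^sup>2"
      proof (cases "b i = 0")
        case False
        then have "real i \<le> 2 * real W" by (auto simp: b_def split: if_splits)
        then have "2 * pi * \<bar>s\<bar> * \<bar>real i\<bar> \<le> 2 * pi * \<bar>s\<bar> * (2 * real W)"
          by (intro mult_left_mono) auto
        then have "cmod (e i - 1) \<le> 4 * pi * \<bar>s\<bar> * real W"
          by (intro order_trans[OF e_diff]) (simp add: mult_ac)
        then have "(cmod (e i - 1))\<^sup>2 \<le> (4 * pi * \<bar>s\<bar> * real W)\<^sup>2"
          by (intro power_mono) auto
        from mult_right_mono[OF this, of "(cmod (b i))\<^sup>2"] show ?thesis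
          unfolding b2_def Real_Vector_Spaces.norm_mult power_mult_distrib
          by (simp add: mult.commute)
      qed (simp add: b2_def)
    qed
    also have "\<dots> = (4 * pi * \<bar>s\<bar> * real W)\<^sup>2 * (1 / real W)"
      by (simp add: b_sum flip: sum_distrib_left)
    finally have "?q b2 \<le> sqrt ((4 * pi * \<bar>s\<bar> * real W)\<^sup>2 * (1 / real W))" by (rule real_sqrt_le_mono)
    also have "\<dots> = 4 * pi * \<bar>s\<bar> * real W * sqrt (1 / real W)"
      unfolding real_sqrt_mult by simp
    finally show ?thesis .
  qed
  have sq: "sqrt (3 * real W) * sqrt (1 / real W) \<le> 2"
  proof -
    have "sqrt (3 * real W) * sqrt (1 / real W) = sqrt 3"
      using W by (simp flip: real_sqrt_mult)
    also have "\<dots> \<le> 2" by (rule real_le_lsqrt) auto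
    finally show ?thesis .
  qed
  \<comment> \<open>The constants 6 and 4 are 2 * 3 and 2 * 2, from the bounds 3W and 2W for the
    indices in \<open>a1\<close> and \<open>b2\<close>; the last factor 2 replaces sqrt 3.\<close>
  have "?q a1 * ?q b1 + ?q a * ?q b2
      \<le> (6 * pi * \<bar>s\<bar> * real W * sqrt (3 * real W)) * sqrt (1 / real W)
       + sqrt (3 * real W) * (4 * pi * \<bar>s\<bar> * real W * sqrt (1 / real W))"
    unfolding qa qb1 by (intro add_mono mult_right_mono mult_left_mono qa1 qb2) auto
  also have "\<dots> = 10 * pi * \<bar>s\<bar> * real W * (sqrt (3 * real W) * sqrt (1 / real W))"
    by (simp add: algebra_simps)
  also have "\<dots> \<le> 10 * pi * \<bar>s\<bar> * real W * 2"
    by (intro mult_left_mono sq) auto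
  finally have q: "?q a1 * ?q b1 + ?q a * ?q b2 \<le> 20 * pi * real W * \<bar>s\<bar>" by (simp add: mult_ac)
  have "N (fmult (\<lambda>m. character (s *\<^sub>R axis j 1) m - 1) A)
      = N (fmult (\<lambda>m. correlation (3 * W) a1 b1 (m $ j) + correlation (3 * W) a b2 (m $ j)) A)"
    using eq by (intro arg_cong[where f = N] fmult_cong_spectrum[OF A]) (simp add: character_axis e_def)
  also have "\<dots> \<le> N (fmult (\<lambda>m. correlation (3 * W) a1 b1 (m $ j)) A)
                    + N (fmult (\<lambda>m. correlation (3 * W) a b2 (m $ j)) A)"
    unfolding fmult_plus by (intro norm_triangle correlation_multiplier[OF assms(1) A])
  also have "\<dots> \<le> action_bound * (?q a1 * ?q b1) * N A + action_bound * (?q a * ?q b2) * N A"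
    by (intro add_mono correlation_multiplier[OF assms(1) A])
  also have "\<dots> = action_bound * N A * (?q a1 * ?q b1 + ?q a * ?q b2)"
    by (simp add: algebra_simps)
  also have "\<dots> \<le> action_bound * N A * (20 * pi * real W * \<bar>s\<bar>)"
    using q action_bound_pos norm_nonneg[OF assms(1)] by (intro mult_left_mono) auto
  finally show ?thesis by (simp add: mult_ac)
qed

text \<open>One factor \<open>action_bound\<close> comes from the correlation multipliers, the other
  from the reduction to the coordinate directions.\<close>

definition bernstein_const :: real where
  "bernstein_const = 20 * pi * action_bound\<^sup>2"

lemma bernstein_const_pos: "0 < bernstein_const"
  using action_bound_pos by (simp add: bernstein_const_def)

definition band :: "nat \<Rightarrow> (int ^ 'a) set" where
  "band W = {m. \<forall>j. \<bar>m $ j\<bar> \<le> int W}"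

lemma bernstein:
  assumes "A \<in> S" and "spectrum_in A (band W)" and "1 \<le> W"
  shows "N (fmult (\<lambda>m. character t m - 1) A) \<le> bernstein_const * real W * norm1 t * N A"
proof -
  have "(\<Sum>j\<in>UNIV. N (fmult (\<lambda>m. character ((t $ j) *\<^sub>R axis j 1) m - 1) A))
      \<le> (\<Sum>j\<in>UNIV. 20 * pi * action_bound * real W * \<bar>t $ j\<bar> * N A)"
    using assms by (intro sum_mono bernstein_axis) (auto simp: band_def intro: spectrum_in_mono)
  also have "\<dots> = 20 * pi * action_bound * real W * norm1 t * N A"
    by (simp add: norm1_def sum_distrib_left sum_distrib_right)
  finally have "action_bound * (\<Sum>j\<in>UNIV. N (fmult (\<lambda>m. character ((t $ j) *\<^sub>R axis j 1) m - 1) A))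
      \<le> action_bound * (20 * pi * action_bound * real W * norm1 t * N A)"
    using action_bound_pos by simp
  with diff1_coordinatewise[OF assms(1), of t] show ?thesis
    by (simp add: bernstein_const_def power2_eq_square mult_ac)
qed

lemma bernstein_difference:
  assumes "A \<in> S" and "spectrum_in A (band W)" and "1 \<le> W"
  shows "N (difference n t A) \<le> (bernstein_const * real W * norm1 t) ^ n * N A"
proof (induction n)
  case (Suc n)
  have "N (difference (Suc n) t A) = N (fmult (\<lambda>m. character t m - 1) (difference n t A))"
    by (simp add: difference_fmult fmult_fmult)
  also have "\<dots> \<le> bernstein_const * real W * norm1 t * N (difference n t A)"
    using assms by (intro bernstein difference_mem) (auto simp: difference_fmult intro: spectrum_in_fmult)
  also have "\<dots> \<le> bernstein_const * real W * norm1 t * ((bernstein_const * real W * norm1 t) ^ n * N A)"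
    using Suc bernstein_const_pos by (intro mult_left_mono) (auto simp: norm1_nonneg)
  finally show ?case by (simp add: mult_ac)
qed (simp add: difference_def)

end

section \<open>Elements on which the action is continuous\<close>

lemma integral_cis_unit_interval:
  fixes x :: int
  shows "(LINT s|lborel. indicator {0..1} s *\<^sub>R cis (2 * pi * (s * of_int x))) = (if x = 0 then 1 else 0)"
    and "integrable lborel (\<lambda>s::real. indicator {0..1} s *\<^sub>R cis (2 * pi * (s * of_int x)))"
proof -
  show "integrable lborel (\<lambda>s::real. indicator {0..1} s *\<^sub>R cis (2 * pi * (s * of_int x)))"
    by (intro borel_integrable_compact continuous_intros) auto
  show "(LINT s|lborel. indicator {0..1} s *\<^sub>R cis (2 * pi * (s * of_int x))) = (if x = 0 then 1 else 0)"
  proof (cases "x = 0")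
    case False
    define c where "c = 2 * pi * of_int x"
    have c: "c \<noteq> 0" using False by (simp add: c_def)
    define F where "F s = cis (c * s) / (\<i> * of_real c)" for s
    have F: "(F has_vector_derivative cis (c * s)) (at s within {0..1})" for s
    proof -
      have "((\<lambda>s. cis (c * s)) has_derivative (\<lambda>t. (c * t) *\<^sub>R (\<i> * cis (c * s)))) (at s within {0..1})"
        by (rule has_derivative_cis) (auto intro!: derivative_eq_intros)
      then have "((\<lambda>s. cis (c * s)) has_vector_derivative c *\<^sub>R (\<i> * cis (c * s))) (at s within {0..1})"
        by (simp add: has_vector_derivative_def mult.commute)
      from has_vector_derivative_divide[OF this, of "\<i> * of_real c"] show ?thesis
        using c by (simp add: F_def[abs_def] scaleR_conv_of_real)
    qed
    have "(LINT s|lborel. indicator {0..1} s *\<^sub>R cis (c * s)) = F 1 - F 0"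
      by (rule integral_FTC_Icc) (auto intro!: F continuous_intros)
    also have "F 1 = F 0"
      by (simp add: F_def c_def cis_multiple_2pi)
    finally show ?thesis using False by (simp add: c_def mult_ac)
  qed simp
qed

context homogeneous_matrix_algebra
begin

text \<open>The subspace of strong continuity. With \<open>nhds 0\<close> in place of
  \<open>at 0\<close> the limit composes with functions that take the value 0; at t = 0 the norm is
  0 anyway.\<close>

definition continuous_elements :: "'a zmat set" where
  "continuous_elements = {A \<in> S. ((\<lambda>t. N (fmult (\<lambda>m. character t m - 1) A)) \<longlongrightarrow> 0) (nhds 0)}"

lemma continuous_mem: "A \<in> continuous_elements \<Longrightarrow> A \<in> S"
  by (simp add: continuous_elements_def)

lemma continuous_tendsto:
  "A \<in> continuous_elements \<Longrightarrow> (f \<longlongrightarrow> 0) F \<Longrightarrow> ((\<lambda>x. N (fmult (\<lambda>m. character (f x) m - 1) A)) \<longlongrightarrow> 0) F"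
  unfolding continuous_elements_def by (auto intro: filterlim_compose)

lemma continuous_elementsI:
  assumes "A \<in> S" and "\<And>e. 0 < e \<Longrightarrow> \<exists>d>0. \<forall>t. norm1 t \<le> d \<longrightarrow> N (fmult (\<lambda>m. character t m - 1) A) < e"
  shows "A \<in> continuous_elements"
proof -
  have "((\<lambda>t. N (fmult (\<lambda>m. character t m - 1) A)) \<longlongrightarrow> 0) (nhds 0)"
    unfolding tendsto_iff
  proof (intro allI impI)
    fix e :: real assume "0 < e"
    with assms(2) obtain d where d: "0 < d" "\<And>t. norm1 t \<le> d \<Longrightarrow> N (fmult (\<lambda>m. character t m - 1) A) < e"
      by blast
    have "\<forall>\<^sub>F t in nhds (0 :: real ^ 'a). dist t 0 < d / real CARD('a)"
      unfolding eventually_nhds_metric using d(1) by (intro exI[of _ "d / real CARD('a)"]) auto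
    then show "\<forall>\<^sub>F t in nhds 0. dist (N (fmult (\<lambda>m. character t m - 1) A)) 0 < e"
    proof eventually_elim
      case (elim t)
      then have "real CARD('a) * norm t \<le> d" by (simp add: field_simps)
      then have "norm1 t \<le> d" using norm1_le_norm[of t] by linarith
      then show ?case
        using d(2) norm_nonneg[OF diff1_mem[OF assms(1)]] by (simp add: dist_real_def)
    qed
  qed
  then show ?thesis using assms(1) by (simp add: continuous_elements_def)
qed

lemma band_mono: "V \<le> W \<Longrightarrow> band V \<subseteq> band W"
  unfolding band_def by (auto intro: order_trans)

text \<open>Bernstein's inequality gives a bound linear in \<open>norm1 t\<close>. It is applied
  with \<open>Suc W\<close> because it asks for a positive bandwidth.\<close>

lemma banded_continuous:
  assumes "A \<in> S" and "spectrum_in A (band W)"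
  shows "A \<in> continuous_elements"
proof (rule continuous_elementsI[OF assms(1)])
  fix e :: real assume "0 < e"
  define K where "K = bernstein_const * real (Suc W) * N A + 1"
  have K: "1 \<le> K" using bernstein_const_pos norm_nonneg[OF assms(1)] by (simp add: K_def)
  have "N (fmult (\<lambda>m. character t m - 1) A) < e" if "norm1 t \<le> e / (2 * K)" for t
  proof -
    have "N (fmult (\<lambda>m. character t m - 1) A) \<le> bernstein_const * real (Suc W) * norm1 t * N A"
      by (intro bernstein assms(1) spectrum_in_mono[OF assms(2)] band_mono) auto
    also have "\<dots> = (K - 1) * norm1 t"
      by (simp add: K_def)
    also have "\<dots> \<le> K * (e / (2 * K))"
      using that K norm1_nonneg[of t] by (intro mult_mono) auto
    also have "\<dots> < e" using K \<open>0 < e\<close> by simp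
    finally show ?thesis .
  qed
  then show "\<exists>d>0. \<forall>t. norm1 t \<le> d \<longrightarrow> N (fmult (\<lambda>m. character t m - 1) A) < e"
    using K \<open>0 < e\<close> by (intro exI[of _ "e / (2 * K)"]) auto
qed

text \<open>Uniform boundedness of the action controls the contribution of A - X for all t
  simultaneously, which makes the set of continuous elements closed.\<close>

lemma continuous_limit:
  assumes "\<And>e. 0 < e \<Longrightarrow> \<exists>X\<in>continuous_elements. N (A - X) < e" and "A \<in> S"
  shows "A \<in> continuous_elements"
proof -
  have "((\<lambda>t. N (fmult (\<lambda>m. character t m - 1) A)) \<longlongrightarrow> 0) (nhds 0)"
    unfolding tendsto_iff
  proof (intro allI impI)
    fix e :: real assume e: "0 < e"
    define K where "K = action_bound + 1"
    have K: "0 < K" using action_bound_pos by (simp add: K_def)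
    then obtain X where X: "X \<in> continuous_elements" "N (A - X) < e / (2 * K)"
      using assms(1)[of "e / (2 * K)"] e by auto
    have XS: "X \<in> S" "A - X \<in> S" using X(1) assms(2) by (auto simp: continuous_mem diff_mem)
    have "\<forall>\<^sub>F t in nhds 0. N (fmult (\<lambda>m. character t m - 1) X) < e / 2"
      using continuous_tendsto[OF X(1) filterlim_ident] e by (intro order_tendstoD(2)) auto
    then show "\<forall>\<^sub>F t in nhds 0. dist (N (fmult (\<lambda>m. character t m - 1) A)) 0 < e"
    proof eventually_elim
      case (elim t)
      have "fmult (\<lambda>m. character t m - 1) A
          = fmult (\<lambda>m. character t m - 1) X + fmult (\<lambda>m. character t m - 1) (A - X)"
        by (simp add: fmult_diff_right)
      then have "N (fmult (\<lambda>m. character t m - 1) A)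
          \<le> N (fmult (\<lambda>m. character t m - 1) X) + N (fmult (\<lambda>m. character t m - 1) (A - X))"
        using norm_triangle[OF diff1_mem[OF XS(1)] diff1_mem[OF XS(2)], of t t] by metis
      also have "\<dots> \<le> N (fmult (\<lambda>m. character t m - 1) X) + K * N (A - X)"
        using diff1_bound[OF XS(2), of t] by (simp add: K_def)
      also have "K * N (A - X) \<le> K * (e / (2 * K))"
        using X(2) K by (intro mult_left_mono) auto
      finally show ?case
        using elim K norm_nonneg[OF diff1_mem[OF assms(2)], of t] by (simp add: dist_real_def)
    qed
  qed
  then show ?thesis using assms(2) by (simp add: continuous_elements_def)
qed

text \<open>Multipliers commute with the action, so that the modulus of continuity of the image is
  at most K times that of A. The bound is assumed on continuous elements and is applied to the
  differences of A, which therefore have to be shown continuous beforehand.\<close>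

lemma fmult_continuous:
  assumes "\<And>X. X \<in> continuous_elements \<Longrightarrow> fmult \<mu> X \<in> S"
    and "\<And>X. X \<in> continuous_elements \<Longrightarrow> N (fmult \<mu> X) \<le> K * N X"
    and "A \<in> continuous_elements"
  shows "fmult \<mu> A \<in> continuous_elements"
proof -
  have cont: "fmult (\<lambda>m. character t m - 1) A \<in> continuous_elements" for t
  proof -
    have "((\<lambda>s. (action_bound + 1) * N (fmult (\<lambda>m. character s m - 1) A)) \<longlongrightarrow> 0) (nhds 0)"
      using assms(3) by (intro tendsto_mult_right_zero) (simp add: continuous_elements_def)
    moreover have "norm (N (fmult (\<lambda>m. character s m - 1) (fmult (\<lambda>m. character t m - 1) A)))
        \<le> (action_bound + 1) * N (fmult (\<lambda>m. character s m - 1) A)" for s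
    proof -
      have "N (fmult (\<lambda>m. character s m - 1) (fmult (\<lambda>m. character t m - 1) A))
          = N (fmult (\<lambda>m. character t m - 1) (fmult (\<lambda>m. character s m - 1) A))"
        by (rule arg_cong[OF fmult_commute])
      moreover have "N (fmult (\<lambda>m. character t m - 1) (fmult (\<lambda>m. character s m - 1) A))
          \<le> (action_bound + 1) * N (fmult (\<lambda>m. character s m - 1) A)"
        by (intro diff1_bound diff1_mem continuous_mem assms(3))
      moreover have "0 \<le> N (fmult (\<lambda>m. character t m - 1) (fmult (\<lambda>m. character s m - 1) A))"
        by (intro norm_nonneg diff1_mem continuous_mem assms(3))
      ultimately show ?thesis by simp
    qed
    ultimately have "((\<lambda>s. N (fmult (\<lambda>m. character s m - 1) (fmult (\<lambda>m. character t m - 1) A))) \<longlongrightarrow> 0) (nhds 0)"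
      by (rule Lim_null_comparison[OF always_eventually[OF allI], rotated])
    then show ?thesis
      using diff1_mem[OF continuous_mem[OF assms(3)]] by (simp add: continuous_elements_def)
  qed
  have "((\<lambda>t. K * N (fmult (\<lambda>m. character t m - 1) A)) \<longlongrightarrow> 0) (nhds 0)"
    using assms(3) by (intro tendsto_mult_right_zero) (simp add: continuous_elements_def)
  moreover have "norm (N (fmult (\<lambda>m. character t m - 1) (fmult \<mu> A)))
      \<le> K * N (fmult (\<lambda>m. character t m - 1) A)" for t
    unfolding fmult_commute[of "\<lambda>m. character t m - 1" \<mu> A]
    using assms(2)[OF cont, of t] norm_nonneg[OF assms(1)[OF cont, of t]] by simp
  ultimately have "((\<lambda>t. N (fmult (\<lambda>m. character t m - 1) (fmult \<mu> A))) \<longlongrightarrow> 0) (nhds 0)"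
    by (rule Lim_null_comparison[OF always_eventually[OF allI], rotated])
  then show ?thesis
    using assms(1)[OF assms(3)] by (simp add: continuous_elements_def)
qed

lemma difference_continuous: "A \<in> continuous_elements \<Longrightarrow> difference n t A \<in> continuous_elements"
  unfolding difference_fmult
  by (rule fmult_continuous[where K = "(action_bound + 1) ^ n"])
    (auto simp flip: difference_fmult intro: difference_mem difference_bound continuous_mem)

section \<open>Multipliers given by integrals of characters\<close>

text \<open>Grouping the points by their value under \<open>P\<close> turns the integral into a
  finite sum of the symbols \<open>T y\<close>, with the integrals of f over the level sets as
  coefficients. A general family \<open>T\<close> admits differences of two characters as well as
  single ones.\<close>

lemma simple_multiplier:
  fixes f :: "'b \<Rightarrow> complex" and P :: "'b \<Rightarrow> 'c"
  assumes f: "integrable M f" and P: "simple_function M P"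
    and T: "\<And>y. fmult (T y) A \<in> S"
  shows "fmult (\<lambda>m. LINT x|M. f x * T (P x) m) A \<in> S"
    and "N (fmult (\<lambda>m. LINT x|M. f x * T (P x) m) A) \<le> (LINT x|M. cmod (f x) * N (fmult (T (P x)) A))"
proof -
  let ?Y = "P ` space M"
  let ?I = "\<lambda>y x. indicator (P -` {y} \<inter> space M) x"
  have fin: "finite ?Y" and sets: "\<And>y. P -` {y} \<inter> space M \<in> sets M"
    using simple_functionD[OF P] by auto
  define c where "c y = (LINT x|M. ?I y x *\<^sub>R f x)" for y
  have int: "integrable M (\<lambda>x. ?I y x *\<^sub>R f x)" for y
    using f sets by (intro integrable_mult_indicator) auto
  have intn: "integrable M (\<lambda>x. ?I y x * cmod (f x))" for y
    using integrable_mult_indicator[OF sets[of y] integrable_norm[OF f]] by simp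
  have decomp: "g (P x) = (\<Sum>y\<in>?Y. ?I y x * g y)" if "x \<in> space M" for x and g :: "'c \<Rightarrow> 'x::real_normed_field"
  proof -
    have "(\<Sum>y\<in>?Y. ?I y x * g y) = (\<Sum>y\<in>?Y. if y = P x then g y else 0)"
      using that by (intro sum.cong) (auto simp: indicator_def)
    then show ?thesis using fin that by simp
  qed
  have eq: "(LINT x|M. f x * T (P x) m) = (\<Sum>y\<in>?Y. c y * T y m)" for m
  proof -
    have "(LINT x|M. f x * T (P x) m) = (LINT x|M. (\<Sum>y\<in>?Y. (?I y x *\<^sub>R f x) * T y m))"
    proof (rule Bochner_Integration.integral_cong[OF refl])
      fix x assume "x \<in> space M"
      then show "f x * T (P x) m = (\<Sum>y\<in>?Y. (?I y x *\<^sub>R f x) * T y m)"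
        unfolding decomp[of x "\<lambda>y. T y m", OF \<open>x \<in> space M\<close>] sum_distrib_left
        by (intro sum.cong) (auto simp: indicator_def)
    qed
    also have "\<dots> = (\<Sum>y\<in>?Y. c y * T y m)"
      unfolding c_def using int
      by (subst Bochner_Integration.integral_sum) (auto simp del: mult_scaleR_left)
    finally show ?thesis .
  qed
  show "fmult (\<lambda>m. LINT x|M. f x * T (P x) m) A \<in> S"
    unfolding eq by (rule N_scaled_sum_le(1)[OF T])
  have "N (fmult (\<lambda>m. LINT x|M. f x * T (P x) m) A) \<le> (\<Sum>y\<in>?Y. cmod (c y) * N (fmult (T y) A))"
    unfolding eq by (rule N_scaled_sum_le(2)[OF T])
  also have "\<dots> \<le> (\<Sum>y\<in>?Y. (LINT x|M. ?I y x * cmod (f x)) * N (fmult (T y) A))"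
  proof (intro sum_mono mult_right_mono norm_nonneg T)
    fix y
    have "cmod (c y) \<le> (LINT x|M. cmod (?I y x *\<^sub>R f x))"
      unfolding c_def by (rule integral_norm_bound)
    then show "cmod (c y) \<le> (LINT x|M. ?I y x * cmod (f x))" by simp
  qed
  also have "\<dots> = (LINT x|M. (\<Sum>y\<in>?Y. (?I y x * cmod (f x)) * N (fmult (T y) A)))"
    using intn by (subst Bochner_Integration.integral_sum) auto
  also have "\<dots> = (LINT x|M. cmod (f x) * N (fmult (T (P x)) A))"
  proof (rule Bochner_Integration.integral_cong[OF refl])
    fix x assume "x \<in> space M"
    then show "(\<Sum>y\<in>?Y. (?I y x * cmod (f x)) * N (fmult (T y) A)) = cmod (f x) * N (fmult (T (P x)) A)"
      using decomp[of x "\<lambda>y. N (fmult (T y) A)"] by (simp add: sum_distrib_left mult_ac)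
  qed
  finally show "N (fmult (\<lambda>m. LINT x|M. f x * T (P x) m) A) \<le> (LINT x|M. cmod (f x) * N (fmult (T (P x)) A))" .
qed

text \<open>The map \<tau> is approximated by simple functions, for which the integral is a finite
  exponential sum bounded by the L1 norm of f. Continuity of the action makes the approximations a
  Cauchy sequence, and scalar dominated convergence identifies the limit entry by entry.\<close>

lemma integral_multiplier:
  fixes f :: "'b \<Rightarrow> complex" and \<tau> :: "'b \<Rightarrow> real ^ 'a"
  assumes A: "A \<in> continuous_elements" and f: "integrable M f" and \<tau>: "\<tau> \<in> borel_measurable M"
  shows "fmult (\<lambda>m. LINT x|M. f x * character (\<tau> x) m) A \<in> S"
    and "N (fmult (\<lambda>m. LINT x|M. f x * character (\<tau> x) m) A) \<le> action_bound * (LINT x|M. cmod (f x)) * N A"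
proof -
  note AS = continuous_mem[OF A]
  from borel_measurable_implies_sequence_metric[OF \<tau>, of 0]
  obtain F where "\<forall>i. simple_function M (F i)" "\<forall>x\<in>space M. (\<lambda>i. F i x) \<longlonglongrightarrow> \<tau> x"
    by (elim exE conjE)
  then have F: "\<And>i. simple_function M (F i)" "\<And>x. x \<in> space M \<Longrightarrow> (\<lambda>i. F i x) \<longlonglongrightarrow> \<tau> x"
    by simp_all
  define X where "X i = fmult (\<lambda>m. LINT x|M. f x * character (F i x) m) A" for i
  have fm[measurable]: "f \<in> borel_measurable M" using f by auto
  have chm: "(\<lambda>x. character (F i x) m) \<in> borel_measurable M" for i m
    using borel_measurable_simple_function[OF simple_function_compose[OF F(1)[of i], of "\<lambda>t. character t m"]]
    by (simp add: comp_def)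
  have ch_lim: "(\<lambda>i. character (F i x) m) \<longlonglongrightarrow> character (\<tau> x) m" if "x \<in> space M" for x m
    unfolding character_def by (intro tendsto_intros F that)
  have ch\<tau>: "(\<lambda>x. character (\<tau> x) m) \<in> borel_measurable M" for m
    by (rule borel_measurable_LIMSEQ_metric[OF chm ch_lim])
  have lim: "(\<lambda>i. LINT x|M. f x * character (F i x) m) \<longlonglongrightarrow> (LINT x|M. f x * character (\<tau> x) m)" for m
  proof (rule integral_dominated_convergence[where w = "\<lambda>x. cmod (f x)"])
    show "AE x in M. (\<lambda>i. f x * character (F i x) m) \<longlonglongrightarrow> f x * character (\<tau> x) m"
      by (intro AE_I2 tendsto_mult tendsto_const ch_lim)
  qed (use f chm ch\<tau> in \<open>auto simp: Real_Vector_Spaces.norm_mult\<close>)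
  have XS: "X i \<in> S" for i
    unfolding X_def by (rule simple_multiplier(1)[OF f F(1)]) (rule character_mem[OF AS])
  have XN: "N (X i) \<le> action_bound * (LINT x|M. cmod (f x)) * N A" for i
  proof -
    have "N (X i) \<le> (LINT x|M. cmod (f x) * N (fmult (character (F i x)) A))"
      unfolding X_def by (rule simple_multiplier(2)[OF f F(1)]) (rule character_mem[OF AS])
    also have "\<dots> \<le> (LINT x|M. cmod (f x) * (action_bound * N A))"
    proof (rule integral_mono)
      have "(\<lambda>x. N (fmult (character (F i x)) A)) \<in> borel_measurable M"
        using borel_measurable_simple_function[OF simple_function_compose[OF F(1)[of i], of "\<lambda>t. N (fmult (character t) A)"]]
        by (simp add: comp_def)
      then have "(\<lambda>x. cmod (f x) * N (fmult (character (F i x)) A)) \<in> borel_measurable M"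
        by simp
      then show "integrable M (\<lambda>x. cmod (f x) * N (fmult (character (F i x)) A))"
      proof (rule Bochner_Integration.integrable_bound[where f = "\<lambda>x. cmod (f x) * (action_bound * N A)", rotated])
        show "AE x in M. norm (cmod (f x) * N (fmult (character (F i x)) A)) \<le> norm (cmod (f x) * (action_bound * N A))"
          using character_bound[OF AS] norm_nonneg[OF character_mem[OF AS]] norm_nonneg[OF AS] action_bound_pos
          by (intro AE_I2) (simp add: abs_mult mult_left_mono)
      qed (use f in auto)
      show "integrable M (\<lambda>x. cmod (f x) * (action_bound * N A))" using f by auto
    qed (intro mult_left_mono character_bound AS; simp)
    also have "\<dots> = action_bound * (LINT x|M. cmod (f x)) * N A" by simp
    finally show ?thesis .
  qed
  \<comment> \<open>Failure of the Cauchy property yields two index sequences tending to infinity,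
    along which dominated convergence applies.\<close>
  have cauchy: "\<exists>K. \<forall>a\<ge>K. \<forall>b\<ge>K. N (X a - X b) < e" if "0 < e" for e
  proof (rule ccontr)
    assume "\<not> ?thesis"
    then have "\<forall>k. \<exists>a\<ge>k. \<exists>b\<ge>k. e \<le> N (X a - X b)" by (metis not_less)
    then obtain a b where ab: "\<And>k. a k \<ge> k" "\<And>k. b k \<ge> k" "\<And>k. e \<le> N (X (a k) - X (b k))"
      by metis
    have to_top: "filterlim a at_top sequentially" "filterlim b at_top sequentially"
      using ab by (auto intro!: filterlim_at_top_mono[OF filterlim_ident])
    define T where "T y m = character (fst y) m - character (snd y) m" for y :: "(real ^ 'a) \<times> (real ^ 'a)" and m
    have T: "fmult (T y) A \<in> S" for y
      unfolding T_def[abs_def] by (simp add: fmult_minus diff_mem character_mem AS)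
    \<comment> \<open>Writing e(u) - e(v) as e(v) (e(u - v) - 1) reduces the comparison of two
      characters to continuity at 0.\<close>
    have T_split: "fmult (T (u, v)) A = fmult (character v) (fmult (\<lambda>m. character (u - v) m - 1) A)" for u v
    proof -
      have "character u m = character v m * character (u - v) m" for m
        using character_add[of v "u - v" m] by simp
      then show ?thesis by (simp add: T_def[abs_def] fmult_fmult right_diff_distrib)
    qed
    have T_le: "N (fmult (T (u, v)) A) \<le> action_bound * N (fmult (\<lambda>m. character (u - v) m - 1) A)" for u v
      unfolding T_split by (rule character_bound[OF diff1_mem[OF AS]])
    define P where "P k x = (F (a k) x, F (b k) x)" for k x
    have P: "simple_function M (P k)" for k
      unfolding P_def by (intro simple_function_Pair F)
    define h where "h k x = cmod (f x) * N (fmult (T (P k x)) A)" for k x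
    \<comment> \<open>Measurability comes from the finitely many values of \<open>P k\<close>,
      without any examination of the orbit norm as a function of t.\<close>
    have hm: "h k \<in> borel_measurable M" for k
      using borel_measurable_simple_function[OF simple_function_compose[OF P[of k], of "\<lambda>y. N (fmult (T y) A)"]]
      unfolding h_def[abs_def] by (intro borel_measurable_times) (auto simp: comp_def)
    have h_le: "h k x \<le> cmod (f x) * (action_bound * ((action_bound + 1) * N A))" for k x
      unfolding h_def P_def using action_bound_pos diff1_bound[OF AS]
      by (intro mult_left_mono order_trans[OF T_le]) auto
    have h_ge: "0 \<le> h k x" for k x
      unfolding h_def using T norm_nonneg by simp
    have "(\<lambda>k. LINT x|M. h k x) \<longlonglongrightarrow> (LINT x|M. 0)"
    proof (rule integral_dominated_convergence[where w = "\<lambda>x. cmod (f x) * (action_bound * ((action_bound + 1) * N A))"])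
      show "AE x in M. (\<lambda>k. h k x) \<longlonglongrightarrow> 0"
      proof (rule AE_I2)
        fix x assume x: "x \<in> space M"
        have "(\<lambda>k. F (a k) x - F (b k) x) \<longlonglongrightarrow> \<tau> x - \<tau> x"
          by (intro tendsto_diff filterlim_compose[OF F(2)[OF x]] to_top)
        then have "(\<lambda>k. N (fmult (\<lambda>m. character (F (a k) x - F (b k) x) m - 1) A)) \<longlonglongrightarrow> 0"
          by (intro continuous_tendsto[OF A]) simp
        then have "(\<lambda>k. cmod (f x) * (action_bound * N (fmult (\<lambda>m. character (F (a k) x - F (b k) x) m - 1) A))) \<longlonglongrightarrow> 0"
          by (intro tendsto_mult_right_zero)
        then show "(\<lambda>k. h k x) \<longlonglongrightarrow> 0"
        proof (rule Lim_null_comparison[rotated], intro always_eventually allI)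
          fix k
          show "norm (h k x) \<le> cmod (f x) * (action_bound * N (fmult (\<lambda>m. character (F (a k) x - F (b k) x) m - 1) A))"
            using h_ge[of k x] T_le by (simp add: h_def P_def mult_left_mono)
        qed
      qed
    qed (use hm h_le h_ge f in auto)
    then have "(\<lambda>k. LINT x|M. h k x) \<longlonglongrightarrow> 0" by simp
    then obtain k where k: "(LINT x|M. h k x) < e"
      using order_tendstoD(2)[of _ 0 sequentially e] \<open>0 < e\<close> eventually_happens by fastforce
    have "X (a k) - X (b k) = fmult (\<lambda>m. LINT x|M. f x * T (P k x) m) A"
    proof -
      have "(LINT x|M. f x * T (P k x) m)
          = (LINT x|M. f x * character (F (a k) x) m) - (LINT x|M. f x * character (F (b k) x) m)" for m
      proof -
        have int: "integrable M (\<lambda>x. f x * character (F i x) m)" for i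
          using f chm[of i m] by (auto intro: Bochner_Integration.integrable_bound[OF f] simp: Real_Vector_Spaces.norm_mult)
        show ?thesis
          using Bochner_Integration.integral_diff[OF int int, of "a k" "b k"]
          by (simp add: T_def P_def right_diff_distrib)
      qed
      then show ?thesis by (simp add: X_def fmult_minus)
    qed
    then have "N (X (a k) - X (b k)) \<le> (LINT x|M. h k x)"
      unfolding h_def using simple_multiplier(2)[OF f P T] by simp
    with ab(3)[of k] k show False by linarith
  qed
  have entries: "(\<lambda>i. X i k l) \<longlonglongrightarrow> fmult (\<lambda>m. LINT x|M. f x * character (\<tau> x) m) A k l" for k l
    unfolding X_def fmult_def by (intro tendsto_mult lim tendsto_const)
  note lim_X = limit_in_algebra[OF XS cauchy entries]
  show "fmult (\<lambda>m. LINT x|M. f x * character (\<tau> x) m) A \<in> S"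
    by (rule lim_X(1))
  show "N (fmult (\<lambda>m. LINT x|M. f x * character (\<tau> x) m) A) \<le> action_bound * (LINT x|M. cmod (f x)) * N A"
    by (rule N_le_of_tendsto[OF XS lim_X XN])
qed

text \<open>Integration over one period against the conjugate character in direction j selects the
  frequencies with \<open>m $ j = n\<close>, and the density has L1 norm 1.\<close>

lemma coordinate_projection:
  assumes "A \<in> continuous_elements"
  shows "fmult (\<lambda>m. if m $ j = n then 1 else 0) A \<in> continuous_elements"
    and "N (fmult (\<lambda>m. if m $ j = n then 1 else 0) A) \<le> action_bound * N A"
proof -
  define f where "f s = indicator {0..1} s *\<^sub>R cis (2 * pi * (s * of_int (- n)))" for s :: real
  define \<tau> :: "real \<Rightarrow> real ^ 'a" where "\<tau> s = s *\<^sub>R axis j 1" for s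
  have eq: "(LINT s|lborel. f s * character (\<tau> s) m) = (if m $ j = n then 1 else 0)" for m
  proof -
    have "f s * character (\<tau> s) m = indicator {0..1} s *\<^sub>R cis (2 * pi * (s * of_int (m $ j - n)))" for s
      by (simp add: f_def \<tau>_def character_axis cis_mult algebra_simps)
    then show ?thesis using integral_cis_unit_interval(1)[of "m $ j - n"] by simp
  qed
  have f: "integrable lborel f" unfolding f_def by (rule integral_cis_unit_interval)
  have "(LINT s|lborel. cmod (f s)) = (LINT s|lborel. indicator {0..1::real} s)"
    by (intro Bochner_Integration.integral_cong) (auto simp: f_def indicator_def)
  then have f1: "(LINT s|lborel. cmod (f s)) = 1" by simp
  have \<tau>: "\<tau> \<in> borel_measurable lborel" unfolding \<tau>_def by measurable
  have bnd: "fmult (\<lambda>m. if m $ j = n then 1 else 0) X \<in> S"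
    "N (fmult (\<lambda>m. if m $ j = n then 1 else 0) X) \<le> action_bound * N X"
    if "X \<in> continuous_elements" for X
    using integral_multiplier[OF that f \<tau>] unfolding eq f1 by simp_all
  show "fmult (\<lambda>m. if m $ j = n then 1 else 0) A \<in> continuous_elements"
    by (rule fmult_continuous[OF bnd assms])
  show "N (fmult (\<lambda>m. if m $ j = n then 1 else 0) A) \<le> action_bound * N A"
    by (rule bnd(2)[OF assms])
qed

text \<open>A single frequency is the intersection of the hyperplanes that fix one coordinate each,
  so that a side diagonal is a composition of coordinate projections.\<close>

lemma side_diag_continuous:
  assumes "A \<in> continuous_elements"
  shows "side_diag m A \<in> continuous_elements"
    and "N (side_diag m A) \<le> action_bound ^ CARD('a) * N A"
proof -
  have "fmult (\<lambda>x. if \<forall>j\<in>J. x $ j = m $ j then 1 else 0) A \<in> continuous_elements \<and>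
        N (fmult (\<lambda>x. if \<forall>j\<in>J. x $ j = m $ j then 1 else 0) A) \<le> action_bound ^ card J * N A"
    if "finite J" for J
    using that
  proof induction
    case (insert j J)
    let ?B = "fmult (\<lambda>x. if \<forall>j\<in>J. x $ j = m $ j then 1 else 0) A"
    have eq: "fmult (\<lambda>x. if \<forall>j\<in>insert j J. x $ j = m $ j then 1 else 0) A
        = fmult (\<lambda>x. if x $ j = m $ j then 1 else 0) ?B"
      unfolding fmult_fmult by (rule arg_cong[where f = "\<lambda>\<mu>. fmult \<mu> A"]) auto
    have "N (fmult (\<lambda>x. if x $ j = m $ j then 1 else 0) ?B) \<le> action_bound * N ?B"
      using insert.IH by (intro coordinate_projection) auto
    also have "\<dots> \<le> action_bound * (action_bound ^ card J * N A)"
      using insert.IH action_bound_pos by (intro mult_left_mono) auto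
    finally show ?case
      unfolding eq using insert coordinate_projection(1)[of ?B] by simp
  qed (use assms in simp)
  from this[of UNIV] show "side_diag m A \<in> continuous_elements"
    and "N (side_diag m A) \<le> action_bound ^ CARD('a) * N A"
    by (simp_all add: side_diag_fmult vec_eq_iff)
qed

text \<open>
  Marchaud's argument: the factorization \<open>(z\<^sup>2 - 1)\<^sup>k = (z + 1)\<^sup>k (z - 1)\<^sup>k\<close>, in which \<open>(z + 1)\<^sup>k - 2\<^sup>k\<close> is divisible
  by \<open>z - 1\<close>, bounds \<open>\<Delta>\<^sub>t\<^sup>k\<close> by \<open>2\<^sup>-\<^sup>k \<Delta>\<^bsub>2t\<^esub>\<^sup>k\<close> and \<open>\<Delta>\<^sub>t\<^bsup>k+1\<^esup>\<close>.
\<close>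

lemma difference_doubling:
  assumes "1 \<le> k"
  shows "\<exists>C\<ge>0. \<forall>A\<in>S. \<forall>t. N (difference k t A) \<le> N (difference k (2 *\<^sub>R t) A) / 2 + C * N (difference (Suc k) t A)"
proof -
  \<comment> \<open>The quotient of w^k - 2^k by w - 2 at w = z + 1, where w - 2 = z - 1.\<close>
  define Q where "Q z = (\<Sum>i<k. (z + 1) ^ i * 2 ^ (k - Suc i))" for z :: complex
  have Q: "(z + 1) ^ k - 2 ^ k = (z - 1) * Q z" for z
    using diff_power_eq_sum[of "z + 1" "k - 1" 2] assms unfolding Q_def by (simp add: algebra_simps)
  define C where "C = (\<Sum>i<k. (action_bound + 1) ^ i * 2 ^ (k - Suc i))"
  have C: "0 \<le> C" unfolding C_def using action_bound_pos by (intro sum_nonneg) auto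
  have plus_power: "fmult (\<lambda>m. (character t m + 1) ^ i) B \<in> S \<and>
      N (fmult (\<lambda>m. (character t m + 1) ^ i) B) \<le> (action_bound + 1) ^ i * N B" if B: "B \<in> S" for t i B
  proof (induction i)
    case (Suc i)
    let ?X = "fmult (\<lambda>m. (character t m + 1) ^ i) B"
    have eq: "fmult (\<lambda>m. (character t m + 1) ^ Suc i) B = fmult (character t) ?X + ?X"
      by (simp add: fmult_fmult flip: fmult_plus) (simp add: algebra_simps)
    have "N (fmult (character t) ?X + ?X) \<le> action_bound * N ?X + N ?X"
      using Suc norm_triangle[OF character_mem, of ?X ?X t] character_bound[of ?X t] by fastforce
    also have "\<dots> = (action_bound + 1) * N ?X" by (simp add: distrib_right)
    also have "\<dots> \<le> (action_bound + 1) * ((action_bound + 1) ^ i * N B)"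
      using Suc action_bound_pos by (intro mult_left_mono) auto
    finally have "N (fmult (character t) ?X + ?X) \<le> (action_bound + 1) ^ Suc i * N B" by simp
    then have "N (fmult (\<lambda>m. (character t m + 1) ^ Suc i) B) \<le> (action_bound + 1) ^ Suc i * N B"
      by (subst eq)
    moreover have "fmult (\<lambda>m. (character t m + 1) ^ Suc i) B \<in> S"
      by (subst eq) (intro add_mem character_mem; use Suc in simp)
    ultimately show ?case by blast
  qed (use B in simp)
  have Q_bound: "fmult (\<lambda>m. Q (character t m)) B \<in> S" "N (fmult (\<lambda>m. Q (character t m)) B) \<le> C * N B"
    if B: "B \<in> S" for t B
  proof -
    have eq: "Q (character t m) = (\<Sum>i<k. 2 ^ (k - Suc i) * (character t m + 1) ^ i)" for m
      by (simp add: Q_def mult.commute)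
    show "fmult (\<lambda>m. Q (character t m)) B \<in> S"
      unfolding eq by (intro N_scaled_sum_le(1)) (simp add: plus_power[OF B])
    have "N (fmult (\<lambda>m. Q (character t m)) B)
        \<le> (\<Sum>i<k. cmod (2 ^ (k - Suc i)) * N (fmult (\<lambda>m. (character t m + 1) ^ i) B))"
      unfolding eq by (intro N_scaled_sum_le(2)) (simp add: plus_power[OF B])
    also have "\<dots> \<le> (\<Sum>i<k. 2 ^ (k - Suc i) * ((action_bound + 1) ^ i * N B))"
      using plus_power[OF B] by (intro sum_mono) (simp add: norm_power)
    also have "\<dots> = C * N B" by (simp add: C_def sum_distrib_left mult_ac)
    finally show "N (fmult (\<lambda>m. Q (character t m)) B) \<le> C * N B" .
  qed
  have "N (difference k t A) \<le> N (difference k (2 *\<^sub>R t) A) / 2 + C * N (difference (Suc k) t A)"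
    if A: "A \<in> S" for A t
  proof -
    have char2: "character (2 *\<^sub>R t) m = (character t m)\<^sup>2" for m
      using character_scale_nat[of 2 t m] by simp
    have "2 ^ k * (z - 1) ^ k = (z\<^sup>2 - 1) ^ k - Q z * (z - 1) ^ Suc k" for z :: complex
    proof -
      have "(z\<^sup>2 - 1) ^ k = ((z + 1) * (z - 1)) ^ k"
        by (simp add: power2_eq_square algebra_simps)
      also have "\<dots> = (2 ^ k + (z - 1) * Q z) * (z - 1) ^ k"
        unfolding power_mult_distrib using Q[of z] by (simp add: diff_eq_eq add.commute)
      finally show ?thesis by (simp add: algebra_simps)
    qed
    then have "mat_scale (2 ^ k) (difference k t A)
        = difference k (2 *\<^sub>R t) A - fmult (\<lambda>m. Q (character t m)) (difference (Suc k) t A)"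
      by (simp add: difference_fmult fmult_fmult char2 flip: fmult_minus fmult_cmult)
    then have "2 ^ k * N (difference k t A)
        = N (difference k (2 *\<^sub>R t) A - fmult (\<lambda>m. Q (character t m)) (difference (Suc k) t A))"
      using norm_scale[OF difference_mem[OF A, of k t], of "2 ^ k"] by (simp add: norm_power)
    also have "\<dots> \<le> N (difference k (2 *\<^sub>R t) A) + N (fmult (\<lambda>m. Q (character t m)) (difference (Suc k) t A))"
      by (intro N_diff_le difference_mem Q_bound A)
    also have "\<dots> \<le> N (difference k (2 *\<^sub>R t) A) + C * N (difference (Suc k) t A)"
      by (intro add_left_mono Q_bound difference_mem A)
    finally have *: "2 ^ k * N (difference k t A) \<le> N (difference k (2 *\<^sub>R t) A) + C * N (difference (Suc k) t A)" .
    \<comment> \<open>As \<open>k\<close> is at least 1, the gain 2^k is at least 2, and the factor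
      1/2 is enough for the later iteration to contract.\<close>
    have "2 * N (difference k t A) \<le> 2 ^ k * N (difference k t A)"
      using assms norm_nonneg[OF difference_mem[OF A]] by (intro mult_right_mono) (auto intro: self_le_power)
    with * have "2 * N (difference k t A) \<le> N (difference k (2 *\<^sub>R t) A) + C * N (difference (Suc k) t A)"
      by linarith
    moreover have "0 \<le> C * N (difference (Suc k) t A)"
      using C norm_nonneg[OF difference_mem[OF A]] by simp
    ultimately show ?thesis by linarith
  qed
  with C show ?thesis by blast
qed

text \<open>The order descends from n to 1. If the differences of order k + 1 are small near 0,
  iterating the doubling inequality from t up to the size d halves the trivial bound of order k at
  each step, while the errors of order k + 1 add up geometrically.\<close>

lemma marchaud:
  assumes A: "A \<in> S" and "1 \<le> n"
    and "\<And>e. 0 < e \<Longrightarrow> \<exists>d>0. \<forall>t. norm1 t \<le> d \<longrightarrow> N (difference n t A) < e"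
  shows "A \<in> continuous_elements"
  using assms(2,3)
proof (induction n rule: nat_induct_at_least)
  case base
  then show ?case
    using A by (intro continuous_elementsI) (auto simp: difference_fmult)
next
  case (Suc k)
  show ?case
  proof (rule Suc.IH)
    fix e :: real assume e: "0 < e"
    obtain C where C: "0 \<le> C" "\<And>t. N (difference k t A) \<le> N (difference k (2 *\<^sub>R t) A) / 2 + C * N (difference (Suc k) t A)"
      using difference_doubling[OF Suc.hyps] A by blast
    \<comment> \<open>The threshold makes e / 2 the fixed point of x \<mapsto> x / 2 + e / 4; C may
      be 0, hence C + 1.\<close>
    obtain d where d: "0 < d" "\<And>t. norm1 t \<le> d \<Longrightarrow> N (difference (Suc k) t A) < e / (4 * (C + 1))"
      using Suc.prems[of "e / (4 * (C + 1))"] e C(1) by auto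
    define B where "B = (action_bound + 1) ^ k * N A"
    have dbl: "N (difference k t A) \<le> B / 2 ^ i + e / 2" if "norm1 t \<le> d / 2 ^ i" for i t
      using that
    proof (induction i arbitrary: t)
      case 0
      then show ?case using difference_bound[OF A, of k t] e by (simp add: B_def)
    next
      case (Suc i)
      have "norm1 (2 *\<^sub>R t) \<le> d / 2 ^ i" using Suc.prems by (simp add: norm1_scale field_simps)
      then have 1: "N (difference k (2 *\<^sub>R t) A) \<le> B / 2 ^ i + e / 2" by (rule Suc.IH)
      have "d / 2 ^ Suc i \<le> d" using divide_left_mono[of 1 "2 ^ Suc i" d] d(1) one_le_power[of "2::real" "Suc i"] by simp
      then have "C * N (difference (Suc k) t A) \<le> (C + 1) * (e / (4 * (C + 1)))"
        using d(2)[of t] Suc.prems C(1) norm_nonneg[OF difference_mem[OF A]] by (intro mult_mono) auto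
      also have "\<dots> = e / 4" using C(1) by (simp add: field_simps)
      finally show ?case using C(2)[of t] 1 by simp
    qed
    obtain i where "2 * (B / e) < 2 ^ i"
      using real_arch_pow[of 2 "2 * (B / e)"] by auto
    then have "B / 2 ^ i < e / 2" using e by (simp add: field_simps)
    then have "N (difference k t A) < e" if "norm1 t \<le> d / 2 ^ i" for t
      using dbl[OF that] by linarith
    then show "\<exists>d>0. \<forall>t. norm1 t \<le> d \<longrightarrow> N (difference k t A) < e"
      using d(1) by (intro exI[of _ "d / 2 ^ i"]) auto
  qed
qed

end

section \<open>Bandlimited elements are banded matrices\<close>

lemma finite_vec_bounded: "finite {m :: int ^ 'n::finite. \<forall>j. \<bar>m $ j\<bar> \<le> c}"
proof -
  have "{m :: int ^ 'n. \<forall>j. \<bar>m $ j\<bar> \<le> c} \<subseteq> vec_lambda ` (Pi UNIV (\<lambda>_. {-c..c}))"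
  proof
    fix m :: "int ^ 'n" assume "m \<in> {m. \<forall>j. \<bar>m $ j\<bar> \<le> c}"
    then have "vec_nth m \<in> Pi UNIV (\<lambda>_. {-c..c})" by (auto simp: abs_le_iff minus_le_iff)
    then have "vec_lambda (vec_nth m) \<in> vec_lambda ` (Pi UNIV (\<lambda>_. {-c..c}))" by (rule imageI)
    then show "m \<in> vec_lambda ` (Pi UNIV (\<lambda>_. {-c..c}))" by simp
  qed
  moreover have "finite (PiE UNIV (\<lambda>_::'n. {-c..c}))"
    by (intro finite_PiE) auto
  ultimately show ?thesis
    by (auto intro: finite_subset simp: PiE_UNIV_domain)
qed

lemma coords_distinct_UNIV: "distinct (coords :: 'd::finite list) \<and> set (coords :: 'd list) = UNIV"
  unfolding coords_def by (rule someI_ex) (metis finite_distinct_list finite)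

lemma prod_list_coords: "prod_list (map g coords) = (\<Prod>j\<in>UNIV. g j)" for g :: "'d::finite \<Rightarrow> complex"
  using coords_distinct_UNIV[where 'd = 'd] prod.distinct_set_conv_list[of "coords :: 'd list" g] by simp

lemma cis_diff_quotient_tendsto:
  "((\<lambda>h. (cis (2 * pi * (h * x)) - 1) / of_real h) \<longlongrightarrow> 2 * of_real pi * \<i> * of_real x) (at 0)"
proof -
  have "((\<lambda>z. exp (2 * of_real pi * \<i> * of_real x * z)) has_field_derivative 2 * of_real pi * \<i> * of_real x) (at 0)"
    by (auto intro!: derivative_eq_intros)
  then have "((\<lambda>h. (exp (2 * of_real pi * \<i> * of_real x * h) - 1) / h) \<longlongrightarrow> 2 * of_real pi * \<i> * of_real x) (at 0)"
    by (simp add: DERIV_def)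
  moreover have "filterlim (of_real :: real \<Rightarrow> complex) (at 0) (at 0)"
    by (intro filterlim_atI) (auto intro!: tendsto_eq_intros simp: eventually_at_filter)
  ultimately have "((\<lambda>h. (exp (2 * of_real pi * \<i> * of_real x * of_real h) - 1) / of_real h)
      \<longlongrightarrow> 2 * of_real pi * \<i> * of_real x) (at (0::real))"
    by (rule filterlim_compose)
  then show ?thesis by (simp add: cis_conv_exp mult_ac)
qed

context homogeneous_matrix_algebra
begin

lemma finite_band: "finite (band W)"
  unfolding band_def by (rule finite_vec_bounded)

text \<open>The side diagonals of a banded matrix belong to the algebra, so that an arbitrary symbol
  acts as a finite combination of them. The bound depends on the band, which is enough for limits of
  symbols on a fixed band.\<close>

lemma banded_multiplier:
  assumes "A \<in> S" and A: "spectrum_in A (band W)"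
  shows "fmult \<mu> A \<in> S"
    and "N (fmult \<mu> A) \<le> (\<Sum>m\<in>band W. cmod (\<mu> m) * N (side_diag m A))"
proof -
  have eq: "fmult \<mu> A = fmult (\<lambda>x. \<Sum>m\<in>band W. \<mu> m * (if x = m then 1 else 0)) A"
    by (rule fmult_cong_spectrum[OF A]) (simp add: finite_band if_distrib[of "(*) _"] cong: if_cong)
  have diag: "fmult (\<lambda>x. if x = m then 1 else 0) A \<in> S" for m
    using side_diag_continuous(1)[OF banded_continuous[OF assms]] continuous_mem
    by (simp add: side_diag_fmult)
  show "fmult \<mu> A \<in> S"
    unfolding eq by (rule N_scaled_sum_le(1)[OF diag])
  show "N (fmult \<mu> A) \<le> (\<Sum>m\<in>band W. cmod (\<mu> m) * N (side_diag m A))"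
    unfolding eq side_diag_fmult by (rule N_scaled_sum_le(2)[OF diag])
qed

section \<open>The generators of the action and their symbols\<close>

definition deriv_symbol :: "'a \<Rightarrow> int ^ 'a \<Rightarrow> complex" where
  "deriv_symbol j m = 2 * of_real pi * \<i> * of_real (real_of_int (m $ j))"

lemma diff_quotient_tendsto_deriv_symbol:
  "((\<lambda>h. (cis (2 * pi * (h * real_of_int (m $ j))) - 1) / of_real h) \<longlongrightarrow> deriv_symbol j m) (at 0)"
  unfolding deriv_symbol_def by (rule cis_diff_quotient_tendsto)

lemma norm_deriv_symbol: "cmod (deriv_symbol j m) = 2 * pi * \<bar>real_of_int (m $ j)\<bar>"
  unfolding deriv_symbol_def Real_Vector_Spaces.norm_mult norm_of_real by simp

lemma diff_quotient_fmult:
  "mat_scale (1 / of_real h) (chi_act (h *\<^sub>R axis j 1) A - A)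
   = fmult (\<lambda>m. (cis (2 * pi * (h * real_of_int (m $ j))) - 1) / of_real h) A"
  by (simp add: chi_act_fmult character_axis[abs_def] mat_scale_def fmult_def fun_eq_iff left_diff_distrib)

text \<open>Norm convergence implies convergence of entries, and entrywise the difference quotients
  converge to the multiplier with \<open>deriv_symbol\<close>.\<close>

lemma chi_deriv_eq:
  assumes "chi_deriv S N j A B"
  shows "B = fmult (deriv_symbol j) A"
proof -
  have AB: "A \<in> S" "B \<in> S"
    and lim: "((\<lambda>h::real. N (mat_scale (1 / of_real h) (chi_act (h *\<^sub>R axis j 1) A - A) - B)) \<longlongrightarrow> 0) (at 0)"
    using assms by (auto simp: chi_deriv_def)
  have mem: "mat_scale (1 / of_real h) (chi_act (h *\<^sub>R axis j 1) A - A) \<in> S" for h :: real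
    using AB chi_mem by (intro scale_mem diff_mem)
  have "B k l = deriv_symbol j (k - l) * A k l" for k l
  proof -
    have "((\<lambda>h::real. mat_scale (1 / of_real h) (chi_act (h *\<^sub>R axis j 1) A - A) k l) \<longlongrightarrow> B k l) (at 0)"
      by (rule entry_tendsto[OF mem AB(2) lim])
    moreover have "((\<lambda>h::real. mat_scale (1 / of_real h) (chi_act (h *\<^sub>R axis j 1) A - A) k l)
        \<longlongrightarrow> deriv_symbol j (k - l) * A k l) (at 0)"
      unfolding diff_quotient_fmult fmult_def
      by (intro tendsto_mult tendsto_const diff_quotient_tendsto_deriv_symbol)
    ultimately show ?thesis by (rule tendsto_unique[OF trivial_limit_at])
  qed
  then show ?thesis by (simp add: fmult_def fun_eq_iff)
qed

text \<open>On a fixed band the difference quotients involve finitely many values of the symbol, so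
  that pointwise convergence gives convergence in norm.\<close>

lemma chi_deriv_banded:
  assumes "A \<in> S" and A: "spectrum_in A (band W)"
  shows "chi_deriv S N j A (fmult (deriv_symbol j) A)"
proof -
  let ?q = "\<lambda>h m. (cis (2 * pi * (h * real_of_int (m $ j))) - 1) / of_real h - deriv_symbol j m"
  have "((\<lambda>h::real. \<Sum>m\<in>band W. cmod (?q h m) * N (side_diag m A)) \<longlongrightarrow> (\<Sum>m\<in>band W. cmod 0 * N (side_diag m A))) (at 0)"
    by (intro tendsto_sum tendsto_mult tendsto_norm tendsto_const)
       (simp add: LIM_zero_iff diff_quotient_tendsto_deriv_symbol)
  then have lim: "((\<lambda>h::real. \<Sum>m\<in>band W. cmod (?q h m) * N (side_diag m A)) \<longlongrightarrow> 0) (at 0)"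
    by simp
  have bound: "norm (N (fmult (?q h) A)) \<le> (\<Sum>m\<in>band W. cmod (?q h m) * N (side_diag m A))" for h :: real
    using banded_multiplier(2)[OF assms, of "?q h"] norm_nonneg[OF banded_multiplier(1)[OF assms, of "?q h"]] by simp
  have "((\<lambda>h::real. N (fmult (?q h) A)) \<longlongrightarrow> 0) (at 0)"
    by (rule Lim_null_comparison[OF always_eventually[OF allI[OF bound]] lim])
  then show ?thesis
    using banded_multiplier(1)[OF assms] assms(1)
    by (simp add: chi_deriv_def diff_quotient_fmult flip: fmult_minus)
qed

lemma chi_deriv_power_eq: "(chi_deriv S N j ^^ n) A B \<Longrightarrow> B = fmult (\<lambda>m. deriv_symbol j m ^ n) A"
proof (induction n arbitrary: B)
  case (Suc n)
  then obtain X where "(chi_deriv S N j ^^ n) A X" "chi_deriv S N j X B" by auto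
  from Suc.IH[OF this(1)] chi_deriv_eq[OF this(2)] show ?case by (simp add: fmult_fmult)
qed simp

lemma chi_deriv_power_banded:
  assumes "A \<in> S" and "spectrum_in A (band W)"
  shows "(chi_deriv S N j ^^ n) A (fmult (\<lambda>m. deriv_symbol j m ^ n) A)"
proof (induction n)
  case (Suc n)
  let ?X = "fmult (\<lambda>m. deriv_symbol j m ^ n) A"
  have "chi_deriv S N j ?X (fmult (deriv_symbol j) ?X)"
    using banded_multiplier(1)[OF assms] spectrum_in_fmult[OF assms(2)] by (rule chi_deriv_banded)
  with Suc show ?case by (auto simp: fmult_fmult)
qed simp

text \<open>The fold is treated for an arbitrary list of coordinates. On symbols composition is
  multiplication, in which the order fixed by \<open>coords\<close> disappears.\<close>

lemma chi_multideriv_eq: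
  assumes "chi_multideriv S N \<alpha> A B"
  shows "B = fmult (\<lambda>m. \<Prod>j\<in>UNIV. deriv_symbol j m ^ \<alpha> j) A"
proof -
  have "foldr (\<lambda>j R. R OO (chi_deriv S N j ^^ \<alpha> j)) js (=) A B
      \<Longrightarrow> B = fmult (\<lambda>m. prod_list (map (\<lambda>j. deriv_symbol j m ^ \<alpha> j) js)) A" for js
  proof (induction js arbitrary: B)
    case (Cons j js)
    then obtain X where "foldr (\<lambda>j R. R OO (chi_deriv S N j ^^ \<alpha> j)) js (=) A X"
      "(chi_deriv S N j ^^ \<alpha> j) X B" by auto
    from Cons.IH[OF this(1)] chi_deriv_power_eq[OF this(2)] show ?case by (simp add: fmult_fmult)
  qed simp
  from this[of coords] assms show ?thesis
    by (simp add: chi_multideriv_def prod_list_coords)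
qed

lemma chi_multideriv_banded:
  assumes "A \<in> S" and "spectrum_in A (band W)"
  shows "chi_multideriv S N \<alpha> A (fmult (\<lambda>m. \<Prod>j\<in>UNIV. deriv_symbol j m ^ \<alpha> j) A)"
proof -
  have "foldr (\<lambda>j R. R OO (chi_deriv S N j ^^ \<alpha> j)) js (=) A
      (fmult (\<lambda>m. prod_list (map (\<lambda>j. deriv_symbol j m ^ \<alpha> j) js)) A)" for js
  proof (induction js)
    case (Cons j js)
    let ?X = "fmult (\<lambda>m. prod_list (map (\<lambda>j. deriv_symbol j m ^ \<alpha> j) js)) A"
    have "(chi_deriv S N j ^^ \<alpha> j) ?X (fmult (\<lambda>m. deriv_symbol j m ^ \<alpha> j) ?X)"
      using banded_multiplier(1)[OF assms] spectrum_in_fmult[OF assms(2)] by (rule chi_deriv_power_banded)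
    with Cons show ?case by (auto simp: fmult_fmult)
  qed simp
  from this[of coords] show ?thesis
    by (simp add: chi_multideriv_def prod_list_coords)
qed

text \<open>On the band every factor of the symbol of \<delta>^\<alpha> is at most 2 pi W in
  modulus, and the sum of the norms of the side diagonals serves as a constant independent of
  \<alpha>.\<close>

lemma banded_imp_bandlimited:
  assumes "A \<in> S" and A: "spectrum_in A (band W)"
  shows "bandlimited S N (real W) A"
proof -
  let ?D = "\<lambda>\<alpha>. fmult (\<lambda>m. \<Prod>j\<in>UNIV. deriv_symbol j m ^ \<alpha> j) A"
  define C where "C = (\<Sum>m\<in>band W. N (side_diag m A))"
  have nn: "0 \<le> N (side_diag m A)" for m
    using side_diag_continuous(1)[OF banded_continuous[OF assms]] continuous_mem norm_nonneg by blast
  have "N (?D \<alpha>) \<le> C * (2 * pi * real W) ^ (\<Sum>j\<in>UNIV. \<alpha> j)" for \<alpha> :: "'a \<Rightarrow> nat"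
  proof -
    have "cmod (\<Prod>j\<in>UNIV. deriv_symbol j m ^ \<alpha> j) \<le> (2 * pi * real W) ^ (\<Sum>j\<in>UNIV. \<alpha> j)" if "m \<in> band W" for m
    proof -
      have "cmod (\<Prod>j\<in>UNIV. deriv_symbol j m ^ \<alpha> j) = (\<Prod>j\<in>UNIV. (2 * pi * \<bar>real_of_int (m $ j)\<bar>) ^ \<alpha> j)"
        by (simp add: norm_power norm_deriv_symbol flip: prod_norm)
      also have "\<dots> \<le> (\<Prod>j\<in>UNIV. (2 * pi * real W) ^ \<alpha> j)"
      proof (intro prod_mono conjI power_mono mult_left_mono)
        fix j
        have "\<bar>m $ j\<bar> \<le> int W" using that by (simp add: band_def)
        then show "\<bar>real_of_int (m $ j)\<bar> \<le> real W" by linarith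
      qed auto
      also have "\<dots> = (2 * pi * real W) ^ (\<Sum>j\<in>UNIV. \<alpha> j)" by (simp add: power_sum)
      finally show ?thesis .
    qed
    then have "N (?D \<alpha>) \<le> (\<Sum>m\<in>band W. (2 * pi * real W) ^ (\<Sum>j\<in>UNIV. \<alpha> j) * N (side_diag m A))"
      by (intro order_trans[OF banded_multiplier(2)[OF assms]] sum_mono mult_right_mono nn)
    then show ?thesis by (simp add: C_def sum_distrib_right mult.commute)
  qed
  then have "\<exists>B. chi_multideriv S N \<alpha> A B \<and> N B \<le> C * (2 * pi * real W) ^ (\<Sum>j\<in>UNIV. \<alpha> j)" for \<alpha>
    using chi_multideriv_banded[OF assms, of \<alpha>] by (intro exI[of _ "?D \<alpha>"] conjI)
  with assms(1) show ?thesis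
    unfolding bandlimited_def by (intro conjI exI[of _ C] allI)
qed

text \<open>At a nonzero entry whose lag has a component x with |x| > W, the pure derivatives of
  order n in that direction grow like (2 pi |x|)^n, which violates a bound by a multiple of (2 pi
  W)^n.\<close>

lemma bandlimited_imp_banded:
  assumes "bandlimited S N (real W) A"
  shows "A \<in> S" and "spectrum_in A (band W)"
proof -
  from assms obtain C where AS: "A \<in> S"
    and C: "\<And>\<alpha>. \<exists>B. chi_multideriv S N \<alpha> A B \<and> N B \<le> C * (2 * pi * real W) ^ (\<Sum>j\<in>UNIV. \<alpha> j)"
    unfolding bandlimited_def by blast
  show "A \<in> S" by (rule AS)
  obtain K where K: "0 < K" "\<And>A k l. A \<in> S \<Longrightarrow> cmod (A k l) \<le> K * N A"
    using entry_bound by auto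
  have "\<bar>(k - l) $ j\<bar> \<le> int W" if nz: "A k l \<noteq> 0" for k l j
  proof (rule ccontr)
    assume "\<not> ?thesis"
    then have gt: "real W < \<bar>real_of_int ((k - l) $ j)\<bar>" by linarith
    define x where "x = \<bar>real_of_int ((k - l) $ j)\<bar>"
    have bound: "x ^ n * cmod (A k l) \<le> K * C * real W ^ n" for n
    proof -
      define \<alpha> where "\<alpha> = (\<lambda>i. if i = j then n else 0)"
      obtain B where B: "chi_multideriv S N \<alpha> A B" "N B \<le> C * (2 * pi * real W) ^ (\<Sum>j\<in>UNIV. \<alpha> j)"
        using C by blast
      have "B \<in> S"
      proof -
        have "chi_multideriv S N \<alpha> A B \<Longrightarrow> B \<in> S"
        proof -
          have pow: "(chi_deriv S N i ^^ k) X Y \<Longrightarrow> X \<in> S \<Longrightarrow> Y \<in> S" for i k X Y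
            by (cases k) (auto simp: chi_deriv_def)
          have "foldr (\<lambda>j R. R OO (chi_deriv S N j ^^ \<alpha> j)) js (=) A Y \<Longrightarrow> Y \<in> S" for js Y
            by (induction js arbitrary: Y) (auto intro: AS pow)
          then show "chi_multideriv S N \<alpha> A B \<Longrightarrow> B \<in> S" by (simp add: chi_multideriv_def)
        qed
        with B show ?thesis by simp
      qed
      have "(\<Prod>i\<in>UNIV. deriv_symbol i m ^ \<alpha> i) = deriv_symbol j m ^ n" for m
      proof -
        have "(\<Prod>i\<in>UNIV. deriv_symbol i m ^ \<alpha> i) = (\<Prod>i\<in>UNIV. if i = j then deriv_symbol j m ^ n else 1)"
          by (intro prod.cong) (auto simp: \<alpha>_def)
        then show ?thesis by simp
      qed
      then have "B k l = deriv_symbol j (k - l) ^ n * A k l"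
        using chi_multideriv_eq[OF B(1)] by (simp add: fmult_def)
      then have "cmod (B k l) = (2 * pi) ^ n * (x ^ n * cmod (A k l))"
        by (simp add: Real_Vector_Spaces.norm_mult norm_power norm_deriv_symbol power_mult_distrib x_def)
      moreover have "cmod (B k l) \<le> K * (C * (2 * pi * real W) ^ n)"
        using order_trans[OF K(2)[OF \<open>B \<in> S\<close>] mult_left_mono[OF B(2), of K]] K(1)
        by (simp add: \<alpha>_def)
      ultimately have "(2 * pi) ^ n * (x ^ n * cmod (A k l)) \<le> (2 * pi) ^ n * (K * C * real W ^ n)"
        by (simp add: power_mult_distrib mult_ac)
      then show ?thesis by (subst (asm) mult_le_cancel_left_pos) auto
    qed
    have x: "real W < x" "0 < x" using gt by (auto simp: x_def)
    show False
    \<comment> \<open>For W = 0 the ratio x / W is meaningless, but the bound for n = 1 already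
      forces the entry to vanish.\<close>
    proof (cases "W = 0")
      case True
      then show False using bound[of 1] nz x by (simp add: mult_le_0_iff)
    next
      case False
      then have "1 < x / real W" using x by simp
      then obtain n where n: "K * C / cmod (A k l) < (x / real W) ^ n"
        using real_arch_pow by blast
      have "(x / real W) ^ n * cmod (A k l) \<le> K * C"
        using bound[of n] False by (simp add: power_divide field_simps)
      with n nz show False by (simp add: field_simps)
    qed
  qed
  then show "spectrum_in A (band W)" by (simp add: spectrum_in_def band_def)
qed

text \<open>At W = 0 the two sides are different sets: the left one is {0} by definition, the right
  one consists of the diagonal matrices of the algebra.\<close>

lemma bandlimited_set_eq:
  "1 \<le> W \<Longrightarrow> bandlimited_set S N (real W) = {A \<in> S. spectrum_in A (band W)}"
  unfolding bandlimited_set_def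
  using banded_imp_bandlimited bandlimited_imp_banded by auto

lemma approx_error_zero: "approx_error S N 0 A = ennreal (N A)"
  by (simp add: approx_error_def bandlimited_set_def)

lemma approx_error_banded:
  "1 \<le> W \<Longrightarrow> approx_error S N (real W) A = (INF X\<in>{X \<in> S. spectrum_in X (band W)}. ennreal (N (A - X)))"
  by (simp add: approx_error_def bandlimited_set_eq)

text \<open>The sets of competitors increase with the bandwidth; V = 0 is treated apart because 0 is
  the only competitor there.\<close>

lemma approx_error_antimono:
  assumes "V \<le> W" and "A \<in> S"
  shows "approx_error S N (real W) A \<le> approx_error S N (real V) A"
proof (cases "V = 0")
  case True
  show ?thesis
  proof (cases "W = 0")
    case False
    have "(0 :: 'a zmat) \<in> {X \<in> S. spectrum_in X (band W)}" by (simp add: spectrum_in_def)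
    from INF_lower[OF this, of "\<lambda>X. ennreal (N (A - X))"] have "approx_error S N (real W) A \<le> ennreal (N (A - 0))"
      using False by (subst approx_error_banded) simp_all
    then show ?thesis using True by (simp add: approx_error_zero)
  qed (use True in simp)
next
  case False
  then show ?thesis
    using assms by (simp add: approx_error_banded) (intro INF_superset_mono; auto dest: spectrum_in_mono[OF _ band_mono])
qed

end

section \<open>An inverse Bernstein inequality\<close>

text \<open>The squared modulus of the transform of this sequence is a Jackson-type kernel.\<close>

definition tent :: "nat \<Rightarrow> nat \<Rightarrow> complex" where
  "tent h i = (if i < h then of_nat (i + 1) else if i < 2 * h then of_nat (2 * h - i) else 0)"

lemma sum_lessThan_double: "(\<Sum>i<2 * h. f i) = (\<Sum>i<h. f i) + (\<Sum>i<h. f (h + i))" for f :: "nat \<Rightarrow> 'x::comm_monoid_add"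
proof -
  have eq: "{..<2 * h} = {..<h} \<union> {h..<h + h}" by auto
  have "sum f {..<2 * h} = sum f {..<h} + sum f {h..<h + h}"
    unfolding eq by (rule sum.union_disjoint) auto
  also have "sum f {h..<h + h} = (\<Sum>i<h. f (h + i))"
    using sum.shift_bounds_nat_ivl[of f 0 h h] by (simp add: add.commute atLeast0LessThan)
  finally show ?thesis .
qed

text \<open>Each half of the tent contributes 1 + 4 + ... + h^2, which is at least h^3 / 3.\<close>

lemma tent_sum: "2 * real h ^ 3 / 3 \<le> (\<Sum>i<2*h. (cmod (tent h i))\<^sup>2)"
proof -
  have sq: "real h ^ 3 / 3 \<le> (\<Sum>i<h. (real (i + 1))\<^sup>2)" for h
    by (induction h) (auto simp: power2_eq_square power3_eq_cube field_simps)
  have "(\<Sum>i<h. (cmod (tent h (h + i)))\<^sup>2) = (\<Sum>i<h. (real (h - i))\<^sup>2)"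
    by (intro sum.cong) (auto simp: tent_def simp del: of_nat_diff)
  also have "\<dots> = (\<Sum>i<h. (real (i + 1))\<^sup>2)"
    by (subst sum.nat_diff_reindex[symmetric]) (auto intro!: sum.cong simp: of_nat_diff Suc_diff_Suc)
  finally have 2: "(\<Sum>i<h. (cmod (tent h (h + i)))\<^sup>2) = (\<Sum>i<h. (real (i + 1))\<^sup>2)" .
  have 1: "(\<Sum>i<h. (cmod (tent h i))\<^sup>2) = (\<Sum>i<h. (real (i + 1))\<^sup>2)"
  proof (intro sum.cong refl)
    fix i assume "i \<in> {..<h}"
    then have "cmod (tent h i) = cmod (of_nat (i + 1))" by (simp only: tent_def) simp
    then show "(cmod (tent h i))\<^sup>2 = (real (i + 1))\<^sup>2" by (simp only: norm_of_nat)
  qed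
  show ?thesis
    unfolding sum_lessThan_double 1 2 using sq[of h] by simp
qed

text \<open>For h \<ge> 1 the tent climbs by unit steps to h at i = h - 1, keeps this value at i = h
  and descends by unit steps to 0 at i = 2h.\<close>

lemma tent_step:
  "cmod (tent h 0) \<le> 1" "cmod (tent h i - tent h (Suc i)) \<le> 1" "tent h (2 * h) = 0"
proof -
  show "cmod (tent h 0) \<le> 1" by (simp add: tent_def)
  show "tent h (2 * h) = 0" by (simp add: tent_def)
  consider "Suc i < h" | "Suc i = h" | "h \<le> i" "Suc i < 2 * h" | "h \<le> i" "Suc i = 2 * h" | "2 * h \<le> i"
    by linarith
  then show "cmod (tent h i - tent h (Suc i)) \<le> 1"
  proof cases
    case 2
    then have "tent h i - tent h (Suc i) = 0" by (auto simp: tent_def)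
    then show ?thesis by simp
  next
    case 4
    then have "2 * h - i = 1" "\<not> i < h" "i < 2 * h" "\<not> Suc i < h" "\<not> Suc i < 2 * h" by auto
    then show ?thesis by (simp only: tent_def if_True if_False of_nat_1) simp
  qed (auto simp: tent_def of_nat_diff)
qed

text \<open>Jordan's inequality with a weaker constant. Up to pi / 3 the derivative cos y - 1/2 is
  nonnegative; beyond it sin x is at least sqrt 3 / 2, which exceeds pi / 4.\<close>

lemma sin_ge_half: "0 \<le> x \<Longrightarrow> x \<le> pi / 2 \<Longrightarrow> x / 2 \<le> sin x" for x :: real
proof -
  assume x: "0 \<le> x" "x \<le> pi / 2"
  show "x / 2 \<le> sin x"
  proof (cases "x \<le> pi / 3")
    case True
    have "\<exists>D. ((\<lambda>y. sin y - y / 2) has_real_derivative D) (at y) \<and> 0 \<le> D" if "0 \<le> y" "y \<le> x" for y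
    proof (intro exI[of _ "cos y - 1 / 2"] conjI)
      have "cos (pi / 3) \<le> cos y" using that True by (intro cos_monotone_0_pi_le) auto
      then show "0 \<le> cos y - 1 / 2" by (simp add: cos_60)
    qed (auto intro!: derivative_eq_intros)
    then have "sin 0 - 0 / 2 \<le> sin x - x / 2"
      by (intro DERIV_nonneg_imp_nondecreasing[OF x(1)]) auto
    then show ?thesis by simp
  next
    case False
    have "sin (pi / 3) \<le> sin x" using False x by (intro sin_monotone_2pi_le) auto
    then have "sqrt 3 / 2 \<le> sin x" by (simp add: sin_60)
    moreover have "1.7 \<le> sqrt 3" by (rule real_le_rsqrt) (simp add: power2_eq_square)
    moreover have "pi \<le> 3.2" using pi_approx by simp
    ultimately show ?thesis using x by linarith
  qed
qed

lemma abs_le_norm_cis_minus_one: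
  assumes "\<bar>t\<bar> \<le> 1 / 2"
  shows "\<bar>t\<bar> \<le> cmod (cis (2 * pi * t) - 1)"
proof -
  have "pi * \<bar>t\<bar> / 2 \<le> sin (pi * \<bar>t\<bar>)"
    using assms by (intro sin_ge_half) auto
  moreover have "\<bar>t\<bar> \<le> pi * \<bar>t\<bar>"
    using mult_right_mono[of 1 pi "\<bar>t\<bar>"] pi_ge_two by simp
  moreover have "\<bar>sin (pi * t)\<bar> \<ge> sin (pi * \<bar>t\<bar>)"
    by (cases "0 \<le> t") auto
  ultimately have "\<bar>t\<bar> \<le> 2 * \<bar>sin (pi * t)\<bar>" by linarith
  then show ?thesis by (simp add: norm_cis_minus_one)
qed

section \<open>The Jackson-type kernel on a finite grid\<close>

text \<open>The representative of g / G modulo 1 of least modulus, so that its size is the distance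
  to 0 on the circle. Integer frequencies do not see the change of representative.\<close>

definition grid_point :: "nat \<Rightarrow> nat \<Rightarrow> real" where
  "grid_point G g = (if 2 * g \<le> G then real g / real G else real g / real G - 1)"

lemma grid_point_bound: "g < G \<Longrightarrow> \<bar>grid_point G g\<bar> \<le> 1 / 2"
  unfolding grid_point_def by (auto simp: field_simps abs_le_iff)

lemma cis_grid_point: "cis (2 * pi * (grid_point G g * of_int x)) = cis (2 * pi * (real g / real G * of_int x))"
proof -
  have "cis (2 * pi * ((real g / real G - 1) * of_int x)) = cis (2 * pi * (real g / real G * of_int x)) / cis (2 * pi * of_int x)"
    by (simp add: cis_divide algebra_simps)
  then show ?thesis by (simp add: grid_point_def cis_multiple_2pi)
qed

text \<open>Probability weights on the grid: by Parseval the denominator is the total of the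
  numerators.\<close>

definition jackson_weight :: "nat \<Rightarrow> nat \<Rightarrow> nat \<Rightarrow> real" where
  "jackson_weight h G g = (cmod (grid_transform G (2 * h) (tent h) g))\<^sup>2
      / (real G * (\<Sum>i<2*h. (cmod (tent h i))\<^sup>2))"

lemma jackson_weight_nonneg: "0 \<le> jackson_weight h G g"
  unfolding jackson_weight_def by (intro divide_nonneg_nonneg mult_nonneg_nonneg sum_nonneg) auto

lemma tent_sum_pos: "1 \<le> h \<Longrightarrow> 0 < (\<Sum>i<2*h. (cmod (tent h i))\<^sup>2)"
proof -
  assume "1 \<le> h"
  then have "0 < 2 * real h ^ 3 / 3" by simp
  also note tent_sum
  finally show ?thesis .
qed

lemma jackson_weight_sum:
  assumes "1 \<le> h" and "2 * h \<le> G"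
  shows "(\<Sum>g<G. jackson_weight h G g) = 1"
proof -
  have G: "0 < G" using assms by simp
  have "(\<Sum>g<G. jackson_weight h G g) = real G * (\<Sum>i<2*h. (cmod (tent h i))\<^sup>2) / (real G * (\<Sum>i<2*h. (cmod (tent h i))\<^sup>2))"
    unfolding jackson_weight_def sum_divide_distrib[symmetric] grid_parseval[OF G assms(2)] ..
  also have "\<dots> = 1" using tent_sum_pos[OF assms(1)] G by simp
  finally show ?thesis .
qed

text \<open>The coefficients of the squared transform are the autocorrelation of the tent, which
  vanishes at lags of modulus 2h or more. The last assumption rules out aliasing.\<close>

lemma jackson_weight_transform:
  assumes "1 \<le> h" and "int (2 * h) \<le> \<bar>x\<bar>" and "\<bar>x\<bar> + int (2 * h) \<le> int G"
  shows "(\<Sum>g<G. of_real (jackson_weight h G g) * cis (2 * pi * (grid_point G g * of_int x))) = 0"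
proof -
  have G: "0 < G" using assms by linarith
  let ?T = "\<Sum>i<2*h. (cmod (tent h i))\<^sup>2"
  have "of_real (jackson_weight h G g) * cis (2 * pi * (grid_point G g * of_int x))
     = grid_transform G (2 * h) (tent h) g * cnj (grid_transform G (2 * h) (tent h) g) / of_nat G
         * cis (2 * pi * (real g / real G * of_int x)) / of_real ?T" for g
    unfolding jackson_weight_def cis_grid_point
    by (simp add: complex_norm_square[symmetric] del: of_real_power of_real_sum)
  then have "(\<Sum>g<G. of_real (jackson_weight h G g) * cis (2 * pi * (grid_point G g * of_int x)))
     = (\<Sum>g<G. grid_transform G (2 * h) (tent h) g * cnj (grid_transform G (2 * h) (tent h) g) / of_nat G
         * cis (2 * pi * (real g / real G * of_int x))) / of_real ?T"
    by (simp only: sum_divide_distrib)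
  also note grid_correlation[OF G assms(3), of "tent h" "tent h"]
  also have "correlation (2 * h) (tent h) (tent h) x = 0"
    unfolding correlation_def using assms(2) by (intro sum.neutral ballI) auto
  finally show ?thesis by simp
qed

text \<open>
  The second moment of the kernel, computed by Parseval from the increments of the tent function:
  multiplication by \<open>z - 1\<close> turns the coefficients into their increments.
\<close>

lemma jackson_weight_second_moment:
  assumes "1 \<le> h" and "2 * h < G"
  shows "(\<Sum>g<G. jackson_weight h G g * (grid_point G g)\<^sup>2) \<le> 9 / (2 * (real h)\<^sup>2)"
proof -
  have G: "0 < G" using assms by simp
  define T where "T = (\<Sum>i<2*h. (cmod (tent h i))\<^sup>2)"
  have T: "0 < T" "2 * real h ^ 3 / 3 \<le> T" using tent_sum_pos[OF assms(1)] tent_sum[of h] by (simp_all add: T_def)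
  \<comment> \<open>The increments of the tent continued by 0 on both sides. There are 2h + 1 of
    them, so that Parseval on the grid needs \<open>2 * h < G\<close> strictly.\<close>
  define d where "d i = (case i of 0 \<Rightarrow> tent h 0 | Suc i' \<Rightarrow> tent h (Suc i') - tent h i')" for i
  define w where "w g = cis (- (2 * pi * (real g / real G)))" for g
  have wpow: "cis (- (2 * pi * (real g / real G * real i))) = w g ^ i" for g i
    by (simp add: w_def Complex.DeMoivre mult_ac)
  have dt: "grid_transform G (2 * h + 1) d g = (1 - w g) * grid_transform G (2 * h) (tent h) g" for g
  proof -
    have "(\<Sum>i<n+1. d i * w g ^ i) = (1 - w g) * (\<Sum>i<n. tent h i * w g ^ i) + tent h n * w g ^ n" for n
      by (induction n) (auto simp: d_def algebra_simps)
    from this[of "2 * h"] show ?thesis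
      unfolding grid_transform_def wpow tent_step(3) by simp
  qed
  have "cmod (d i) \<le> 1" for i
    using tent_step(1)[of h] tent_step(2)[of h "i - 1"] by (cases i) (auto simp: d_def norm_minus_commute)
  then have "(\<Sum>i<2*h+1. (cmod (d i))\<^sup>2) \<le> (\<Sum>i<2*h+1. 1)"
    by (intro sum_mono) (simp add: power_le_one)
  also have "\<dots> \<le> 3 * real h" using assms(1) by simp
  finally have dsum: "(\<Sum>i<2*h+1. (cmod (d i))\<^sup>2) \<le> 3 * real h" .
  have "(\<Sum>g<G. jackson_weight h G g * (grid_point G g)\<^sup>2)
      \<le> (\<Sum>g<G. (cmod (grid_transform G (2 * h + 1) d g))\<^sup>2 / (real G * T))"
  proof (intro sum_mono)
    fix g assume "g \<in> {..<G}"
    then have "\<bar>grid_point G g\<bar> \<le> cmod (cis (2 * pi * grid_point G g) - 1)"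
      by (intro abs_le_norm_cis_minus_one grid_point_bound) simp
    also have "cis (2 * pi * grid_point G g) = cnj (w g)"
      using cis_grid_point[of G g 1] by (simp add: w_def cis_cnj)
    also have "cmod (cnj (w g) - 1) = cmod (1 - w g)"
      by (metis complex_cnj_diff complex_cnj_one complex_mod_cnj norm_minus_commute)
    finally have "(grid_point G g)\<^sup>2 \<le> (cmod (1 - w g))\<^sup>2" by (simp add: abs_le_square_iff[symmetric])
    then have "jackson_weight h G g * (grid_point G g)\<^sup>2 \<le> jackson_weight h G g * (cmod (1 - w g))\<^sup>2"
      by (intro mult_left_mono jackson_weight_nonneg)
    also have "\<dots> = (cmod (grid_transform G (2 * h + 1) d g))\<^sup>2 / (real G * T)"
      unfolding dt norm_mult power_mult_distrib jackson_weight_def T_def by simp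
    finally show "jackson_weight h G g * (grid_point G g)\<^sup>2 \<le> (cmod (grid_transform G (2 * h + 1) d g))\<^sup>2 / (real G * T)" .
  qed
  also have "\<dots> = (\<Sum>i<2*h+1. (cmod (d i))\<^sup>2) / T"
    unfolding sum_divide_distrib[symmetric] using G assms(2) by (subst grid_parseval) auto
  \<comment> \<open>The numerator bounds 2h + 1 \<le> 3h increments of modulus at most 1, the
    denominator is the lower bound for the normalization.\<close>
  also have "\<dots> \<le> 3 * real h / (2 * real h ^ 3 / 3)"
    using dsum T assms(1) by (intro frac_le) auto
  also have "\<dots> = 9 / (2 * (real h)\<^sup>2)"
    using assms(1) by (simp add: power2_eq_square power3_eq_cube field_simps)
  finally show ?thesis .
qed

text \<open>Chebyshev's inequality for the second moment.\<close>

lemma jackson_weight_tail: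
  assumes "1 \<le> h" and "2 * h < G" and "0 < R"
  shows "(\<Sum>g | g < G \<and> R / real h < \<bar>grid_point G g\<bar>. jackson_weight h G g) \<le> 9 / (2 * R\<^sup>2)"
proof -
  let ?B = "{g. g < G \<and> R / real h < \<bar>grid_point G g\<bar>}"
  have "(R / real h)\<^sup>2 * (\<Sum>g\<in>?B. jackson_weight h G g) = (\<Sum>g\<in>?B. jackson_weight h G g * (R / real h)\<^sup>2)"
    by (subst sum_distrib_left) (simp only: mult.commute)
  also have "\<dots> \<le> (\<Sum>g\<in>?B. jackson_weight h G g * (grid_point G g)\<^sup>2)"
  proof (intro sum_mono mult_left_mono jackson_weight_nonneg)
    fix g assume "g \<in> ?B"
    then show "(R / real h)\<^sup>2 \<le> (grid_point G g)\<^sup>2"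
      using assms by (simp flip: abs_le_square_iff)
  qed
  also have "\<dots> \<le> (\<Sum>g<G. jackson_weight h G g * (grid_point G g)\<^sup>2)"
    by (intro sum_mono2) (auto simp: jackson_weight_nonneg)
  also have "\<dots> \<le> 9 / (2 * (real h)\<^sup>2)"
    by (rule jackson_weight_second_moment[OF assms(1,2)])
  finally show ?thesis
    using assms(1,3) by (simp add: power_divide field_simps)
qed

context homogeneous_matrix_algebra
begin

text \<open>
  The multiplier \<open>u\<^sub>j\<close> is an average of \<open>(1 - e(t m\<^sub>j))\<^sup>n\<close> against the kernel. It equals 1 where
  \<open>\<bar>m\<^sub>j\<bar> \<ge> 2h\<close>, so that \<open>\<Prod>\<^sub>j (1 - u\<^sub>j)\<close> vanishes on the spectrum of A.
\<close>

lemma inverse_bernstein: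
  assumes "1 \<le> n"
  shows "\<exists>R>0. \<exists>C>0. \<forall>h\<ge>1. \<forall>A\<in>S. \<forall>W. \<forall>\<epsilon>.
     spectrum_in A {m \<in> band W. \<exists>j. int (2 * h) \<le> \<bar>m $ j\<bar>} \<longrightarrow>
     (\<forall>t. norm1 t \<le> R / real h \<longrightarrow> N (difference n t A) \<le> \<epsilon>) \<longrightarrow> N A \<le> C * \<epsilon>"
proof -
  define D where "D = (action_bound + 1) ^ n"
  have D: "1 \<le> D" unfolding D_def using action_bound(1) by (intro one_le_power) simp
  \<comment> \<open>The telescoping over the coordinates below has one term per coordinate, each
    preceded by a product of factors of norm at most 1 + D.\<close>
  define E where "E = real CARD('a) * (1 + D) ^ CARD('a)"
  have E: "0 < E" using D by (simp add: E_def)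
  \<comment> \<open>With this radius the tail mass 9 / (2 R^2), multiplied by the trivial bound D,
    equals 1 / (2 E), so that the large shifts contribute a term that can be absorbed.\<close>
  define R where "R = sqrt (9 * E * D)"
  have R: "0 < R" "R\<^sup>2 = 9 * E * D" using D E by (auto simp: R_def)
  have main: "N A \<le> 2 * E * \<epsilon>"
    if h: "1 \<le> h" and A: "A \<in> S" and spec: "spectrum_in A {m \<in> band W. \<exists>j. int (2 * h) \<le> \<bar>m $ j\<bar>}"
      and \<epsilon>: "\<And>t. norm1 t \<le> R / real h \<Longrightarrow> N (difference n t A) \<le> \<epsilon>" for h A W \<epsilon>
  proof -
    \<comment> \<open>The expansion of (1 - e)^n contains harmonics up to n times a frequency of the
      band; these must not alias against the kernel, whose coefficients live below 2h.\<close>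
    define G where "G = n * W + 2 * h + 1"
    let ?\<kappa> = "jackson_weight h G"
    let ?t = "\<lambda>j g. grid_point G g *\<^sub>R axis j 1 :: real ^ 'a"
    define u where "u j m = (\<Sum>g<G. of_real (?\<kappa> g) * (1 - character (?t j g) m) ^ n)" for j and m :: "int ^ 'a"
    have neg: "(1 - z) ^ n = (-1) ^ n * (z - 1) ^ n" for z :: complex
      by (simp flip: power_mult_distrib)
    have diff_mem': "fmult (\<lambda>m. (1 - character t m) ^ n) B \<in> S"
      and diff_norm: "N (fmult (\<lambda>m. (1 - character t m) ^ n) B) = N (difference n t B)" if B: "B \<in> S" for t B
      unfolding neg fmult_cmult difference_fmult[symmetric]
      using difference_mem[OF B, of n t] by (auto intro: scale_mem simp: norm_scale norm_power)
    have u_bound: "fmult (u j) B \<in> S \<and> N (fmult (u j) B) \<le> (\<Sum>g<G. ?\<kappa> g * N (difference n (?t j g) B))"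
      if B: "B \<in> S" for j B
      using N_scaled_sum_le[of "{..<G}" "\<lambda>g m. (1 - character (?t j g) m) ^ n" B "\<lambda>g. of_real (?\<kappa> g)"]
        diff_mem'[OF B] jackson_weight_nonneg[of h G]
      by (simp add: u_def[abs_def] diff_norm[OF B])
    have G2: "2 * h \<le> G" "2 * h < G" by (auto simp: G_def)
    have u_norm: "N (fmult (u j) B) \<le> D * N B" if B: "B \<in> S" for j B
    proof -
      have "(\<Sum>g<G. ?\<kappa> g * N (difference n (?t j g) B)) \<le> (\<Sum>g<G. ?\<kappa> g * (D * N B))"
        unfolding D_def by (intro sum_mono mult_left_mono difference_bound B jackson_weight_nonneg)
      also have "\<dots> = D * N B" by (simp add: jackson_weight_sum[OF h G2(1)] flip: sum_distrib_right)
      finally show ?thesis using u_bound[OF B, of j] by linarith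
    qed
    \<comment> \<open>In the binomial expansion the constant term yields the total mass 1 of the
      kernel, and every other harmonic has modulus at least 2h, where the coefficients of the kernel
      vanish.\<close>
    have u_one: "u j m = 1" if "m \<in> band W" "int (2 * h) \<le> \<bar>m $ j\<bar>" for j m
    proof -
      have "(1 - z) ^ n = (\<Sum>i\<le>n. of_nat (n choose i) * (-1) ^ i * z ^ i)" for z :: complex
        using binomial_ring[of "- z" 1 n] by (simp add: power_minus[of z] mult.assoc)
      then have "u j m = (\<Sum>g<G. \<Sum>i\<le>n. of_nat (n choose i) * (-1) ^ i * (of_real (?\<kappa> g) * character (?t j g) m ^ i))"
        by (simp add: u_def sum_distrib_left mult_ac)
      also have "\<dots> = (\<Sum>i\<le>n. of_nat (n choose i) * (-1) ^ i * (\<Sum>g<G. of_real (?\<kappa> g) * character (?t j g) m ^ i))"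
        by (subst sum.swap) (simp add: sum_distrib_left)
      also have "\<dots> = (\<Sum>i\<le>n. if i = 0 then 1 else 0)"
      proof (intro sum.cong refl)
        fix i assume i: "i \<in> {..n}"
        show "of_nat (n choose i) * (-1) ^ i * (\<Sum>g<G. of_real (?\<kappa> g) * character (?t j g) m ^ i) = (if i = 0 then 1 else 0)"
        proof (cases "i = 0")
          case True
          have "(\<Sum>g<G. complex_of_real (?\<kappa> g)) = 1"
            using jackson_weight_sum[OF h G2(1)] by (simp flip: of_real_sum)
          with True show ?thesis by simp
        next
          case False
          define x where "x = int i * m $ j"
          have eq: "character (?t j g) m ^ i = cis (2 * pi * (grid_point G g * of_int x))" for g
            by (simp add: character_axis Complex.DeMoivre x_def mult_ac)
          have "\<bar>m $ j\<bar> \<le> \<bar>x\<bar>" using False by (simp add: x_def abs_mult mult_le_cancel_right1)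
          then have 1: "int (2 * h) \<le> \<bar>x\<bar>" using that(2) by linarith
          have "\<bar>x\<bar> \<le> int n * int W"
            unfolding x_def abs_mult using i that(1) by (intro mult_mono) (auto simp: band_def)
          then have 2: "\<bar>x\<bar> + int (2 * h) \<le> int G" by (simp add: G_def)
          show ?thesis
            unfolding eq jackson_weight_transform[OF h 1 2] using False by simp
        qed
      qed
      also have "\<dots> = 1" by simp
      finally show ?thesis .
    qed
    have u_small: "N (fmult (u j) A) \<le> \<epsilon> + N A / (2 * E)" for j
    proof -
      let ?good = "{g. g < G \<and> \<bar>grid_point G g\<bar> \<le> R / real h}" and ?bad = "{g. g < G \<and> R / real h < \<bar>grid_point G g\<bar>}"
      have \<epsilon>0: "0 \<le> \<epsilon>"
        using \<epsilon>[of 0] norm_nonneg[OF difference_mem[OF A, of n 0]] R(1) by (simp add: norm1_def)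
      have split: "{..<G} = ?good \<union> ?bad" by auto
      have "(\<Sum>g<G. ?\<kappa> g * N (difference n (?t j g) A))
          = (\<Sum>g\<in>?good. ?\<kappa> g * N (difference n (?t j g) A)) + (\<Sum>g\<in>?bad. ?\<kappa> g * N (difference n (?t j g) A))"
        unfolding split by (rule sum.union_disjoint) auto
      also have "\<dots> \<le> (\<Sum>g\<in>?good. ?\<kappa> g * \<epsilon>) + (\<Sum>g\<in>?bad. ?\<kappa> g * (D * N A))"
        unfolding D_def
        by (intro add_mono sum_mono mult_left_mono difference_bound A jackson_weight_nonneg \<epsilon>)
           (auto simp: norm1_axis)
      also have "(\<Sum>g\<in>?good. ?\<kappa> g * \<epsilon>) \<le> (\<Sum>g<G. ?\<kappa> g * \<epsilon>)"
        using \<epsilon>0 by (intro sum_mono2) (auto simp: jackson_weight_nonneg)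
      also have "(\<Sum>g<G. ?\<kappa> g * \<epsilon>) = \<epsilon>" by (simp add: jackson_weight_sum[OF h G2(1)] flip: sum_distrib_right)
      also have "(\<Sum>g\<in>?bad. ?\<kappa> g * (D * N A)) = (\<Sum>g\<in>?bad. ?\<kappa> g) * (D * N A)"
        by (simp add: sum_distrib_right)
      also have "\<dots> \<le> 9 / (2 * R\<^sup>2) * (D * N A)"
        using D norm_nonneg[OF A] by (intro mult_right_mono jackson_weight_tail[OF h G2(2) R(1)]) auto
      also have "\<dots> = N A / (2 * E)" using D E by (simp add: R(2))
      finally show ?thesis using u_bound[OF A, of j] by linarith
    qed
    let ?P = "\<lambda>J m. \<Prod>j\<in>J. (1 - u j m)"
    have P_bound: "fmult (?P J) B \<in> S \<and> N (fmult (?P J) B) \<le> (1 + D) ^ card J * N B"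
      if "finite J" "B \<in> S" for J B
      using that
    proof (induction J)
      case (insert j J)
      let ?X = "fmult (?P J) B"
      have X: "?X \<in> S" using insert by simp
      have eq: "fmult (?P (insert j J)) B = ?X - fmult (u j) ?X"
        using insert.hyps by (simp add: fmult_fmult left_diff_distrib fmult_minus)
      have "N (?X - fmult (u j) ?X) \<le> N ?X + D * N ?X"
        using N_diff_le[OF X conjunct1[OF u_bound[OF X]]] u_norm[OF X] by (meson add_left_mono order_trans)
      also have "\<dots> = (1 + D) * N ?X" by (simp add: distrib_right)
      also have "\<dots> \<le> (1 + D) * ((1 + D) ^ card J * N B)"
        using insert D by (intro mult_left_mono) auto
      finally have "N (fmult (?P (insert j J)) B) \<le> (1 + D) ^ card (insert j J) * N B"
        unfolding eq using insert.hyps by simp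
      moreover have "fmult (?P (insert j J)) B \<in> S"
        unfolding eq by (intro diff_mem X conjunct1[OF u_bound])
      ultimately show ?case by blast
    qed simp
    \<comment> \<open>The product is built up one coordinate at a time; each new factor 1 - u_j
      changes the result by a product applied to u_j A, which \<open>u_small\<close>
      controls.\<close>
    have tel: "N (A - fmult (?P J) A) \<le> real (card J) * (1 + D) ^ CARD('a) * (\<epsilon> + N A / (2 * E))"
      if "finite J" for J :: "'a set"
      using that
    proof induction
      case (insert j J)
      let ?X = "fmult (?P J) A" and ?Y = "fmult (?P J) (fmult (u j) A)"
      have U: "fmult (u j) A \<in> S" using u_bound[OF A] by simp
      have XY: "?X \<in> S" "?Y \<in> S" using P_bound insert.hyps A U by simp_all
      have eq: "fmult (?P (insert j J)) A = ?X - ?Y"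
        using insert.hyps by (simp add: fmult_fmult left_diff_distrib fmult_minus mult.commute)
      have 1: "N (A - fmult (?P (insert j J)) A) = N ((A - ?X) + ?Y)"
        unfolding eq by (rule arg_cong[where f = N]) simp
      have 2: "N ((A - ?X) + ?Y) \<le> N (A - ?X) + N ?Y" by (intro norm_triangle diff_mem A XY)
      have "N ?Y \<le> (1 + D) ^ card J * N (fmult (u j) A)" using P_bound[OF insert.hyps(1) U] by simp
      also have "\<dots> \<le> (1 + D) ^ CARD('a) * (\<epsilon> + N A / (2 * E))"
        using D norm_nonneg[OF U] insert.hyps(1)
        by (intro mult_mono u_small power_increasing card_mono) auto
      finally have "N (A - fmult (?P (insert j J)) A) \<le> N (A - ?X) + (1 + D) ^ CARD('a) * (\<epsilon> + N A / (2 * E))"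
        using 1 2 by linarith
      moreover have "real (card (insert j J)) * (1 + D) ^ CARD('a) * (\<epsilon> + N A / (2 * E))
          = real (card J) * (1 + D) ^ CARD('a) * (\<epsilon> + N A / (2 * E)) + (1 + D) ^ CARD('a) * (\<epsilon> + N A / (2 * E))"
        using insert.hyps by (simp add: distrib_right)
      ultimately show ?case using insert.IH by linarith
    next
      case empty
      show ?case unfolding prod.empty fmult_one diff_self N_zero by simp
    qed
    have "?P UNIV m = 0" if "m \<in> {m \<in> band W. \<exists>j. int (2 * h) \<le> \<bar>m $ j\<bar>}" for m
      using that u_one by (auto simp: prod_zero_iff)
    then have "fmult (?P UNIV) A = fmult (\<lambda>_. 0) A"
      by (intro fmult_cong_spectrum[OF spec]) auto
    \<comment> \<open>The product symbol vanishes on the spectrum, so that A is itself the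
      telescoped difference; half of its norm is then absorbed on the left.\<close>
    then have "N A \<le> E * (\<epsilon> + N A / (2 * E))"
      using tel[of UNIV] by (simp add: E_def)
    also have "\<dots> = E * \<epsilon> + N A / 2" using E by (simp add: distrib_left)
    finally show ?thesis by simp
  qed
  show ?thesis
    by (intro exI[of _ R] exI[of _ "2 * E"] conjI R(1)) (use E main in auto)
qed

end

section \<open>Weighted sequence norms\<close>

lemma epowr_ennreal: "0 \<le> x \<Longrightarrow> epowr (ennreal x) s = ennreal (x powr s)"
  by (simp add: epowr_def)

lemma epowr_top [simp]: "epowr top s = top"
  by (simp add: epowr_def infinity_ennreal_def)

lemma epowr_zero [simp]: "epowr 0 s = 0"
  by (simp add: epowr_def infinity_ennreal_def)

lemma epowr_mono: "0 \<le> s \<Longrightarrow> x \<le> y \<Longrightarrow> epowr x s \<le> epowr y s"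
  by (cases x; cases y) (auto simp: epowr_ennreal top_unique intro!: ennreal_leI powr_mono2)

lemma epowr_eq_0_iff: "epowr x s = 0 \<longleftrightarrow> x = 0"
  by (cases x) (auto simp: epowr_ennreal)

text \<open>The product of 0 and \<infinity> is consistent with powers, since
  \<open>0 powr s\<close> is 0 for every s.\<close>

lemma epowr_mult: "epowr (x * y) s = epowr x s * epowr y s"
  by (cases x; cases y)
    (auto simp: epowr_ennreal ennreal_mult_top ennreal_top_mult epowr_eq_0_iff powr_mult
          simp flip: ennreal_mult)

lemma epowr_epowr: "epowr (epowr x s) t = epowr x (s * t)"
  by (cases x) (auto simp: epowr_ennreal powr_powr)

lemma epowr_one [simp]: "epowr x 1 = x"
  by (cases x) (auto simp: epowr_ennreal)

lemma epowr_inverse: "s \<noteq> 0 \<Longrightarrow> epowr (epowr x s) (1 / s) = x" "s \<noteq> 0 \<Longrightarrow> epowr (epowr x (1 / s)) s = x"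
  by (simp_all add: epowr_epowr)

text \<open>Convexity is replaced by x + y \<le> 2 max x y, which also covers exponents 1 / q below
  1.\<close>

lemma epowr_add_le: "0 \<le> s \<Longrightarrow> epowr (x + y) s \<le> epowr 2 s * (epowr x s + epowr y s)"
proof -
  assume s: "0 \<le> s"
  have "x + y \<le> 2 * max x y"
    by (simp add: mult_2 add_mono)
  then have "epowr (x + y) s \<le> epowr 2 s * epowr (max x y) s"
    using epowr_mono[OF s] epowr_mult by metis
  also have "\<dots> \<le> epowr 2 s * (epowr x s + epowr y s)"
    by (intro mult_left_mono) (auto simp: max_def)
  finally show ?thesis .
qed

lemma suminf_ge_term: "f i \<le> (\<Sum>i. f i)" for f :: "nat \<Rightarrow> ennreal"
  using sum_le_suminf[of f "{i}"] by simp

lemma suminf_le_bound: "(\<And>n. sum f {..<n} \<le> B) \<Longrightarrow> suminf f \<le> B" for f :: "nat \<Rightarrow> ennreal"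
  by (simp add: suminf_eq_SUP SUP_least)

lemma ennreal_suminf_swap: "(\<Sum>i. \<Sum>j. f i j) = (\<Sum>j. \<Sum>i. f i j)" for f :: "nat \<Rightarrow> nat \<Rightarrow> ennreal"
  using nn_integral_suminf[of "\<lambda>j i. f i j" "count_space UNIV"] by (simp add: nn_integral_count_space_nat)

lemma ennreal_suminf_split_head: "(\<Sum>i. f i) = f 0 + (\<Sum>i. f (Suc i))" for f :: "nat \<Rightarrow> ennreal"
  using suminf_offset[of f 1] by simp

definition ellp_norm :: "ennreal \<Rightarrow> (nat \<Rightarrow> ennreal) \<Rightarrow> ennreal" where
  "ellp_norm p e = (if p = \<infinity> then (SUP n. e n) else epowr (\<Sum>n. epowr (e n) (enn2real p)) (1 / enn2real p))"

lemma exponent_pos: "1 \<le> p \<Longrightarrow> p \<noteq> \<infinity> \<Longrightarrow> 1 \<le> enn2real p"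
  by (cases p) (auto simp: infinity_ennreal_def)

lemma ellp_norm_mono: "(\<And>n. e n \<le> f n) \<Longrightarrow> ellp_norm p e \<le> ellp_norm p f"
  unfolding ellp_norm_def by (auto intro!: SUP_mono' epowr_mono suminf_le)

lemma ellp_norm_cmult: "1 \<le> p \<Longrightarrow> ellp_norm p (\<lambda>n. c * e n) = c * ellp_norm p e"
  unfolding ellp_norm_def
  using exponent_pos[of p] by (auto simp: SUP_mult_left_ennreal epowr_mult epowr_inverse)

lemma ellp_norm_ge_term: "1 \<le> p \<Longrightarrow> e n \<le> ellp_norm p e"
proof (cases "p = \<infinity>")
  case False
  assume "1 \<le> p"
  then have q: "1 \<le> enn2real p" using False by (rule exponent_pos)
  have "e n = epowr (epowr (e n) (enn2real p)) (1 / enn2real p)"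
    using q by (simp add: epowr_inverse)
  also have "\<dots> \<le> ellp_norm p e"
    using False q suminf_ge_term[of "\<lambda>n. epowr (e n) (enn2real p)"] by (auto simp: ellp_norm_def intro!: epowr_mono)
  finally show ?thesis .
qed (simp add: ellp_norm_def SUP_upper)

lemma ellp_norm_power: "1 \<le> p \<Longrightarrow> p \<noteq> \<infinity> \<Longrightarrow> epowr (ellp_norm p e) (enn2real p) = (\<Sum>n. epowr (e n) (enn2real p))"
  using exponent_pos[of p] by (simp add: ellp_norm_def epowr_inverse)

lemma ellp_norm_le_of_power:
  assumes "1 \<le> p" "p \<noteq> \<infinity>" and "(\<Sum>n. epowr (e n) (enn2real p)) \<le> C * epowr x (enn2real p)"
  shows "ellp_norm p e \<le> epowr C (1 / enn2real p) * x"
proof -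
  have q: "1 \<le> enn2real p" using assms(1,2) by (rule exponent_pos)
  have "ellp_norm p e \<le> epowr (C * epowr x (enn2real p)) (1 / enn2real p)"
    using assms(2,3) q by (simp add: ellp_norm_def epowr_mono)
  also have "\<dots> = epowr C (1 / enn2real p) * x"
    using q by (simp add: epowr_mult epowr_inverse)
  finally show ?thesis .
qed

definition ndist :: "nat \<Rightarrow> nat \<Rightarrow> nat" where
  "ndist n k = (n - k) + (k - n)"

lemma geometric_inj_sum_le:
  fixes \<rho> :: real
  assumes "0 < \<rho>" "\<rho> < 1" "finite K" "inj_on f K"
  shows "(\<Sum>k\<in>K. \<rho> ^ f k) \<le> 1 / (1 - \<rho>)"
proof -
  have "(\<Sum>k\<in>K. \<rho> ^ f k) = (\<Sum>i\<in>f ` K. \<rho> ^ i)"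
    using assms(4) by (simp add: sum.reindex)
  also have "\<dots> \<le> (\<Sum>i. \<rho> ^ i)"
    using assms by (intro sum_le_suminf) auto
  also have "\<dots> = 1 / (1 - \<rho>)" using assms by (simp add: suminf_geometric)
  finally show ?thesis .
qed

text \<open>Below n and from n on the distance is injective in k, so that the sum is at most twice a
  geometric series.\<close>

lemma ndist_sum_le:
  fixes \<rho> :: real
  assumes "0 < \<rho>" "\<rho> < 1"
  shows "(\<Sum>k. ennreal (\<rho> ^ ndist n k)) \<le> ennreal (2 / (1 - \<rho>))"
proof (rule suminf_le_bound)
  fix m
  have split: "{..<m} = {k. k < m \<and> k < n} \<union> {k. k < m \<and> n \<le> k}" by auto
  have "(\<Sum>k<m. \<rho> ^ ndist n k) = (\<Sum>k | k < m \<and> k < n. \<rho> ^ ndist n k) + (\<Sum>k | k < m \<and> n \<le> k. \<rho> ^ ndist n k)"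
    unfolding split by (rule sum.union_disjoint) auto
  also have "\<dots> \<le> 1 / (1 - \<rho>) + 1 / (1 - \<rho>)"
    using assms by (intro add_mono geometric_inj_sum_le) (auto simp: ndist_def inj_on_def)
  finally have "(\<Sum>k<m. \<rho> ^ ndist n k) \<le> 2 / (1 - \<rho>)" by simp
  then show "(\<Sum>k<m. ennreal (\<rho> ^ ndist n k)) \<le> ennreal (2 / (1 - \<rho>))"
    using assms by (subst sum_ennreal) (auto intro!: ennreal_leI)
qed

lemma ndist_commute: "ndist n k = ndist k n"
  by (simp add: ndist_def)

text \<open>
  A discrete Young inequality for geometric weights. Splitting the weight into two halves and taking
  a supremum against one of them avoids any convexity argument.
\<close>

lemma geometric_convolution:
  fixes \<rho> :: real
  assumes p: "1 \<le> p" and \<rho>: "0 < \<rho>" "\<rho> < 1"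
  shows "\<exists>K>0. \<forall>e g. (\<forall>n. e n \<le> (\<Sum>k. ennreal (\<rho> ^ (2 * ndist n k)) * g k)) \<longrightarrow> ellp_norm p e \<le> ennreal K * ellp_norm p g"
proof -
  define K1 where "K1 = 2 / (1 - \<rho>)"
  have K1: "0 < K1" using \<rho> by (simp add: K1_def)
  have e_le: "e n \<le> ennreal K1 * (SUP k. ennreal (\<rho> ^ ndist n k) * g k)"
    if "\<And>n. e n \<le> (\<Sum>k. ennreal (\<rho> ^ (2 * ndist n k)) * g k)" for e g n
  proof -
    let ?s = "SUP k. ennreal (\<rho> ^ ndist n k) * g k"
    have "e n \<le> (\<Sum>k. ennreal (\<rho> ^ ndist n k) * (ennreal (\<rho> ^ ndist n k) * g k))"
      using that[of n] \<rho> by (simp add: mult.assoc[symmetric] power_mult power2_eq_square mult_2 power_add ennreal_mult)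
    also have "\<dots> \<le> (\<Sum>k. ennreal (\<rho> ^ ndist n k) * ?s)"
      by (intro suminf_le mult_left_mono SUP_upper) auto
    also have "\<dots> = (\<Sum>k. ennreal (\<rho> ^ ndist n k)) * ?s" by simp
    also have "\<dots> \<le> ennreal K1 * ?s"
      unfolding K1_def by (intro mult_right_mono ndist_sum_le \<rho>) auto
    finally show ?thesis .
  qed
  show ?thesis
  proof (cases "p = \<infinity>")
    case True
    have "ellp_norm p e \<le> ennreal K1 * ellp_norm p g"
      if *: "\<And>n. e n \<le> (\<Sum>k. ennreal (\<rho> ^ (2 * ndist n k)) * g k)" for e g
    proof -
      have "ennreal (\<rho> ^ ndist n k) * g k \<le> ellp_norm p g" for n k
      proof -
        have "ennreal (\<rho> ^ ndist n k) * g k \<le> 1 * g k"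
          using \<rho> by (intro mult_right_mono) (auto simp: power_le_one)
        also have "\<dots> \<le> ellp_norm p g" using ellp_norm_ge_term[OF p, of g k] by simp
        finally show ?thesis .
      qed
      then have "e n \<le> ennreal K1 * ellp_norm p g" for n
        by (intro order_trans[OF e_le[OF *]] mult_left_mono SUP_least) auto
      then show ?thesis using True by (auto simp: ellp_norm_def intro!: SUP_least)
    qed
    then show ?thesis using K1 by blast
  next
    case False
    define q where "q = enn2real p"
    have q: "1 \<le> q" unfolding q_def using p False by (rule exponent_pos)
    define \<sigma> where "\<sigma> = \<rho> powr q"
    have \<sigma>: "0 < \<sigma>" "\<sigma> < 1" using \<rho> q powr_less_mono'[of \<rho> 0 q] by (auto simp: \<sigma>_def)
    define K2 where "K2 = 2 / (1 - \<sigma>)"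
    have K2: "0 < K2" using \<sigma> by (simp add: K2_def)
    define K where "K = (K1 powr q * K2) powr (1 / q)"
    have K: "0 < K" using K1 K2 by (simp add: K_def)
    have "ellp_norm p e \<le> ennreal K * ellp_norm p g"
      if *: "\<And>n. e n \<le> (\<Sum>k. ennreal (\<rho> ^ (2 * ndist n k)) * g k)" for e g
    proof -
      have e_power: "epowr (e n) q \<le> ennreal (K1 powr q) * (\<Sum>k. ennreal (\<sigma> ^ ndist n k) * epowr (g k) q)" for n
      proof -
        let ?h = "\<lambda>k. ennreal (\<rho> ^ ndist n k) * g k"
        \<comment> \<open>The supremum is at most the norm in the p-summable sequences, whose power
          of order q is again a convolution with a geometric weight; exchanging the sums finishes
          the estimate.\<close>
        have "e n \<le> ennreal K1 * ellp_norm p ?h"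
          by (intro order_trans[OF e_le[OF *]] mult_left_mono SUP_least ellp_norm_ge_term p) auto
        then have "epowr (e n) q \<le> epowr (ennreal K1) q * epowr (ellp_norm p ?h) q"
          using q epowr_mono[of q "e n" "ennreal K1 * ellp_norm p ?h"] by (simp add: epowr_mult)
        also have "epowr (ellp_norm p ?h) q = (\<Sum>k. epowr (?h k) q)"
          unfolding q_def by (rule ellp_norm_power[OF p False])
        also have "\<dots> = (\<Sum>k. ennreal (\<sigma> ^ ndist n k) * epowr (g k) q)"
          using \<rho> by (simp add: epowr_mult epowr_ennreal \<sigma>_def powr_power mult.commute flip: powr_realpow)
            (simp add: powr_powr mult.commute)
        finally show ?thesis using K1 by (simp add: epowr_ennreal)
      qed
      have "(\<Sum>n. epowr (e n) q) \<le> (\<Sum>n. ennreal (K1 powr q) * (\<Sum>k. ennreal (\<sigma> ^ ndist n k) * epowr (g k) q))"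
        by (intro suminf_le e_power) auto
      also have "\<dots> = ennreal (K1 powr q) * (\<Sum>k. \<Sum>n. ennreal (\<sigma> ^ ndist n k) * epowr (g k) q)"
        by (simp only: ennreal_suminf_cmult) (subst ennreal_suminf_swap, rule refl)
      also have "\<dots> = ennreal (K1 powr q) * (\<Sum>k. (\<Sum>n. ennreal (\<sigma> ^ ndist k n)) * epowr (g k) q)"
        by (simp add: ndist_commute)
      also have "\<dots> \<le> ennreal (K1 powr q) * (\<Sum>k. ennreal K2 * epowr (g k) q)"
        unfolding K2_def by (intro mult_left_mono suminf_le mult_right_mono ndist_sum_le \<sigma>) auto
      also have "\<dots> = ennreal (K1 powr q * K2) * epowr (ellp_norm p g) q"
        unfolding q_def ellp_norm_power[OF p False] using K1 K2 by (simp add: ennreal_mult mult.assoc)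
      finally have "ellp_norm p e \<le> epowr (ennreal (K1 powr q * K2)) (1 / q) * ellp_norm p g"
        unfolding q_def by (rule ellp_norm_le_of_power[OF p False])
      then show ?thesis using K2 by (simp add: epowr_ennreal K_def)
    qed
    then show ?thesis using K by blast
  qed
qed

section \<open>Dyadic weights and the discrete Hardy inequality\<close>

definition wnorm :: "ennreal \<Rightarrow> real \<Rightarrow> (nat \<Rightarrow> ennreal) \<Rightarrow> ennreal" where
  "wnorm p r e = ellp_norm p (\<lambda>n. ennreal (2 powr (real n * r)) * e n)"

text \<open>The weights of block k at scale n: no gain for k \<ge> n, where only the tail is summed,
  and the Bernstein gain of differences of order l for k < n.\<close>

definition hardy_kernel :: "real \<Rightarrow> nat \<Rightarrow> nat \<Rightarrow> real" where
  "hardy_kernel l n k = (if n \<le> k then 1 else 2 powr (- (l * real (n - k))))"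

lemma hardy_kernel_pos: "0 < hardy_kernel l n k"
  by (simp add: hardy_kernel_def)

text \<open>Conjugated with the weights 2^(n r), the kernel decays like 2^(-r |n - k|) for k \<ge> n
  and like 2^(-(l - r) |n - k|) for k < n. Both rates are positive exactly for 0 < r < l, and the
  smaller one gives a geometric convolution; its root \<rho> carries half of the rate because that
  lemma uses the square of the weight.\<close>

lemma wnorm_hardy:
  assumes p: "1 \<le> p" and r: "0 < r" "r < l"
  shows "\<exists>K>0. \<forall>C e f. (\<forall>n. e n \<le> C * (\<Sum>k. ennreal (hardy_kernel l n k) * f k)) \<longrightarrow> wnorm p r e \<le> C * (ennreal K * wnorm p r f)"
proof -
  define \<epsilon> where "\<epsilon> = min r (l - r)"
  have \<epsilon>: "0 < \<epsilon>" "\<epsilon> \<le> r" "\<epsilon> \<le> l - r" using r by (auto simp: \<epsilon>_def)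
  define \<rho> where "\<rho> = 2 powr (- \<epsilon> / 2)"
  have \<rho>: "0 < \<rho>" "\<rho> < 1" using \<epsilon> powr_less_mono[of "- \<epsilon> / 2" 0 2] by (auto simp: \<rho>_def)
  obtain K where K: "0 < K" "\<And>e g. (\<forall>n. e n \<le> (\<Sum>k. ennreal (\<rho> ^ (2 * ndist n k)) * g k)) \<Longrightarrow> ellp_norm p e \<le> ennreal K * ellp_norm p g"
    using geometric_convolution[OF p \<rho>] by blast
  have weight: "2 powr (real n * r) * hardy_kernel l n k \<le> \<rho> ^ (2 * ndist n k) * 2 powr (real k * r)" for n k
  proof -
    have pw: "\<rho> ^ (2 * ndist n k) = 2 powr (- \<epsilon> * real (ndist n k))"
      using \<rho>(1) by (simp add: powr_realpow[symmetric] \<rho>_def powr_powr)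
    show ?thesis
    proof (cases "n \<le> k")
      case True
      then have "real n * r \<le> - \<epsilon> * real (ndist n k) + real k * r"
        using mult_right_mono[OF \<epsilon>(2), of "real k - real n"] by (simp add: ndist_def of_nat_diff algebra_simps)
      then show ?thesis using True by (simp add: pw hardy_kernel_def flip: powr_add)
    next
      case False
      then have "real n * r - l * real (n - k) \<le> - \<epsilon> * real (ndist n k) + real k * r"
        using mult_right_mono[OF \<epsilon>(3), of "real n - real k"] by (simp add: ndist_def of_nat_diff algebra_simps)
      then show ?thesis using False by (simp add: pw hardy_kernel_def flip: powr_add)
    qed
  qed
  have "wnorm p r e \<le> C * (ennreal K * wnorm p r f)"
    if *: "\<And>n. e n \<le> C * (\<Sum>k. ennreal (hardy_kernel l n k) * f k)" for C e f
  proof -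
    let ?g = "\<lambda>k. ennreal (2 powr (real k * r)) * f k"
    let ?c = "\<lambda>n. \<Sum>k. ennreal (\<rho> ^ (2 * ndist n k)) * ?g k"
    have "ennreal (2 powr (real n * r)) * e n \<le> C * ?c n" for n
    proof -
      have "ennreal (2 powr (real n * r)) * e n \<le> C * (ennreal (2 powr (real n * r)) * (\<Sum>k. ennreal (hardy_kernel l n k) * f k))"
        using mult_left_mono[OF *[of n], of "ennreal (2 powr (real n * r))"] by (simp add: mult_ac)
      also have "ennreal (2 powr (real n * r)) * (\<Sum>k. ennreal (hardy_kernel l n k) * f k)
          = (\<Sum>k. ennreal (2 powr (real n * r) * hardy_kernel l n k) * f k)"
        by (simp add: ennreal_mult less_imp_le[OF hardy_kernel_pos] mult.assoc)
      also have "\<dots> \<le> (\<Sum>k. ennreal (\<rho> ^ (2 * ndist n k) * 2 powr (real k * r)) * f k)"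
        by (intro suminf_le mult_right_mono ennreal_leI weight) auto
      also have "\<dots> = ?c n" using \<rho>(1) by (simp add: ennreal_mult mult.assoc)
      finally show ?thesis by (simp add: mult_left_mono)
    qed
    then have "wnorm p r e \<le> ellp_norm p (\<lambda>n. C * ?c n)"
      unfolding wnorm_def by (rule ellp_norm_mono)
    also have "\<dots> = C * ellp_norm p ?c" by (rule ellp_norm_cmult[OF p])
    also have "ellp_norm p ?c \<le> ennreal K * ellp_norm p ?g" by (rule K(2)) simp
    finally show ?thesis by (simp add: wnorm_def mult_left_mono)
  qed
  with K(1) show ?thesis by blast
qed

lemma wnorm_ge_term: "1 \<le> p \<Longrightarrow> 0 \<le> r \<Longrightarrow> e n \<le> wnorm p r e"
proof -
  assume p: "1 \<le> p" and r: "0 \<le> r"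
  have "1 * e n \<le> ennreal (2 powr (real n * r)) * e n"
    using r by (intro mult_right_mono) (auto simp: ge_one_powr_ge_zero)
  also have "\<dots> \<le> wnorm p r e" unfolding wnorm_def by (rule ellp_norm_ge_term[OF p])
  finally show ?thesis by simp
qed

lemma wnorm_ge_weighted_term: "1 \<le> p \<Longrightarrow> ennreal (2 powr (real n * r)) * e n \<le> wnorm p r e"
  unfolding wnorm_def by (rule ellp_norm_ge_term)

section \<open>The dyadic form of the approximation norm\<close>

lemma dyadic_regroup: "(\<Sum>k. f k) = f 0 + (\<Sum>n. \<Sum>k\<in>{2^n..<2^Suc n}. f k)" for f :: "nat \<Rightarrow> ennreal"
proof -
  have partial: "(\<Sum>k<2^m. f k) = f 0 + (\<Sum>n<m. \<Sum>k\<in>{2^n..<2^Suc n}. f k)" for m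
  proof (induction m)
    case (Suc m)
    have split: "{..<2 ^ Suc m} = {..<2 ^ m} \<union> {2 ^ m..<2 ^ Suc m :: nat}" by auto
    have "(\<Sum>k<2 ^ Suc m. f k) = (\<Sum>k<2 ^ m. f k) + (\<Sum>k\<in>{2 ^ m..<2 ^ Suc m}. f k)"
      unfolding split by (rule sum.union_disjoint) auto
    with Suc show ?case by (simp add: add.assoc)
  qed simp
  show ?thesis
  proof (rule antisym)
    show "(\<Sum>k. f k) \<le> f 0 + (\<Sum>n. \<Sum>k\<in>{2^n..<2^Suc n}. f k)"
    proof (rule suminf_le_bound)
      fix m
      have "(\<Sum>k<m. f k) \<le> (\<Sum>k<2^m. f k)"
        using less_exp[of m] by (intro sum_mono2) auto
      also have "\<dots> \<le> f 0 + (\<Sum>n. \<Sum>k\<in>{2^n..<2^Suc n}. f k)"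
        unfolding partial by (intro add_left_mono sum_le_suminf) auto
      finally show "(\<Sum>k<m. f k) \<le> f 0 + (\<Sum>n. \<Sum>k\<in>{2^n..<2^Suc n}. f k)" .
    qed
    define h where "h n = (case n of 0 \<Rightarrow> f 0 | Suc n \<Rightarrow> \<Sum>k\<in>{2^n..<2^Suc n}. f k)" for n
    have "f 0 + (\<Sum>n. \<Sum>k\<in>{2^n..<2^Suc n}. f k) = (\<Sum>n. h n)"
      by (subst (2) ennreal_suminf_split_head) (simp add: h_def)
    also have "\<dots> \<le> (\<Sum>k. f k)"
    proof (rule suminf_le_bound)
      fix m
      show "sum h {..<m} \<le> (\<Sum>k. f k)"
      proof (cases m)
        case (Suc m')
        have "sum h {..<m} = (\<Sum>k<2^m'. f k)"
          unfolding partial Suc sum.lessThan_Suc_shift by (simp add: h_def)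
        then show ?thesis by (simp add: sum_le_suminf)
      qed simp
    qed
    finally show "f 0 + (\<Sum>n. \<Sum>k\<in>{2^n..<2^Suc n}. f k) \<le> (\<Sum>k. f k)" .
  qed
qed

lemma dyadic_interval_ex:
  fixes k :: nat
  assumes "1 \<le> k"
  obtains n where "2 ^ n \<le> k" "k < 2 ^ Suc n"
proof -
  have "\<exists>n. 2 ^ n \<le> k \<and> k < 2 ^ Suc n"
    using ex_power_ivl1[of 2 k] assms by (auto simp: numeral_2_eq_2)
  then show ?thesis using that by blast
qed

lemma real_le_two_powr: "k < 2 ^ n \<Longrightarrow> real (k + 1) \<le> 2 powr real n"
proof -
  assume "k < 2 ^ n"
  then have "real (k + 1) \<le> real (2 ^ n)" by (intro of_nat_mono) simp
  then show ?thesis by (simp add: powr_realpow)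
qed

lemma two_powr_le_real: "2 ^ n \<le> k \<Longrightarrow> 2 powr real n \<le> real k"
proof -
  assume "2 ^ n \<le> k"
  then have "real (2 ^ n) \<le> real k" by (intro of_nat_mono)
  then show ?thesis by (simp add: powr_realpow)
qed

lemma powr_le_two_powr: "k < 2 ^ n \<Longrightarrow> 0 \<le> s \<Longrightarrow> real (k + 1) powr s \<le> 2 powr (real n * s)"
  unfolding powr_powr[symmetric] by (intro powr_mono2 real_le_two_powr) auto

lemma two_powr_le_powr: "2 ^ n \<le> k \<Longrightarrow> 0 \<le> s \<Longrightarrow> 2 powr (real n * s) \<le> real (k + 1) powr s"
  unfolding powr_powr[symmetric] using two_powr_le_real[of n k] by (intro powr_mono2) auto

text \<open>Samples at 0, 1, 2, 4, and so on. The value at 0 has its own index because no dyadic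
  interval contains it; for approximation errors it is the norm of the matrix.\<close>

definition dyadic_seq :: "(nat \<Rightarrow> ennreal) \<Rightarrow> nat \<Rightarrow> ennreal" where
  "dyadic_seq E n = (case n of 0 \<Rightarrow> E 0 | Suc k \<Rightarrow> E (2 ^ k))"

definition approx_seq_norm :: "ennreal \<Rightarrow> real \<Rightarrow> (nat \<Rightarrow> ennreal) \<Rightarrow> ennreal" where
  "approx_seq_norm p r E = (let q = enn2real p in
     if p = \<infinity> then (SUP k::nat. E k * ennreal (real (k + 1) powr r))
     else epowr (\<Sum>k::nat. epowr (E k) q * ennreal (real (k + 1) powr (r * q)) * ennreal (1 / real (k + 1))) (1 / q))"

text \<open>On [2^n, 2^(n+1)) monotonicity bounds E k by its value at the left end and the weight is
  at most 2^((n+1) r q) / 2^n. The interval has 2^n points, so that no constant is lost.\<close>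

lemma approx_seq_norm_le:
  assumes p: "1 \<le> p" and r: "0 < r" and E: "\<And>i j. i \<le> j \<Longrightarrow> E j \<le> E i"
  shows "approx_seq_norm p r E \<le> wnorm p r (dyadic_seq E)"
proof (cases "p = \<infinity>")
  case True
  have "E k * ennreal (real (k + 1) powr r) \<le> wnorm p r (dyadic_seq E)" for k
  proof (cases "k = 0")
    case True
    then show ?thesis using wnorm_ge_term[OF p, of r "dyadic_seq E" 0] r by (simp add: dyadic_seq_def)
  next
    case False
    then have "1 \<le> k" by simp
    then obtain n where n: "2 ^ n \<le> k" "k < 2 ^ Suc n" by (rule dyadic_interval_ex)
    have "real (k + 1) powr r \<le> 2 powr (real (Suc n) * r)"
      using r n by (intro powr_le_two_powr) auto
    then have "E k * ennreal (real (k + 1) powr r) \<le> E (2 ^ n) * ennreal (2 powr (real (Suc n) * r))"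
      using E[OF n(1)] by (intro mult_mono ennreal_leI) auto
    also have "\<dots> \<le> wnorm p r (dyadic_seq E)"
      using wnorm_ge_weighted_term[OF p, of "Suc n" r "dyadic_seq E"] by (simp add: dyadic_seq_def mult.commute)
    finally show ?thesis .
  qed
  then show ?thesis using True by (auto simp: approx_seq_norm_def intro!: SUP_least)
next
  case False
  define q where "q = enn2real p"
  have q: "1 \<le> q" unfolding q_def using p False by (rule exponent_pos)
  let ?F = "\<lambda>k. epowr (E k) q * ennreal (real (k + 1) powr (r * q)) * ennreal (1 / real (k + 1))"
  let ?T = "\<lambda>n. epowr (ennreal (2 powr (real n * r)) * dyadic_seq E n) q"
  have T: "?T n = epowr (dyadic_seq E n) q * ennreal (2 powr (real n * (r * q)))" for n
    by (simp add: epowr_mult epowr_ennreal powr_powr mult_ac)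
  have block: "(\<Sum>k\<in>{2^n..<2^Suc n}. ?F k) \<le> ?T (Suc n)" for n
  proof -
    have "?F k \<le> ?T (Suc n) * ennreal (1 / 2 ^ n)" if k: "k \<in> {2^n..<2^Suc n}" for k
    proof -
      have 1: "real (k + 1) powr (r * q) \<le> 2 powr (real (Suc n) * (r * q))"
        using r q k by (intro powr_le_two_powr) auto
      have "2 ^ n \<le> real k" using k two_powr_le_real[of n k] by (simp add: powr_realpow)
      then have 2: "1 / real (k + 1) \<le> 1 / 2 ^ n" by (intro divide_left_mono order_trans[OF \<open>2 ^ n \<le> real k\<close>]) simp_all
      show ?thesis
        unfolding T using E[of "2 ^ n" k] k q 1 2
        by (intro mult_mono ennreal_leI) (auto simp: dyadic_seq_def intro!: epowr_mono)
    qed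
    then have "(\<Sum>k\<in>{2^n..<2^Suc n}. ?F k) \<le> (\<Sum>k\<in>{2^n..<2^Suc n::nat}. ?T (Suc n) * ennreal (1 / 2 ^ n))"
      by (intro sum_mono)
    also have "\<dots> = ?T (Suc n) * (of_nat (2 ^ n) * ennreal (1 / 2 ^ n))"
      by (simp add: mult_ac)
    also have "of_nat (2 ^ n) * ennreal (1 / 2 ^ n) = 1"
      by (simp add: ennreal_of_nat_eq_real_of_nat flip: ennreal_mult)
    finally show ?thesis by simp
  qed
  have "(\<Sum>k. ?F k) = ?F 0 + (\<Sum>n. \<Sum>k\<in>{2^n..<2^Suc n}. ?F k)" by (rule dyadic_regroup)
  also have "\<dots> \<le> ?T 0 + (\<Sum>n. ?T (Suc n))"
    by (intro add_mono suminf_le block) (auto simp: dyadic_seq_def)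
  also have "\<dots> = (\<Sum>n. ?T n)" by (rule ennreal_suminf_split_head[symmetric])
  finally have "epowr (\<Sum>k. ?F k) (1 / q) \<le> epowr (\<Sum>n. ?T n) (1 / q)"
    using q by (intro epowr_mono) auto
  then show ?thesis
    using False by (simp add: approx_seq_norm_def wnorm_def ellp_norm_def q_def[symmetric] Let_def)
qed

text \<open>Monotonicity now bounds the sample at 2^(n+1) by the terms of the interval to its left.
  The samples at 0 and 1 have no such interval and are both bounded by E 0.\<close>

lemma approx_seq_norm_ge:
  assumes p: "1 \<le> p" and r: "0 < r"
  shows "\<exists>K>0. \<forall>E. (\<forall>i j. i \<le> j \<longrightarrow> E j \<le> E i) \<longrightarrow> wnorm p r (dyadic_seq E) \<le> ennreal K * approx_seq_norm p r E"
proof (cases "p = \<infinity>")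
  case True
  have "wnorm p r (dyadic_seq E) \<le> ennreal (2 powr r) * approx_seq_norm p r E" for E
  proof -
    have ge: "E k * ennreal (real (k + 1) powr r) \<le> approx_seq_norm p r E" for k
      using True by (auto simp: approx_seq_norm_def intro: SUP_upper)
    have "ennreal (2 powr (real n * r)) * dyadic_seq E n \<le> ennreal (2 powr r) * approx_seq_norm p r E" for n
    proof (cases n)
      case 0
      have "1 * E 0 \<le> ennreal (2 powr r) * approx_seq_norm p r E"
        using ge[of 0] r by (intro mult_mono) (auto simp: ge_one_powr_ge_zero)
      with 0 show ?thesis by (simp add: dyadic_seq_def)
    next
      case (Suc m)
      have "2 powr (real m * r) \<le> real (2 ^ m + 1) powr r"
        using r by (intro two_powr_le_powr) auto
      then have "ennreal (2 powr (real m * r)) * E (2 ^ m) \<le> approx_seq_norm p r E"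
        using ge[of "2 ^ m"] by (intro order_trans[OF _ ge[of "2 ^ m"]]) (simp add: mult.commute mult_left_mono ennreal_leI)
      then have "ennreal (2 powr r) * (ennreal (2 powr (real m * r)) * E (2 ^ m)) \<le> ennreal (2 powr r) * approx_seq_norm p r E"
        by (intro mult_left_mono) auto
      moreover have "ennreal (2 powr (real (Suc m) * r)) = ennreal (2 powr r) * ennreal (2 powr (real m * r))"
        by (simp add: distrib_right powr_add flip: ennreal_mult)
      ultimately show ?thesis
        unfolding Suc by (simp only: dyadic_seq_def nat.case mult.assoc)
    qed
    then show ?thesis using True by (auto simp: wnorm_def ellp_norm_def intro!: SUP_least)
  qed
  then show ?thesis by (intro exI[of _ "2 powr r"]) auto
next
  case False
  define q where "q = enn2real p"
  have q: "1 \<le> q" unfolding q_def using p False by (rule exponent_pos)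
  \<comment> \<open>The summands 1 and 2^(r q) pay for the samples at 0 and 1. In the last one 2^(2
    r q) pays for the shift of the weight by two indices and 2 for the mass 1/2 left in each
    interval.\<close>
  define K0 where "K0 = 1 + 2 powr (r * q) + 2 * 2 powr (2 * (r * q))"
  have K0: "0 < K0" by (simp add: K0_def add_pos_pos)
  have "wnorm p r (dyadic_seq E) \<le> ennreal (K0 powr (1 / q)) * approx_seq_norm p r E"
    if E: "\<And>i j. i \<le> j \<Longrightarrow> E j \<le> E i" for E
  proof -
    let ?F = "\<lambda>k. epowr (E k) q * ennreal (real (k + 1) powr (r * q)) * ennreal (1 / real (k + 1))"
    let ?T = "\<lambda>n. epowr (ennreal (2 powr (real n * r)) * dyadic_seq E n) q"
    let ?B = "\<lambda>n. \<Sum>k\<in>{2^n..<2^Suc n}. ?F k"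
    have T: "?T n = ennreal (2 powr (real n * (r * q))) * epowr (dyadic_seq E n) q" for n
      by (simp add: epowr_mult epowr_ennreal powr_powr mult_ac)
    have block: "?T (Suc (Suc n)) \<le> ennreal (2 * 2 powr (2 * (r * q))) * ?B n" for n
    proof -
      let ?x = "ennreal (2 powr (real n * (r * q))) * epowr (E (2 ^ Suc n)) q"
      have "?x * ennreal (1 / 2 ^ Suc n) \<le> ?F k" if k: "k \<in> {2^n..<2^Suc n}" for k
      proof -
        have 1: "2 powr (real n * (r * q)) \<le> real (k + 1) powr (r * q)"
          using r q k by (intro two_powr_le_powr) auto
        have "real (k + 1) \<le> 2 ^ Suc n"
          using k real_le_two_powr[of k "Suc n"] by (simp add: powr_realpow del: of_nat_Suc)
        then have 2: "1 / 2 ^ Suc n \<le> 1 / real (k + 1)" by (intro divide_left_mono) auto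
        have "epowr (E (2 ^ Suc n)) q \<le> epowr (E k) q" using k q by (intro epowr_mono E) auto
        then have "epowr (E (2 ^ Suc n)) q * ennreal (2 powr (real n * (r * q))) * ennreal (1 / 2 ^ Suc n) \<le> ?F k"
          using 1 2 by (intro mult_mono ennreal_leI) auto
        then show ?thesis by (simp add: mult_ac)
      qed
      then have "(\<Sum>k\<in>{2^n..<2^Suc n::nat}. ?x * ennreal (1 / 2 ^ Suc n)) \<le> ?B n" by (intro sum_mono)
      also have "(\<Sum>k\<in>{2^n..<2^Suc n::nat}. ?x * ennreal (1 / 2 ^ Suc n)) = ?x * (of_nat (2 ^ n) * ennreal (1 / 2 ^ Suc n))"
        by (simp add: mult_ac)
      also have "of_nat (2 ^ n) * ennreal (1 / 2 ^ Suc n) = ennreal (1 / 2)"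
        by (simp add: ennreal_of_nat_eq_real_of_nat flip: ennreal_mult)
      finally have "ennreal (2 * 2 powr (2 * (r * q))) * (?x * ennreal (1 / 2)) \<le> ennreal (2 * 2 powr (2 * (r * q))) * ?B n"
        by (intro mult_left_mono) auto
      also have "ennreal (2 * 2 powr (2 * (r * q))) * (?x * ennreal (1 / 2))
          = ennreal (2 * 2 powr (2 * (r * q)) * (2 powr (real n * (r * q)) * (1 / 2))) * epowr (E (2 ^ Suc n)) q"
        by (simp only: ennreal_mult powr_ge_zero zero_le_mult_iff zero_le_divide_iff zero_le_numeral zero_le_one simp_thms mult_ac)
      also have "2 * 2 powr (2 * (r * q)) * (2 powr (real n * (r * q)) * (1 / 2)) = 2 powr (real (Suc (Suc n)) * (r * q))"
        by (simp add: algebra_simps powr_add)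
      finally show ?thesis by (simp only: T) (simp add: dyadic_seq_def)
    qed
    have F0: "?F 0 = epowr (E 0) q" by simp
    have "(\<Sum>n. ?T n) = ?T 0 + (?T 1 + (\<Sum>n. ?T (Suc (Suc n))))"
      by (subst ennreal_suminf_split_head, subst ennreal_suminf_split_head) simp
    also have "\<dots> \<le> ?F 0 + (ennreal (2 powr (r * q)) * ?F 0 + (\<Sum>n. ennreal (2 * 2 powr (2 * (r * q))) * ?B n))"
    proof (intro add_mono suminf_le block)
      show "?T 0 \<le> ?F 0" by (simp add: dyadic_seq_def)
      show "?T 1 \<le> ennreal (2 powr (r * q)) * ?F 0"
        unfolding T F0 using E[of 0 1] q by (auto simp: dyadic_seq_def intro!: mult_left_mono epowr_mono)
    qed auto
    also have "\<dots> \<le> ?F 0 + (ennreal (2 powr (r * q)) * ?F 0 + ennreal (2 * 2 powr (2 * (r * q))) * (\<Sum>n. ?B n))"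
      by (simp only: ennreal_suminf_cmult order_refl)
    also have "\<dots> \<le> (\<Sum>k. ?F k) + (ennreal (2 powr (r * q)) * (\<Sum>k. ?F k) + ennreal (2 * 2 powr (2 * (r * q))) * (\<Sum>k. ?F k))"
      using suminf_ge_term[of ?F 0] dyadic_regroup[of ?F]
      by (intro add_mono mult_left_mono) auto
    also have "\<dots> = ennreal K0 * (\<Sum>k. ?F k)"
      unfolding K0_def by (simp add: ennreal_plus distrib_right add.assoc)
    finally have "epowr (\<Sum>n. ?T n) (1 / q) \<le> epowr (ennreal K0 * (\<Sum>k. ?F k)) (1 / q)"
      using q by (intro epowr_mono) auto
    then show ?thesis
      using False K0 by (simp add: approx_seq_norm_def wnorm_def ellp_norm_def q_def[symmetric] Let_def epowr_mult epowr_ennreal)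
  qed
  then show ?thesis using K0 by (intro exI[of _ "K0 powr (1 / q)"]) auto
qed

lemma approx_norm_seq: "approx_norm S N p r A = approx_seq_norm p r (\<lambda>k. approx_error S N (real k) A)"
  by (simp add: approx_norm_def approx_seq_norm_def)

text \<open>Substituting k = n - 1 takes a constant factor out of the weights; for nonnegative terms
  the unordered sum over k \<ge> -1 is a series.\<close>

lemma block_norm_seq:
  assumes p: "1 \<le> p"
  shows "block_norm S N p r b = ennreal (2 powr (- r)) * wnorm p r (\<lambda>n. ext_norm S N (b (int n - 1)))"
proof -
  let ?x = "\<lambda>k. ext_norm S N (b k)"
  let ?i = "\<lambda>n. int n - 1"
  have bij: "bij_betw ?i UNIV {-1..}"
    by (rule bij_betw_byWitness[where f' = "\<lambda>k. nat (k + 1)"]) auto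
  then have im: "{-1..} = range ?i" and inj: "inj ?i" by (auto simp: bij_betw_def)
  have w: "2 powr (real_of_int (?i n) * c) = 2 powr (- c) * 2 powr (real n * c)" for n c
    by (simp add: left_diff_distrib flip: powr_add)
  show ?thesis
  proof (cases "p = \<infinity>")
    case True
    have "block_norm S N p r b = (SUP n. ennreal (2 powr (- r)) * (ennreal (2 powr (real n * r)) * ?x (?i n)))"
      unfolding block_norm_def im using True
      by (simp add: image_image w ennreal_mult mult.assoc del: of_int_diff of_int_of_nat_eq)
    then show ?thesis using True by (simp add: wnorm_def ellp_norm_def SUP_mult_left_ennreal)
  next
    case False
    define q where "q = enn2real p"
    have q: "1 \<le> q" unfolding q_def using p False by (rule exponent_pos)
    let ?f = "\<lambda>k. ennreal (2 powr (real_of_int k * q * r)) * epowr (?x k) q"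
    have "infsum ?f {-1..} = infsum (?f \<circ> ?i) UNIV"
      unfolding im by (rule infsum_reindex[OF inj])
    also have "\<dots> = (\<Sum>n. (?f \<circ> ?i) n)"
      by (rule sums_unique[OF has_sum_imp_sums[OF has_sum_infsum[OF nonneg_summable_on_complete]]]) simp
    also have "\<dots> = (\<Sum>n. epowr (ennreal (2 powr (- r)) * (ennreal (2 powr (real n * r)) * ?x (?i n))) q)"
    proof (rule suminf_cong)
      fix n
      have "2 powr (real_of_int (?i n) * q * r) = (2 powr (- r)) powr q * (2 powr (real n * r)) powr q"
        using w[of n "q * r"] by (simp add: powr_powr mult_ac)
      then show "(?f \<circ> ?i) n = epowr (ennreal (2 powr (- r)) * (ennreal (2 powr (real n * r)) * ?x (?i n))) q"
        by (simp add: epowr_mult epowr_ennreal ennreal_mult mult.assoc)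
    qed
    finally have "block_norm S N p r b = ellp_norm p (\<lambda>n. ennreal (2 powr (- r)) * (ennreal (2 powr (real n * r)) * ?x (?i n)))"
      using False by (simp add: block_norm_def ellp_norm_def q_def Let_def)
    then show ?thesis by (simp only: ellp_norm_cmult[OF p] wnorm_def)
  qed
qed

section \<open>The dyadic form of the Besov norm\<close>

lemma dyadic_point_ex:
  assumes "0 < h" "h \<le> 1"
  obtains n :: nat where "2 powr (- real (Suc n)) < h" "h \<le> 2 powr (- real n)"
proof -
  define n where "n = nat \<lfloor>- log 2 h\<rfloor>"
  have l: "0 \<le> - log 2 h" using assms by simp
  then have n: "real n \<le> - log 2 h" "- log 2 h < real (Suc n)"
    unfolding n_def by linarith+
  have h: "h = 2 powr (log 2 h)" using assms(1) by simp
  have "2 powr (- real (Suc n)) < 2 powr (log 2 h)" "2 powr (log 2 h) \<le> 2 powr (- real n)"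
    using n by auto
  then show ?thesis using that[of n] h by simp
qed

lemma dyadic_point_ex_ge:
  assumes "1 < h"
  obtains n :: nat where "2 powr (real n) < h" "h \<le> 2 powr (real (Suc n))"
proof -
  define n where "n = nat (\<lceil>log 2 h\<rceil> - 1)"
  have l: "0 < log 2 h" using assms by simp
  then have n: "real n < log 2 h" "log 2 h \<le> real (Suc n)"
    unfolding n_def by linarith+
  have h: "h = 2 powr (log 2 h)" using assms(1) by simp
  have "2 powr (real n) < 2 powr (log 2 h)" "2 powr (log 2 h) \<le> 2 powr (real (Suc n))"
    using n by auto
  then show ?thesis using that[of n] h by simp
qed

definition besov_seq_norm :: "ennreal \<Rightarrow> real \<Rightarrow> ennreal \<Rightarrow> (real \<Rightarrow> ennreal) \<Rightarrow> ennreal" where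
  "besov_seq_norm p r a \<omega> = a +
     (let q = enn2real p in
      if p = \<infinity> then (SUP h\<in>{0<..}. ennreal (h powr (- r)) * \<omega> h)
      else epowr (\<integral>\<^sup>+h\<in>{0<..}. epowr (ennreal (h powr (- r)) * \<omega> h) q * ennreal (1 / h) \<partial>lborel) (1 / q))"

text \<open>Aligned with \<open>dyadic_seq\<close>: the norm at index 0, then the moduli at 1, 1/2,
  1/4, and so on.\<close>

definition modulus_seq :: "ennreal \<Rightarrow> (real \<Rightarrow> ennreal) \<Rightarrow> nat \<Rightarrow> ennreal" where
  "modulus_seq a \<omega> n = (case n of 0 \<Rightarrow> a | Suc k \<Rightarrow> \<omega> (2 powr (- real k)))"

text \<open>For h \<le> 1 the modulus is compared with its value at the next dyadic point above h.
  For h > 1 the weight is at most 1 and the bound of \<omega> by a takes over.\<close>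

lemma besov_seq_norm_top:
  assumes r: "0 < r" and "0 \<le> c" and mono: "\<And>h h'. h \<le> h' \<Longrightarrow> \<omega> h \<le> \<omega> h'" and bd: "\<And>h. \<omega> h \<le> ennreal c * a"
  shows "besov_seq_norm \<infinity> r a \<omega> \<le> ennreal (2 + c) * wnorm \<infinity> r (modulus_seq a \<omega>)"
    and "wnorm \<infinity> r (modulus_seq a \<omega>) \<le> ennreal (2 powr r) * besov_seq_norm \<infinity> r a \<omega>"
proof -
  let ?f = "modulus_seq a \<omega>"
  have p: "(1::ennreal) \<le> \<infinity>" by (simp add: infinity_ennreal_def)
  have W: "ennreal (2 powr (real n * r)) * ?f n \<le> wnorm \<infinity> r ?f" for n
    by (rule wnorm_ge_weighted_term[OF p])
  have a: "a \<le> wnorm \<infinity> r ?f" using W[of 0] by (simp add: modulus_seq_def)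
  have "ennreal (h powr (- r)) * \<omega> h \<le> ennreal (1 + c) * wnorm \<infinity> r ?f" if h0: "0 < h" for h
  proof (cases "h \<le> 1")
    case True
    obtain n :: nat where n: "2 powr (- real (Suc n)) < h" "h \<le> 2 powr (- real n)"
      by (rule dyadic_point_ex[OF h0 True])
    have "h powr (- r) \<le> (2 powr (- real (Suc n))) powr (- r)"
      using n r by (intro powr_mono2') auto
    then have "h powr (- r) \<le> 2 powr (real (Suc n) * r)" by (simp add: powr_powr algebra_simps)
    then have "ennreal (h powr (- r)) * \<omega> h \<le> ennreal (2 powr (real (Suc n) * r)) * ?f (Suc n)"
      unfolding modulus_seq_def using n mono by (intro mult_mono ennreal_leI) auto
    also have "\<dots> \<le> 1 * wnorm \<infinity> r ?f" using W[of "Suc n"] by simp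
    also have "\<dots> \<le> ennreal (1 + c) * wnorm \<infinity> r ?f"
      using assms(2) by (intro mult_right_mono) auto
    finally show ?thesis .
  next
    case False
    then have "h powr (- r) \<le> 1" using r by (simp add: powr_minus inverse_le_1_iff ge_one_powr_ge_zero)
    then have "ennreal (h powr (- r)) * \<omega> h \<le> 1 * (ennreal c * a)"
      by (intro mult_mono bd) (auto simp: ennreal_le_1)
    also have "\<dots> \<le> ennreal (1 + c) * wnorm \<infinity> r ?f"
      using a assms(2) by (simp add: mult_mono ennreal_leI)
    finally show ?thesis .
  qed
  then have sup: "(SUP h\<in>{0<..}. ennreal (h powr (- r)) * \<omega> h) \<le> ennreal (1 + c) * wnorm \<infinity> r ?f"
    by (intro SUP_least) simp
  have "besov_seq_norm \<infinity> r a \<omega> = a + (SUP h\<in>{0<..}. ennreal (h powr (- r)) * \<omega> h)"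
    by (simp add: besov_seq_norm_def)
  then have "besov_seq_norm \<infinity> r a \<omega> \<le> wnorm \<infinity> r ?f + ennreal (1 + c) * wnorm \<infinity> r ?f"
    using add_mono[OF a sup] by simp
  also have "\<dots> = (1 + ennreal (1 + c)) * wnorm \<infinity> r ?f" by (simp add: distrib_right)
  also have "1 + ennreal (1 + c) = ennreal (2 + c)"
    using assms(2) by (simp flip: ennreal_1 ennreal_plus)
  finally show "besov_seq_norm \<infinity> r a \<omega> \<le> ennreal (2 + c) * wnorm \<infinity> r ?f" .
  have one: "1 \<le> ennreal (2 powr r)" using r by (simp add: ge_one_powr_ge_zero)
  have "ennreal (2 powr (real n * r)) * ?f n \<le> ennreal (2 powr r) * besov_seq_norm \<infinity> r a \<omega>" for n
  proof (cases n)
    case 0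
    have "1 * a \<le> ennreal (2 powr r) * besov_seq_norm \<infinity> r a \<omega>"
      using one by (intro mult_mono) (auto simp: besov_seq_norm_def)
    then show ?thesis using 0 by (simp add: modulus_seq_def)
  next
    case (Suc k)
    let ?h = "2 powr (- real k)"
    have "ennreal (2 powr (real k * r)) * \<omega> ?h = ennreal (?h powr (- r)) * \<omega> ?h"
      by (simp add: powr_powr)
    also have "\<dots> \<le> (SUP h\<in>{0<..}. ennreal (h powr (- r)) * \<omega> h)"
      by (rule SUP_upper) simp
    also have "\<dots> \<le> besov_seq_norm \<infinity> r a \<omega>" by (simp add: besov_seq_norm_def)
    finally have "ennreal (2 powr r) * (ennreal (2 powr (real k * r)) * \<omega> ?h) \<le> ennreal (2 powr r) * besov_seq_norm \<infinity> r a \<omega>"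
      by (intro mult_left_mono) auto
    moreover have "ennreal (2 powr (real (Suc k) * r)) = ennreal (2 powr r) * ennreal (2 powr (real k * r))"
      by (simp add: distrib_right powr_add flip: ennreal_mult)
    ultimately show ?thesis
      unfolding Suc by (simp only: modulus_seq_def nat.case mult.assoc)
  qed
  then show "wnorm \<infinity> r ?f \<le> ennreal (2 powr r) * besov_seq_norm \<infinity> r a \<omega>"
    by (auto simp: wnorm_def ellp_norm_def intro!: SUP_least)
qed

lemma nn_integral_step_function:
  fixes c :: "nat \<Rightarrow> ennreal" and I :: "nat \<Rightarrow> 'b::euclidean_space set"
  assumes "\<And>n. I n \<in> sets lborel"
  shows "(\<integral>\<^sup>+h. (\<Sum>n. c n * indicator (I n) h) \<partial>lborel) = (\<Sum>n. c n * emeasure lborel (I n))"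
  using assms by (subst nn_integral_suminf) (auto simp: nn_integral_cmult_indicator)

lemma besov_integrand_eq:
  "epowr (ennreal (h powr (- s)) * w) q * ennreal (1 / h) = ennreal (h powr (- (s * q)) * (1 / h)) * epowr w q" if "0 < h"
proof -
  have "ennreal (h powr (- (s * q)) * (1 / h)) = ennreal (h powr (- (s * q))) * ennreal (1 / h)"
    using that by (intro ennreal_mult) auto
  moreover have "epowr (ennreal (h powr (- s)) * w) q = ennreal (h powr (- (s * q))) * epowr w q"
    by (simp add: epowr_mult epowr_ennreal powr_powr)
  ultimately show ?thesis by (simp only: mult_ac)
qed

lemma besov_integrand_le:
  assumes "0 < x" "x \<le> h" "0 \<le> s" "0 < q" and "\<omega> h \<le> w"
  shows "epowr (ennreal (h powr (- s)) * \<omega> h) q * ennreal (1 / h) \<le> ennreal (x powr (- (s * q)) * (1 / x)) * epowr w q"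
proof -
  have 1: "h powr (- (s * q)) \<le> x powr (- (s * q))" using assms by (intro powr_mono2') auto
  have 2: "1 / h \<le> 1 / x" using assms by (intro divide_left_mono) auto
  have "epowr (ennreal (h powr (- s)) * \<omega> h) q * ennreal (1 / h)
      = ennreal (h powr (- (s * q)) * (1 / h)) * epowr (\<omega> h) q"
    using assms by (intro besov_integrand_eq) auto
  also have "\<dots> \<le> ennreal (x powr (- (s * q)) * (1 / x)) * epowr w q"
    using assms 1 2 by (intro mult_mono ennreal_leI epowr_mono) auto
  finally show ?thesis .
qed

lemma besov_integrand_ge:
  assumes "0 < h" "h \<le> y" "0 \<le> s" "0 < q" and "w \<le> \<omega> h"
  shows "ennreal (y powr (- (s * q)) * (1 / y)) * epowr w q \<le> epowr (ennreal (h powr (- s)) * \<omega> h) q * ennreal (1 / h)"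
proof -
  have 1: "y powr (- (s * q)) \<le> h powr (- (s * q))" using assms by (intro powr_mono2') auto
  have 2: "1 / y \<le> 1 / h" using assms by (intro divide_left_mono) auto
  have "epowr (ennreal (h powr (- s)) * \<omega> h) q * ennreal (1 / h)
      = ennreal (h powr (- (s * q)) * (1 / h)) * epowr (\<omega> h) q"
    using assms by (intro besov_integrand_eq) auto
  moreover have "ennreal (y powr (- (s * q)) * (1 / y)) * epowr w q \<le> ennreal (h powr (- (s * q)) * (1 / h)) * epowr (\<omega> h) q"
    using assms 1 2 by (intro mult_mono ennreal_leI epowr_mono) auto
  ultimately show ?thesis by simp
qed

context
  fixes p :: ennreal and r q c :: real
  assumes p: "1 \<le> p" "p \<noteq> \<infinity>" and r: "0 < r" and c: "0 \<le> c"
  defines "q \<equiv> enn2real p"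
begin

lemma q_ge_1: "1 \<le> q"
  unfolding q_def using p by (rule exponent_pos)

private definition I where "I n = {2 powr (- real (Suc n)) <.. 2 powr (- real n)}" for n
private definition J where "J n = {2 powr (real n) <.. 2 powr (real (Suc n))}" for n

private lemma measure_I: "emeasure lborel (I n) = ennreal (2 powr (- real (Suc n)))"
proof -
  have "2 powr (- real n) - 2 powr (- real (Suc n)) = 2 powr (- real (Suc n))"
  proof -
    have "2 powr (- real n) = 2 powr (1 + (- real (Suc n)))" by simp
    also have "\<dots> = 2 * 2 powr (- real (Suc n))" by (subst powr_add) simp
    finally show ?thesis by simp
  qed
  then show ?thesis by (simp add: I_def)
qed

private lemma measure_J: "emeasure lborel (J n) = ennreal (2 powr (real n))"
proof -
  have "2 powr (real (Suc n)) = 2 * 2 powr real n" by (simp add: powr_add)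
  then show ?thesis by (simp add: J_def)
qed

private lemma I_inj: "h \<in> I n \<Longrightarrow> h \<in> I m \<Longrightarrow> n = m"
proof -
  assume "h \<in> I n" "h \<in> I m"
  then have "2 powr (- real (Suc n)) < 2 powr (- real m)" "2 powr (- real (Suc m)) < 2 powr (- real n)"
    unfolding I_def by (simp_all only: greaterThanAtMost_iff) (blast intro: less_le_trans)+
  then show ?thesis by simp
qed

private lemma weighted_power:
  "epowr (ennreal (2 powr (real n * r)) * modulus_seq a \<omega> n) q = ennreal (2 powr (real n * (r * q))) * epowr (modulus_seq a \<omega> n) q"
  by (simp add: epowr_mult epowr_ennreal powr_powr mult_ac)

text \<open>On a shell \<open>I n\<close> the modulus is taken at the right end point and the weight
  at the left one. On the shells beyond 1 the modulus is replaced by c a, and their total is a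
  geometric series.\<close>

private lemma besov_integral_le:
  assumes mono: "\<And>h h'. h \<le> h' \<Longrightarrow> \<omega> h \<le> \<omega> h'" and bd: "\<And>h. \<omega> h \<le> ennreal c * a"
  shows "(\<integral>\<^sup>+h\<in>{0<..}. epowr (ennreal (h powr (- r)) * \<omega> h) q * ennreal (1 / h) \<partial>lborel)
       \<le> ennreal (1 + c powr q / (1 - 2 powr (- (r * q)))) * epowr (wnorm p r (modulus_seq a \<omega>)) q"
proof -
  let ?f = "modulus_seq a \<omega>"
  let ?T = "\<lambda>n. epowr (ennreal (2 powr (real n * r)) * ?f n) q"
  let ?W = "epowr (wnorm p r ?f) q"
  let ?F = "\<lambda>h. epowr (ennreal (h powr (- r)) * \<omega> h) q * ennreal (1 / h) * indicator {0<..} h"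
  have W: "?W = (\<Sum>n. ?T n)"
    unfolding wnorm_def q_def by (rule ellp_norm_power[OF p])
  define cI where "cI n = ennreal ((2 powr (- real (Suc n))) powr (- (r * q)) * (1 / 2 powr (- real (Suc n)))) * epowr (\<omega> (2 powr (- real n))) q" for n
  define cJ where "cJ n = ennreal ((2 powr (real n)) powr (- (r * q)) * (1 / 2 powr (real n))) * epowr (ennreal c * a) q" for n
  have q0: "0 < q" using q_ge_1 by simp
  have "?F h \<le> (\<Sum>n. cI n * indicator (I n) h) + (\<Sum>n. cJ n * indicator (J n) h)" for h
  proof (cases "0 < h")
    case True
    show ?thesis
    proof (cases "h \<le> 1")
      case h1: True
      obtain n :: nat where n: "2 powr (- real (Suc n)) < h" "h \<le> 2 powr (- real n)"
        using dyadic_point_ex[OF True h1] .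
      have "?F h \<le> cI n * indicator (I n) h"
        using besov_integrand_le[of "2 powr (- real (Suc n))" h r q \<omega> "\<omega> (2 powr (- real n))"] n r q0 mono True
        by (simp add: cI_def I_def)
      also have "\<dots> \<le> (\<Sum>n. cI n * indicator (I n) h)" by (rule suminf_ge_term)
      finally show ?thesis by (rule order_trans) simp
    next
      case False
      then have "1 < h" by simp
      then obtain n :: nat where n: "2 powr (real n) < h" "h \<le> 2 powr (real (Suc n))"
        by (rule dyadic_point_ex_ge)
      have "?F h \<le> cJ n * indicator (J n) h"
        using besov_integrand_le[of "2 powr (real n)" h r q \<omega> "ennreal c * a"] n r q0 bd True
        by (simp add: cJ_def J_def)
      also have "\<dots> \<le> (\<Sum>n. cJ n * indicator (J n) h)" by (rule suminf_ge_term)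
      finally show ?thesis by (rule order_trans) simp
    qed
  qed simp
  then have "(\<integral>\<^sup>+h. ?F h \<partial>lborel) \<le> (\<integral>\<^sup>+h. (\<Sum>n. cI n * indicator (I n) h) + (\<Sum>n. cJ n * indicator (J n) h) \<partial>lborel)"
    by (intro nn_integral_mono)
  also have "\<dots> = (\<Sum>n. cI n * emeasure lborel (I n)) + (\<Sum>n. cJ n * emeasure lborel (J n))"
    by (subst nn_integral_add) (auto simp: I_def J_def nn_integral_step_function)
  finally have F_le: "(\<integral>\<^sup>+h. ?F h \<partial>lborel) \<le> (\<Sum>n. cI n * emeasure lborel (I n)) + (\<Sum>n. cJ n * emeasure lborel (J n))" .
  have cI_eq: "cI n * emeasure lborel (I n) = ?T (Suc n)" for n
  proof -
    have "(2 powr (- real (Suc n))) powr (- (r * q)) * (1 / 2 powr (- real (Suc n))) * 2 powr (- real (Suc n)) = 2 powr (real (Suc n) * (r * q))"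
      by (simp add: powr_powr algebra_simps)
    then show ?thesis
      unfolding weighted_power cI_def measure_I
      by (simp add: modulus_seq_def mult_ac flip: ennreal_mult)
  qed
  have cJ_eq: "cJ n * emeasure lborel (J n) = ennreal ((2 powr (- (r * q))) ^ n) * epowr (ennreal c * a) q" for n
  proof -
    have "(2 powr (real n)) powr (- (r * q)) * (1 / 2 powr (real n)) * 2 powr (real n) = (2 powr (- (r * q))) ^ n"
      by (simp add: powr_powr powr_power mult.commute)
    then have eq: "ennreal ((2 powr (real n)) powr (- (r * q)) * (1 / 2 powr (real n))) * ennreal (2 powr (real n)) = ennreal ((2 powr (- (r * q))) ^ n)"
      by (subst ennreal_mult[symmetric]) auto
    have "cJ n * emeasure lborel (J n)
        = ennreal ((2 powr (real n)) powr (- (r * q)) * (1 / 2 powr (real n))) * ennreal (2 powr (real n)) * epowr (ennreal c * a) q"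
      unfolding cJ_def measure_J by (simp only: mult_ac)
    then show ?thesis
      unfolding eq .
  qed
  have geometric: "(\<Sum>n. ennreal ((2 powr (- (r * q))) ^ n) * epowr (ennreal c * a) q) = ennreal (1 / (1 - 2 powr (- (r * q)))) * epowr (ennreal c * a) q"
  proof -
    have *: "2 powr (- (r * q)) < 1" using r q0 powr_less_mono[of "- (r * q)" 0 2] by simp
    then have "(\<Sum>n. ennreal ((2 powr (- (r * q))) ^ n)) = ennreal (1 / (1 - 2 powr (- (r * q))))"
      by (subst suminf_ennreal2) (auto intro!: summable_geometric simp: suminf_geometric)
    then show ?thesis by simp
  qed
  have ca: "epowr (ennreal c * a) q = ennreal (c powr q) * ?T 0"
    using c by (simp add: epowr_mult epowr_ennreal modulus_seq_def)
  note F_le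
  also have "(\<Sum>n. cI n * emeasure lborel (I n)) + (\<Sum>n. cJ n * emeasure lborel (J n))
      = (\<Sum>n. ?T (Suc n)) + ennreal (1 / (1 - 2 powr (- (r * q)))) * (ennreal (c powr q) * ?T 0)"
    unfolding cI_eq cJ_eq geometric unfolding ca ..
  also have "(\<Sum>n. ?T (Suc n)) + ennreal (1 / (1 - 2 powr (- (r * q)))) * (ennreal (c powr q) * ?T 0)
      \<le> ?W + ennreal (1 / (1 - 2 powr (- (r * q)))) * (ennreal (c powr q) * ?W)"
    unfolding W using suminf_ge_term[of ?T 0] ennreal_suminf_split_head[of ?T]
    by (intro add_mono mult_left_mono) auto
  also have "\<dots> = ennreal (1 + c powr q / (1 - 2 powr (- (r * q)))) * ?W"
  proof -
    have *: "2 powr (- (r * q)) < 1" using r q0 powr_less_mono[of "- (r * q)" 0 2] by simp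
    have "ennreal (1 + c powr q / (1 - 2 powr (- (r * q)))) = 1 + ennreal (1 / (1 - 2 powr (- (r * q)))) * ennreal (c powr q)"
      using * by (simp flip: ennreal_mult)
    then show ?thesis by (simp add: distrib_right mult.assoc)
  qed
  finally show ?thesis .
qed

text \<open>On \<open>I n\<close> the modulus is at least its value at the left end point 2^-(n+1),
  the entry of index n + 2. The factor 2^(2 r q) pays for this shift and 2 for the length of the
  shell, half of its right end point; the entries 0 and 1 are bounded by a.\<close>

private lemma besov_integral_ge:
  assumes mono: "\<And>h h'. h \<le> h' \<Longrightarrow> \<omega> h \<le> \<omega> h'" and bd: "\<And>h. \<omega> h \<le> ennreal c * a"
  shows "epowr (wnorm p r (modulus_seq a \<omega>)) q \<le> ennreal (1 + 2 powr (r * q) * c powr q + 2 * 2 powr (2 * (r * q)))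
      * (epowr a q + (\<integral>\<^sup>+h\<in>{0<..}. epowr (ennreal (h powr (- r)) * \<omega> h) q * ennreal (1 / h) \<partial>lborel))"
proof -
  let ?f = "modulus_seq a \<omega>"
  let ?T = "\<lambda>n. epowr (ennreal (2 powr (real n * r)) * ?f n) q"
  let ?F = "\<lambda>h. epowr (ennreal (h powr (- r)) * \<omega> h) q * ennreal (1 / h) * indicator {0<..} h"
  let ?\<Phi> = "\<integral>\<^sup>+h. ?F h \<partial>lborel"
  have q0: "0 < q" using q_ge_1 by simp
  define d where "d n = ennreal ((2 powr (- real n)) powr (- (r * q)) * (1 / 2 powr (- real n))) * epowr (\<omega> (2 powr (- real (Suc n)))) q" for n
  have "(\<Sum>n. d n * indicator (I n) h) \<le> ?F h" for h
  proof (cases "\<exists>n. h \<in> I n")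
    case True
    then obtain m where m: "h \<in> I m" ..
    have "(\<Sum>n. d n * indicator (I n) h) = (\<Sum>n\<in>{m}. d n * indicator (I n) h)"
      using I_inj[OF m] by (intro suminf_finite) (auto simp: indicator_def)
    also have "\<dots> = d m" using m by simp
    also have "d m \<le> ?F h"
    proof -
      have h: "2 powr (- real (Suc m)) < h" "h \<le> 2 powr (- real m)" using m by (auto simp: I_def)
      have "0 < h" using h(1) by (rule order_le_less_trans[rotated]) simp
      then show ?thesis
        using besov_integrand_ge[of h "2 powr (- real m)" r q "\<omega> (2 powr (- real (Suc m)))" \<omega>] h r q0 mono
        by (simp add: d_def)
    qed
    finally show ?thesis .
  next
    case False
    then have "(\<lambda>n. d n * indicator (I n) h) = (\<lambda>n. 0)" by auto
    then show ?thesis by simp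
  qed
  then have "(\<integral>\<^sup>+h. (\<Sum>n. d n * indicator (I n) h) \<partial>lborel) \<le> ?\<Phi>"
    by (intro nn_integral_mono)
  then have d_le: "(\<Sum>n. d n * emeasure lborel (I n)) \<le> ?\<Phi>"
    by (subst (asm) nn_integral_step_function) (auto simp: I_def)
  have T_d: "?T (Suc (Suc n)) = ennreal (2 * 2 powr (2 * (r * q))) * (d n * emeasure lborel (I n))" for n
  proof -
    let ?w = "epowr (\<omega> (2 powr (- real (Suc n)))) q"
    have "2 * 2 powr (2 * (r * q)) * ((2 powr (- real n)) powr (- (r * q)) * (1 / 2 powr (- real n))) * 2 powr (- real (Suc n))
        = 2 powr (real (Suc (Suc n)) * (r * q))"
    proof -
      have "2 * (1 / 2 powr (- real n)) * 2 powr (- real (Suc n)) = (1 :: real)"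
      proof -
        have "2 powr (- real n) = 2 powr (1 + (- real (Suc n)))" by simp
        also have "\<dots> = 2 * 2 powr (- real (Suc n))" by (subst powr_add) simp
        finally show ?thesis by simp
      qed
      moreover have "2 powr (2 * (r * q)) * (2 powr (- real n)) powr (- (r * q)) = 2 powr (real (Suc (Suc n)) * (r * q))"
        unfolding powr_powr by (simp add: algebra_simps flip: powr_add)
      moreover have "2 * x * (y * u) * v = (x * y) * (2 * u * v)" for x y u v :: real
        by (simp only: mult_ac)
      ultimately show ?thesis by (simp only: mult_1_right)
    qed
    then have "ennreal (2 powr (real (Suc (Suc n)) * (r * q))) * ?w
      = ennreal (2 * 2 powr (2 * (r * q)) * ((2 powr (- real n)) powr (- (r * q)) * (1 / 2 powr (- real n))) * 2 powr (- real (Suc n))) * ?w"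
      by simp
    also have "\<dots> = ennreal (2 * 2 powr (2 * (r * q))) * (d n * emeasure lborel (I n))"
      unfolding d_def measure_I by (subst ennreal_mult, simp, simp, subst ennreal_mult, simp, simp) (simp only: mult_ac)
    finally show ?thesis unfolding weighted_power by (simp add: modulus_seq_def)
  qed
  have "epowr (wnorm p r ?f) q = (\<Sum>n. ?T n)"
    unfolding wnorm_def q_def by (rule ellp_norm_power[OF p])
  also have "\<dots> = ?T 0 + (?T 1 + (\<Sum>n. ?T (Suc (Suc n))))"
    by (subst ennreal_suminf_split_head, subst ennreal_suminf_split_head) simp
  also have "\<dots> = ?T 0 + (?T 1 + ennreal (2 * 2 powr (2 * (r * q))) * (\<Sum>n. d n * emeasure lborel (I n)))"
    unfolding T_d by (simp only: ennreal_suminf_cmult)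
  also have "\<dots>
      \<le> epowr a q + (ennreal (2 powr (r * q) * c powr q) * epowr a q + ennreal (2 * 2 powr (2 * (r * q))) * ?\<Phi>)"
  proof (intro add_mono mult_left_mono d_le)
    show "?T 0 \<le> epowr a q" by (simp add: modulus_seq_def)
    have "epowr (\<omega> 1) q \<le> epowr (ennreal c * a) q" using q0 by (intro epowr_mono bd) simp
    then have "epowr (\<omega> 1) q \<le> ennreal (c powr q) * epowr a q" using c by (simp add: epowr_mult epowr_ennreal)
    then have "ennreal (2 powr (r * q)) * epowr (\<omega> 1) q \<le> ennreal (2 powr (r * q)) * (ennreal (c powr q) * epowr a q)"
      by (intro mult_left_mono) auto
    then show "?T 1 \<le> ennreal (2 powr (r * q) * c powr q) * epowr a q"
      unfolding weighted_power by (simp add: modulus_seq_def ennreal_mult mult.assoc)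
  qed auto
  also have "\<dots> \<le> (epowr a q + ?\<Phi>) + (ennreal (2 powr (r * q) * c powr q) * (epowr a q + ?\<Phi>) + ennreal (2 * 2 powr (2 * (r * q))) * (epowr a q + ?\<Phi>))"
    by (intro add_mono mult_left_mono) auto
  also have "\<dots> = ennreal (1 + 2 powr (r * q) * c powr q + 2 * 2 powr (2 * (r * q))) * (epowr a q + ?\<Phi>)"
    by (simp add: ennreal_plus distrib_right add.assoc)
  finally show ?thesis .
qed

lemma besov_seq_norm_finite:
  "\<exists>K>0. \<forall>a \<omega>. (\<forall>h h'. h \<le> h' \<longrightarrow> \<omega> h \<le> \<omega> h') \<longrightarrow> (\<forall>h. \<omega> h \<le> ennreal c * a) \<longrightarrow>
     besov_seq_norm p r a \<omega> \<le> ennreal K * wnorm p r (modulus_seq a \<omega>) \<and>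
     wnorm p r (modulus_seq a \<omega>) \<le> ennreal K * besov_seq_norm p r a \<omega>"
proof -
  have q0: "0 < q" using q_ge_1 by simp
  have "2 powr (- (r * q)) < 1" using r q0 powr_less_mono[of "- (r * q)" 0 2] by simp
  define K1 where "K1 = 1 + c powr q / (1 - 2 powr (- (r * q)))"
  define K2 where "K2 = 1 + 2 powr (r * q) * c powr q + 2 * 2 powr (2 * (r * q))"
  have K: "0 \<le> K1" "0 \<le> K2" using \<open>2 powr (- (r * q)) < 1\<close> by (auto simp: K1_def K2_def)
  define L1 L2 where "L1 = 1 + K1 powr (1 / q)" and "L2 = K2 powr (1 / q) * 2 powr (1 / q)"
  have L: "0 < L1" "0 \<le> L2" by (auto simp: L1_def L2_def add_pos_nonneg)
  have "besov_seq_norm p r a \<omega> \<le> ennreal (L1 + L2) * wnorm p r (modulus_seq a \<omega>) \<and>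
     wnorm p r (modulus_seq a \<omega>) \<le> ennreal (L1 + L2) * besov_seq_norm p r a \<omega>"
    if mono: "\<And>h h'. h \<le> h' \<Longrightarrow> \<omega> h \<le> \<omega> h'" and bd: "\<And>h. \<omega> h \<le> ennreal c * a" for a \<omega>
  proof
    let ?W = "wnorm p r (modulus_seq a \<omega>)"
    let ?\<Phi> = "\<integral>\<^sup>+h\<in>{0<..}. epowr (ennreal (h powr (- r)) * \<omega> h) q * ennreal (1 / h) \<partial>lborel"
    have B: "besov_seq_norm p r a \<omega> = a + epowr ?\<Phi> (1 / q)"
      using p(2) by (simp add: besov_seq_norm_def q_def Let_def)
    have "a \<le> ?W" using wnorm_ge_term[OF p(1), of r "modulus_seq a \<omega>" 0] r by (simp add: modulus_seq_def)
    moreover have "epowr ?\<Phi> (1 / q) \<le> epowr (ennreal K1 * epowr ?W q) (1 / q)"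
      unfolding K1_def using q0 by (intro epowr_mono besov_integral_le mono bd) auto
    then have "epowr ?\<Phi> (1 / q) \<le> ennreal (K1 powr (1 / q)) * ?W"
      using q0 K by (simp add: epowr_mult epowr_inverse epowr_ennreal)
    ultimately have "besov_seq_norm p r a \<omega> \<le> ?W + ennreal (K1 powr (1 / q)) * ?W"
      unfolding B by (rule add_mono)
    also have "\<dots> = ennreal L1 * ?W" by (simp add: L1_def distrib_right)
    also have "\<dots> \<le> ennreal (L1 + L2) * ?W" using L by (intro mult_right_mono ennreal_leI) auto
    finally show "besov_seq_norm p r a \<omega> \<le> ennreal (L1 + L2) * ?W" .
    have "?W = epowr (epowr ?W q) (1 / q)" using q0 by (simp add: epowr_inverse)
    also have "\<dots> \<le> epowr (ennreal K2 * (epowr a q + ?\<Phi>)) (1 / q)"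
      unfolding K2_def using q0 by (intro epowr_mono besov_integral_ge mono bd) auto
    also have "\<dots> = ennreal (K2 powr (1 / q)) * epowr (epowr a q + ?\<Phi>) (1 / q)"
      using K by (simp add: epowr_mult epowr_ennreal)
    also have "\<dots> \<le> ennreal (K2 powr (1 / q)) * (epowr 2 (1 / q) * (epowr (epowr a q) (1 / q) + epowr ?\<Phi> (1 / q)))"
      using q0 by (intro mult_left_mono epowr_add_le) auto
    also have "\<dots> = ennreal L2 * besov_seq_norm p r a \<omega>"
      using q0 epowr_ennreal[of 2 "1 / q"] by (simp add: B L2_def epowr_inverse ennreal_mult mult.assoc)
    also have "\<dots> \<le> ennreal (L1 + L2) * besov_seq_norm p r a \<omega>" using L by (intro mult_right_mono ennreal_leI) auto
    finally show "?W \<le> ennreal (L1 + L2) * besov_seq_norm p r a \<omega>" .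
  qed
  then show ?thesis using L by (intro exI[of _ "L1 + L2"]) auto
qed

end

lemma besov_seq_norm_equiv:
  assumes p: "1 \<le> p" and r: "0 < r" and c: "0 \<le> c"
  shows "\<exists>K>0. \<forall>a \<omega>. (\<forall>h h'. h \<le> h' \<longrightarrow> \<omega> h \<le> \<omega> h') \<longrightarrow> (\<forall>h. \<omega> h \<le> ennreal c * a) \<longrightarrow>
     besov_seq_norm p r a \<omega> \<le> ennreal K * wnorm p r (modulus_seq a \<omega>) \<and>
     wnorm p r (modulus_seq a \<omega>) \<le> ennreal K * besov_seq_norm p r a \<omega>"
proof (cases "p = \<infinity>")
  case True
  define K where "K = 2 + c + 2 powr r"
  have "ennreal (2 + c) \<le> ennreal K" "ennreal (2 powr r) \<le> ennreal K"
    using c by (auto simp: K_def intro!: ennreal_leI)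
  then have *: "ennreal (2 + c) * x \<le> ennreal K * x" "ennreal (2 powr r) * x \<le> ennreal K * x" for x
    by (intro mult_right_mono; simp)+
  have "0 < K" using c by (simp add: K_def add_nonneg_pos)
  moreover have "besov_seq_norm p r a \<omega> \<le> ennreal K * wnorm p r (modulus_seq a \<omega>) \<and>
     wnorm p r (modulus_seq a \<omega>) \<le> ennreal K * besov_seq_norm p r a \<omega>"
    if "\<forall>h h'. h \<le> h' \<longrightarrow> \<omega> h \<le> \<omega> h'" "\<forall>h. \<omega> h \<le> ennreal c * a" for a \<omega>
    unfolding True using besov_seq_norm_top[OF r c, of \<omega> a] that
    by (auto intro: order_trans[OF _ *(1)] order_trans[OF _ *(2)])
  ultimately show ?thesis by blast
next
  case False
  then show ?thesis using besov_seq_norm_finite[OF p _ r c] by simp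
qed

lemma modulus_mono: "h \<le> h' \<Longrightarrow> modulus N n h A \<le> modulus N n h' A"
  unfolding modulus_def by (intro SUP_subset_mono) auto

lemma besov_norm_seq:
  "besov_norm N p r A = besov_seq_norm p r (ennreal (N A)) (\<lambda>h. modulus N (nat \<lfloor>r\<rfloor> + 1) h A)"
  by (simp add: besov_norm_def besov_seq_norm_def Let_def)

section \<open>Dyadic partitions of unity\<close>

text \<open>Decay is wanted in terms of k + 1, which is at most 2 \<open>norm x\<close> for k \<ge>
  1; this costs the power of 2. For k = 0 the plain bound is used.\<close>

lemma rapid_decay_bound:
  fixes f :: "real ^ 'd::finite \<Rightarrow> complex"
  assumes "\<And>x. cmod (f x) \<le> C" and "\<And>x. norm x ^ (CARD('d) + 2) * cmod (f x) \<le> C" and "norm x < real (Suc k)" and "real k \<le> norm x"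
  shows "cmod (f x) \<le> 2 ^ (CARD('d) + 2) * C / real (Suc k) ^ (CARD('d) + 2)"
proof -
  let ?M = "CARD('d) + 2"
  have C: "0 \<le> C" using assms(1)[of 0] norm_ge_zero order_trans by blast
  have "real (Suc k) ^ ?M * cmod (f x) \<le> 2 ^ ?M * C"
  proof (cases "k = 0")
    case True
    have "1 \<le> (2::real) ^ ?M" by (rule one_le_power) simp
    then have "1 * C \<le> 2 ^ ?M * C" using C by (rule mult_right_mono)
    then show ?thesis using True assms(1)[of x] by simp
  next
    case False
    then have "real (Suc k) \<le> 2 * norm x" using assms(4) by simp
    then have "real (Suc k) ^ ?M * cmod (f x) \<le> (2 * norm x) ^ ?M * cmod (f x)"
      by (intro mult_right_mono power_mono) auto
    also have "\<dots> = 2 ^ ?M * (norm x ^ ?M * cmod (f x))" by (simp only: power_mult_distrib mult.assoc)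
    also have "\<dots> \<le> 2 ^ ?M * C" by (intro mult_left_mono assms(2)) simp
    finally show ?thesis .
  qed
  then show ?thesis by (simp add: pos_le_divide_eq mult.commute del: power_Suc of_nat_Suc)
qed

text \<open>The modulus is dominated by a sum of multiples of indicators of balls of radius k + 1.
  Their volumes grow like (k + 1)^d, so that decay of order d + 2 leaves the convergent series of 1
  / (k + 1)^2.\<close>

lemma integrable_rapid_decay:
  fixes f :: "real ^ 'd::finite \<Rightarrow> complex"
  assumes meas: "f \<in> borel_measurable borel"
    and C: "\<And>x. cmod (f x) \<le> C" "\<And>x. norm x ^ (CARD('d) + 2) * cmod (f x) \<le> C"
  shows "integrable lborel f"
proof (rule integrableI_bounded)
  show "f \<in> borel_measurable lborel" using meas by simp
  let ?M = "CARD('d) + 2"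
  define V where "V = unit_ball_vol (real CARD('d))"
  define D where "D = 2 ^ ?M * C"
  have C0: "0 \<le> C" using C(1)[of 0] norm_ge_zero order_trans by blast
  have D: "0 \<le> D" using C0 by (simp add: D_def)
  have V: "0 \<le> V" by (simp add: V_def)
  let ?c = "\<lambda>k. ennreal (D / real (Suc k) ^ ?M)"
  let ?B = "\<lambda>k. ball (0 :: real ^ 'd) (real (Suc k))"
  have "ennreal (cmod (f x)) \<le> (\<Sum>k. ?c k * indicator (?B k) x)" for x
  proof -
    define k where "k = nat \<lfloor>norm x\<rfloor>"
    have "0 \<le> norm x" by simp
    then have k: "real k \<le> norm x" "norm x < real (Suc k)" unfolding k_def by linarith+
    have "ennreal (cmod (f x)) \<le> ?c k * indicator (?B k) x"
      using rapid_decay_bound[OF C k(2,1)] k(2) by (simp add: D_def ennreal_leI del: of_nat_Suc power_Suc)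
    also have "\<dots> \<le> (\<Sum>k. ?c k * indicator (?B k) x)" by (rule suminf_ge_term)
    finally show ?thesis .
  qed
  then have "(\<integral>\<^sup>+x. ennreal (norm (f x)) \<partial>lborel) \<le> (\<integral>\<^sup>+x. (\<Sum>k. ?c k * indicator (?B k) x) \<partial>lborel)"
    by (intro nn_integral_mono) simp
  also have "\<dots> = (\<Sum>k. ?c k * emeasure lborel (?B k))"
    by (rule nn_integral_step_function) simp
  also have "\<dots> = (\<Sum>k. ennreal (D * V * (1 / real (Suc k) ^ 2)))"
  proof (rule suminf_cong)
    fix k
    have "emeasure lborel (?B k) = ennreal (V * real (Suc k) ^ CARD('d))"
      unfolding V_def by (subst emeasure_ball) auto
    then have "?c k * emeasure lborel (?B k) = ?c k * ennreal (V * real (Suc k) ^ CARD('d))"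
      by (simp only:)
    also have "\<dots> = ennreal (D / real (Suc k) ^ ?M * (V * real (Suc k) ^ CARD('d)))"
      using D V by (intro ennreal_mult[symmetric]) auto
    also have "D / real (Suc k) ^ ?M * (V * real (Suc k) ^ CARD('d)) = D * V * (1 / real (Suc k) ^ 2)"
      by (simp add: power_add power2_eq_square field_simps del: of_nat_Suc)
    finally show "?c k * emeasure lborel (?B k) = ennreal (D * V * (1 / real (Suc k) ^ 2))" .
  qed
  also have "\<dots> < \<infinity>"
  proof -
    have "summable (\<lambda>k. D * V * (1 / real (Suc k) ^ 2))"
      using inverse_squares_sums by (intro summable_mult) (auto simp: sums_iff add.commute)
    then show ?thesis
      using D V by (subst suminf_ennreal2) auto
  qed
  finally show "(\<integral>\<^sup>+x. ennreal (norm (f x)) \<partial>lborel) < \<infinity>" .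
qed

lemma schwartz_integrable:
  fixes f :: "real ^ 'd::finite \<Rightarrow> complex"
  assumes "schwartz f"
  shows "integrable lborel f"
proof -
  have d: "f differentiable at x" for x
    using spec[OF assms[unfolded schwartz_def], of "[]"] by simp
  have b: "bounded (range (\<lambda>x. norm x ^ n *\<^sub>R f x))" for n
    using spec[OF assms[unfolded schwartz_def], of "[]"] by simp
  have ex: "\<exists>C. \<forall>x. norm x ^ n * cmod (f x) \<le> C" for n
  proof -
    obtain C where C: "\<And>y. y \<in> range (\<lambda>x. norm x ^ n *\<^sub>R f x) \<Longrightarrow> norm y \<le> C"
      using b[of n] unfolding bounded_iff by blast
    have "norm x ^ n * cmod (f x) \<le> C" for x
      using C[OF rangeI[of _ x]] by simp
    then show ?thesis by blast
  qed
  obtain C0 where C0: "\<And>x. cmod (f x) \<le> C0" using ex[of 0] by auto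
  obtain C1 where C1: "\<And>x. norm x ^ (CARD('d) + 2) * cmod (f x) \<le> C1"
    using ex[of "CARD('d) + 2"] by blast
  have "continuous_on UNIV f"
    using d by (simp add: continuous_on_eq_continuous_at differentiable_imp_continuous_within)
  then have "f \<in> borel_measurable borel" by (rule borel_measurable_continuous_onI)
  then show ?thesis
    using C0 C1 by (intro integrable_rapid_decay[where C = "max C0 C1"]) (auto simp: le_max_iff_disj)
qed

lemma fourier_continuous:
  fixes f :: "real ^ 'd::finite \<Rightarrow> complex"
  assumes f: "integrable lborel f" and w: "w \<longlonglongrightarrow> \<omega>"
  shows "(\<lambda>n. fourier f (w n)) \<longlonglongrightarrow> fourier f \<omega>"
  unfolding fourier_def
proof (rule integral_dominated_convergence[where w = "\<lambda>x. cmod (f x)"])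
  show "AE x in lborel. (\<lambda>i. f x * cis (- 2 * pi * (w i \<bullet> x))) \<longlonglongrightarrow> f x * cis (- 2 * pi * (\<omega> \<bullet> x))"
    by (intro AE_I2 tendsto_intros w)
  have "(\<lambda>x. cis (- 2 * pi * (v \<bullet> x))) \<in> borel_measurable borel" for v :: "real ^ 'd"
    by (intro borel_measurable_continuous_onI continuous_intros)
  then show "(\<lambda>x. f x * cis (- 2 * pi * (\<omega> \<bullet> x))) \<in> borel_measurable lborel"
    "\<And>i. (\<lambda>x. f x * cis (- 2 * pi * (w i \<bullet> x))) \<in> borel_measurable lborel"
    using f by auto
qed (use f in \<open>auto simp: norm_mult\<close>)

context
  fixes \<phi> :: "real ^ 'd::finite \<Rightarrow> complex"
  assumes gen: "dyadic_generator \<phi>"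
begin

lemma generator_integrable: "integrable lborel \<phi>"
  using gen by (intro schwartz_integrable) (simp add: dyadic_generator_def)

text \<open>The definition places the support in a closed shell. A boundary point is a limit of
  dilates outside the shell, where the transform vanishes, and continuity makes the inequalities
  strict, as the strict range |l| < 2^(k+1) of the blocks requires.\<close>

lemma fourier_generator_support:
  assumes "fourier \<phi> \<omega> \<noteq> 0"
  shows "1 / 2 < infnorm \<omega>" and "infnorm \<omega> < 2"
proof -
  have sub: "fourier \<phi> v = 0" if "infnorm v < 1 / 2 \<or> 2 < infnorm v" for v
  proof (rule ccontr)
    assume "fourier \<phi> v \<noteq> 0"
    then have "v \<in> {\<omega>. fourier \<phi> \<omega> \<noteq> 0}" by simp
    then have "v \<in> closure {\<omega>. fourier \<phi> \<omega> \<noteq> 0}" by (rule subsetD[OF closure_subset])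
    moreover have "closure {\<omega>. fourier \<phi> \<omega> \<noteq> 0} \<subseteq> {\<omega>. 1 / 2 \<le> infnorm \<omega> \<and> infnorm \<omega> \<le> 2}"
      using gen unfolding dyadic_generator_def by (elim conjE)
    ultimately have "v \<in> {\<omega>. 1 / 2 \<le> infnorm \<omega> \<and> infnorm \<omega> \<le> 2}" by (rule rev_subsetD)
    then show False using that by simp
  qed
  have lim: "(\<lambda>n. (1 + c / real (Suc n)) *\<^sub>R \<omega>) \<longlonglongrightarrow> \<omega>" for c :: real
  proof -
    have "(\<lambda>n. c / real (Suc n)) \<longlonglongrightarrow> 0" by (rule LIMSEQ_Suc[OF lim_const_over_n])
    from tendsto_scaleR[OF tendsto_add[OF tendsto_const this, of 1] tendsto_const, of \<omega>] show ?thesis by simp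
  qed
  have boundary: "infnorm \<omega> \<noteq> 2"
  proof
    assume a: "infnorm \<omega> = 2"
    have "fourier \<phi> ((1 + 1 / real (Suc n)) *\<^sub>R \<omega>) = 0" for n
      by (rule sub) (simp add: infnorm_mul a abs_of_pos add_pos_pos)
    then have "fourier \<phi> \<omega> = 0"
      using LIMSEQ_unique[OF fourier_continuous[OF generator_integrable lim[of 1]]] by simp
    with assms show False by simp
  qed
  have boundary': "infnorm \<omega> \<noteq> 1 / 2"
  proof
    assume a: "infnorm \<omega> = 1 / 2"
    have "fourier \<phi> ((1 + (- 1) / real (Suc n)) *\<^sub>R \<omega>) = 0" for n
      by (rule sub) (auto simp: infnorm_mul a field_simps abs_if)
    then have "fourier \<phi> \<omega> = 0"
      using LIMSEQ_unique[OF fourier_continuous[OF generator_integrable lim[of "- 1"]]] by simp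
    with assms show False by simp
  qed
  show "1 / 2 < infnorm \<omega>" "infnorm \<omega> < 2"
    using assms sub[of \<omega>] boundary boundary' by fastforce+
qed

lemma infnorm_rvec_ge_1: "l \<noteq> 0 \<Longrightarrow> 1 \<le> infnorm (rvec l :: real ^ 'd)"
proof -
  assume "l \<noteq> 0"
  then obtain j where "l $ j \<noteq> 0" by (auto simp: vec_eq_iff)
  then have "1 \<le> \<bar>rvec l $ j\<bar>" by (simp flip: of_int_abs)
  also have "\<dots> \<le> infnorm (rvec l)" using infnorm_le_iff[of "rvec l" "infnorm (rvec l)"] by simp
  finally show ?thesis .
qed

lemma fourier_generator_zero: "fourier \<phi> 0 = 0"
  using fourier_generator_support(1)[of 0] by (auto simp: infnorm_0)

lemma dyadic_hat_nat: "dyadic_hat \<phi> (int k) \<omega> = fourier \<phi> ((1 / 2 ^ k) *\<^sub>R \<omega>)"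
  by (simp add: dyadic_hat_def power_int_minus inverse_eq_divide)

lemma dyadic_hat_support:
  assumes "dyadic_hat \<phi> (int k) \<omega> \<noteq> 0"
  shows "2 ^ k / 2 < infnorm \<omega>" and "infnorm \<omega> < 2 * 2 ^ k"
  using fourier_generator_support[of "(1 / 2 ^ k) *\<^sub>R \<omega>"] assms
  by (simp_all add: dyadic_hat_nat infnorm_mul field_simps)

lemma dyadic_hat_minus_one: "dyadic_hat \<phi> (- 1) 0 = 1"
  by (simp add: dyadic_hat_def fourier_generator_zero)

text \<open>A nonzero lattice point has \<open>infnorm\<close> at least 1, which kills the negative
  scales; \<open>infnorm\<close> below 2^n kills those above n.\<close>

lemma dyadic_partition:
  assumes "l \<noteq> 0" and "infnorm (rvec l) < 2 ^ n"
  shows "(\<Sum>k\<le>n. dyadic_hat \<phi> (int k) (rvec l)) = 1"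
proof -
  let ?g = "\<lambda>k::int. fourier \<phi> ((2 powi (- k)) *\<^sub>R rvec l)"
  have zero: "?g k = 0" if "k \<notin> int ` {..n}" for k
  proof (rule ccontr)
    assume nz: "?g k \<noteq> 0"
    have s: "1 / 2 < 2 powi (- k) * infnorm (rvec l)" "2 powi (- k) * infnorm (rvec l) < 2"
      using fourier_generator_support[OF nz] by (simp_all add: infnorm_mul)
    have k: "k < 0 \<or> int n < k"
      using that by (metis atMost_iff image_eqI int_nat_eq nat_le_iff not_less)
    then show False
    proof
      assume "k < 0"
      then have "2 ^ 1 \<le> (2::real) ^ nat (- k)" by (intro power_increasing) auto
      then have "2 \<le> (2::real) powi (- k)" using \<open>k < 0\<close> by (simp add: power_int_def)
      then have "2 * 1 \<le> 2 powi (- k) * infnorm (rvec l)"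
        using infnorm_rvec_ge_1[OF assms(1)] by (intro mult_mono) auto
      with s(2) show False by simp
    next
      assume kn: "int n < k"
      then have "2 powi (- k) = 1 / (2::real) ^ nat k"
        by (simp add: power_int_def power_inverse inverse_eq_divide flip: power_one_over)
      also have "\<dots> \<le> 1 / 2 ^ Suc n"
        using kn by (intro divide_left_mono power_increasing) auto
      finally have "2 powi (- k) * infnorm (rvec l) \<le> 1 / 2 ^ Suc n * 2 ^ n"
        using assms(2) infnorm_pos_le[of "rvec l"] by (intro mult_mono) auto
      with s(1) show False by simp
    qed
  qed
  have "(?g has_sum (\<Sum>k\<in>int ` {..n}. ?g k)) UNIV"
    by (rule has_sum_finite_neutralI) (use zero in auto)
  moreover have "(?g has_sum 1) UNIV"
    using gen assms(1) by (auto simp: dyadic_generator_def)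
  ultimately have "(\<Sum>k\<in>int ` {..n}. ?g k) = 1" by (rule has_sum_unique)
  then show ?thesis
    by (simp add: sum.reindex dyadic_hat_def)
qed

end

section \<open>The blocks as multipliers on the lattice\<close>

lemma finite_infnorm_less: "finite {l :: int ^ 'd::finite. infnorm (rvec l) < c}"
proof (rule finite_subset[OF _ finite_vec_bounded])
  show "{l :: int ^ 'd. infnorm (rvec l) < c} \<subseteq> {l. \<forall>j. \<bar>l $ j\<bar> \<le> \<lceil>c\<rceil>}"
  proof (intro subsetI CollectI allI)
    fix l :: "int ^ 'd" and j assume "l \<in> {l. infnorm (rvec l) < c}"
    then have "\<bar>rvec l $ j\<bar> < c" by (simp add: infnorm_less_iff)
    then have "real_of_int \<bar>l $ j\<bar> \<le> real_of_int \<lceil>c\<rceil>"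
      using le_of_int_ceiling[of c] unfolding rvec_nth of_int_abs by linarith
    then show "\<bar>l $ j\<bar> \<le> \<lceil>c\<rceil>" by (simp only: of_int_le_iff)
  qed
qed

lemma block_sum_fmult:
  assumes "finite L"
  shows "(\<Sum>l\<in>L. mat_scale (c l) (side_diag l A)) = fmult (\<lambda>m. if m \<in> L then c m else 0) A"
proof -
  have "(\<Sum>l\<in>L. mat_scale (c l) (side_diag l A)) = fmult (\<lambda>m. \<Sum>l\<in>L. c l * (if m = l then 1 else 0)) A"
    by (simp only: fmult_sum fmult_cmult side_diag_fmult)
  also have "(\<lambda>m. \<Sum>l\<in>L. c l * (if m = l then 1 else 0)) = (\<lambda>m. if m \<in> L then c m else 0)"
    using assms by (simp add: if_distrib[of "(*) _"] cong: if_cong)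
  finally show ?thesis .
qed

text \<open>Index n stands for the block k = n - 1. At index 0 only the lattice point 0 lies in the
  range of the block, and the low-pass function has the value 1 there.\<close>

definition smooth_symbol :: "(real ^ 'd::finite \<Rightarrow> complex) \<Rightarrow> nat \<Rightarrow> int ^ 'd \<Rightarrow> complex" where
  "smooth_symbol \<phi> n m = (case n of 0 \<Rightarrow> if m = 0 then 1 else 0 | Suc k \<Rightarrow> dyadic_hat \<phi> (int k) (rvec m))"

definition sharp_symbol :: "nat \<Rightarrow> int ^ 'd::finite \<Rightarrow> complex" where
  "sharp_symbol n m = (case n of 0 \<Rightarrow> if m = 0 then 1 else 0
     | Suc k \<Rightarrow> if 2 ^ k \<le> infnorm (rvec m) \<and> infnorm (rvec m) < 2 ^ Suc k then 1 else 0)"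

lemma infnorm_rvec_less_1_iff: "infnorm (rvec m) < 1 \<longleftrightarrow> m = (0 :: int ^ 'd::finite)"
  by (auto simp: infnorm_less_iff vec_eq_iff) (metis less_irrefl of_int_abs of_int_less_1_iff zabs_less_one_iff)

text \<open>The range of summation contains all lattice points at which \<open>dyadic_hat\<close> is
  nonzero, so that for k \<ge> 0 the cut-off removes nothing.\<close>

lemma smooth_block_fmult:
  fixes A :: "'d::finite zmat"
  assumes "dyadic_generator \<phi>"
  shows "smooth_block \<phi> (int n - 1) A = fmult (smooth_symbol \<phi> n) A"
proof -
  let ?k = "int n - 1"
  let ?L = "{l. real_of_int \<lfloor>(2::real) powi (?k - 1)\<rfloor> \<le> infnorm (rvec l) \<and> infnorm (rvec l) < 2 powi (?k + 1)}"
  have fin: "finite ?L" by (rule finite_subset[OF _ finite_infnorm_less[of "2 powi (?k + 1)"]]) auto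
  have "(if m \<in> ?L then dyadic_hat \<phi> ?k (rvec m) else 0) = smooth_symbol \<phi> n m" for m :: "int ^ 'd"
  proof (cases n)
    case 0
    have "\<lfloor>(2::real) powi (- 2)\<rfloor> = 0" by (simp add: power_int_def power2_eq_square)
    then have "m \<in> ?L \<longleftrightarrow> m = 0" using 0 by (auto simp: infnorm_rvec_less_1_iff infnorm_pos_le)
    then show ?thesis using 0 dyadic_hat_minus_one[OF assms] by (simp add: smooth_symbol_def)
  next
    case (Suc k)
    have "m \<in> ?L" if nz: "dyadic_hat \<phi> (int k) (rvec m) \<noteq> 0"
    proof -
      have "2 powi (int k - 1) = 2 ^ k / (2::real)" by (simp add: power_int_diff)
      then have "real_of_int \<lfloor>(2::real) powi (int k - 1)\<rfloor> \<le> infnorm (rvec m)"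
        using dyadic_hat_support(1)[OF assms nz] of_int_floor_le[of "(2::real) powi (int k - 1)"] by linarith
      moreover have "2 powi (int k + 1) = 2 * (2::real) ^ k" by (simp add: power_int_add)
      ultimately show ?thesis using dyadic_hat_support(2)[OF assms nz] Suc by simp
    qed
    then show ?thesis using Suc by (auto simp: smooth_symbol_def)
  qed
  then show ?thesis
    unfolding smooth_block_def block_sum_fmult[OF fin] by (simp only:)
qed

lemma sharp_block_fmult:
  fixes A :: "'d::finite zmat"
  shows "sharp_block (int n - 1) A = fmult (sharp_symbol n) A"
proof -
  let ?k = "int n - 1"
  let ?L = "{l. real_of_int \<lfloor>(2::real) powi ?k\<rfloor> \<le> infnorm (rvec l) \<and> infnorm (rvec l) < 2 powi (?k + 1)}"
  have fin: "finite ?L" by (rule finite_subset[OF _ finite_infnorm_less[of "2 powi (?k + 1)"]]) auto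
  have "(if m \<in> ?L then 1 else 0) = sharp_symbol n m" for m :: "int ^ 'd"
  proof (cases n)
    case 0
    have "\<lfloor>(2::real) powi (- 1)\<rfloor> = 0" by (simp add: power_int_def)
    then have "m \<in> ?L \<longleftrightarrow> m = 0" using 0 by (auto simp: infnorm_rvec_less_1_iff infnorm_pos_le)
    then show ?thesis using 0 by (simp add: sharp_symbol_def)
  next
    case (Suc k)
    have "real_of_int \<lfloor>(2::real) ^ k\<rfloor> = 2 ^ k"
      by (metis floor_of_int of_int_numeral of_int_power)
    moreover have "2 powi (int k + 1) = 2 * (2::real) ^ k" by (simp add: power_int_add)
    ultimately show ?thesis using Suc by (simp add: sharp_symbol_def)
  qed
  then have "fmult (\<lambda>m. if m \<in> ?L then 1 else 0) A = fmult (sharp_symbol n) A" by (simp only:)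
  moreover have "sharp_block ?k A = (\<Sum>l\<in>?L. mat_scale 1 (side_diag l A))"
    by (simp add: sharp_block_def mat_scale_def)
  ultimately show ?thesis by (simp only: block_sum_fmult[OF fin])
qed

text \<open>What the smooth and the sharp symbols share, and what the bounds of errors and moduli by
  blocks rest on: localization in frequency, and partial sums that reach 1 at every
  frequency.\<close>

definition littlewood_paley :: "(nat \<Rightarrow> int ^ 'd::finite \<Rightarrow> complex) \<Rightarrow> bool" where
  "littlewood_paley \<mu> \<longleftrightarrow> (\<forall>n m. \<mu> n m \<noteq> 0 \<longrightarrow> infnorm (rvec m) < 2 ^ n)
     \<and> (\<forall>m. \<forall>\<^sub>F L in sequentially. (\<Sum>n<L. \<mu> n m) = 1)"

lemma infnorm_rvec_bounded: "\<exists>n. infnorm (rvec m) < 2 ^ n"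
  using real_arch_pow[of 2 "infnorm (rvec m)"] by auto

lemma littlewood_paley_smooth:
  fixes \<phi> :: "real ^ 'd::finite \<Rightarrow> complex"
  assumes "dyadic_generator \<phi>"
  shows "littlewood_paley (smooth_symbol \<phi>)"
  unfolding littlewood_paley_def
proof (intro conjI allI impI)
  fix n m assume "smooth_symbol \<phi> n m \<noteq> 0"
  then show "infnorm (rvec m) < 2 ^ n"
  proof (cases n)
    case (Suc k)
    then have "dyadic_hat \<phi> (int k) (rvec m) \<noteq> 0"
      using \<open>smooth_symbol \<phi> n m \<noteq> 0\<close> by (simp add: smooth_symbol_def)
    from dyadic_hat_support(2)[OF assms this] Suc show ?thesis by simp
  qed (simp add: smooth_symbol_def infnorm_0 split: if_splits)
next
  fix m :: "int ^ 'd"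
  obtain n where n: "infnorm (rvec m) < 2 ^ n" using infnorm_rvec_bounded by blast
  have "(\<Sum>i<L. smooth_symbol \<phi> i m) = 1" if L: "n + 2 \<le> L" for L
  proof -
    have "L = Suc (Suc (L - 2))" "n \<le> L - 2" using L by auto
    then obtain L' where L': "L = Suc (Suc L')" "n \<le> L'" by blast
    have split: "(\<Sum>i<L. smooth_symbol \<phi> i m) = smooth_symbol \<phi> 0 m + (\<Sum>k\<le>L'. dyadic_hat \<phi> (int k) (rvec m))"
      unfolding L'(1) sum.lessThan_Suc_shift[of _ "Suc L'"] by (simp only: smooth_symbol_def nat.case lessThan_Suc_atMost)
    show ?thesis
    proof (cases "m = 0")
      case True
      have "dyadic_hat \<phi> (int k) (rvec 0) = 0" for k
        by (simp add: dyadic_hat_nat[OF assms] fourier_generator_zero[OF assms])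
      then show ?thesis unfolding split by (simp add: True smooth_symbol_def)
    next
      case False
      have "(2::real) ^ n \<le> 2 ^ L'" using L'(2) by (intro power_increasing) auto
      with n have "infnorm (rvec m) < 2 ^ L'" by (rule less_le_trans)
      then show ?thesis
        unfolding split using dyadic_partition[OF assms False] False by (simp add: smooth_symbol_def)
    qed
  qed
  then show "\<forall>\<^sub>F L in sequentially. (\<Sum>i<L. smooth_symbol \<phi> i m) = 1"
    unfolding eventually_sequentially by blast
qed

lemma littlewood_paley_sharp: "littlewood_paley (sharp_symbol :: nat \<Rightarrow> int ^ 'd::finite \<Rightarrow> complex)"
  unfolding littlewood_paley_def
proof (intro conjI allI impI)
  fix n and m :: "int ^ 'd" assume "sharp_symbol n m \<noteq> 0"
  then show "infnorm (rvec m) < 2 ^ n"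
    by (cases n) (auto simp: sharp_symbol_def infnorm_0 split: if_splits)
next
  fix m :: "int ^ 'd"
  have partial: "(\<Sum>n<Suc L. sharp_symbol n m) = (if infnorm (rvec m) < 2 ^ L then 1 else 0)" for L
  proof (induction L)
    case 0
    then show ?case by (simp add: sharp_symbol_def infnorm_rvec_less_1_iff)
  next
    case (Suc L)
    have "sharp_symbol (Suc L) m = (if 2 ^ L \<le> infnorm (rvec m) \<and> infnorm (rvec m) < 2 ^ Suc L then 1 else 0)"
      by (simp add: sharp_symbol_def)
    moreover have "(\<Sum>n<Suc (Suc L). sharp_symbol n m) = (\<Sum>n<Suc L. sharp_symbol n m) + sharp_symbol (Suc L) m"
      by (rule sum.lessThan_Suc)
    moreover have "infnorm (rvec m) < 2 ^ Suc L" if "infnorm (rvec m) < 2 ^ L"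
      using less_le_trans[OF that, of "2 ^ Suc L"] by simp
    ultimately show ?case
      unfolding Suc by (simp del: power_Suc)
  qed
  obtain n where n: "infnorm (rvec m) < 2 ^ n" using infnorm_rvec_bounded by blast
  have "(\<Sum>i<L. sharp_symbol i m) = 1" if "n + 1 \<le> L" for L
  proof -
    obtain L' where L': "L = Suc L'" "n \<le> L'" using \<open>n + 1 \<le> L\<close> by (cases L) auto
    have "(2::real) ^ n \<le> 2 ^ L'" using L'(2) by (intro power_increasing) auto
    with n have "infnorm (rvec m) < 2 ^ L'" by (rule less_le_trans)
    then show ?thesis unfolding L'(1) partial by simp
  qed
  then show "\<forall>\<^sub>F L in sequentially. (\<Sum>i<L. sharp_symbol i m) = 1"
    unfolding eventually_sequentially by blast
qed

section \<open>Comparison of the norms\<close>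

text \<open>One half of an equivalence. Being transitive, it allows the equivalences to be assembled
  from chains of one-sided bounds.\<close>

definition norm_dominated :: "'a set \<Rightarrow> ('a \<Rightarrow> ennreal) \<Rightarrow> ('a \<Rightarrow> ennreal) \<Rightarrow> bool" where
  "norm_dominated S F G \<longleftrightarrow> (\<exists>K>0. \<forall>A\<in>S. F A \<le> ennreal K * G A)"

lemma norm_dominatedI: "0 < K \<Longrightarrow> (\<And>A. A \<in> S \<Longrightarrow> F A \<le> ennreal K * G A) \<Longrightarrow> norm_dominated S F G"
  by (auto simp: norm_dominated_def)

lemma norm_dominated_trans:
  assumes "norm_dominated S F G" "norm_dominated S G H"
  shows "norm_dominated S F H"
proof -
  obtain K L where K: "0 < K" "\<And>A. A \<in> S \<Longrightarrow> F A \<le> ennreal K * G A"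
    and L: "0 < L" "\<And>A. A \<in> S \<Longrightarrow> G A \<le> ennreal L * H A"
    using assms by (auto simp: norm_dominated_def)
  show ?thesis
  proof (rule norm_dominatedI[of "K * L"])
    fix A assume A: "A \<in> S"
    have "F A \<le> ennreal K * (ennreal L * H A)"
      by (rule order_trans[OF K(2)[OF A] mult_left_mono[OF L(2)[OF A]]]) simp
    then show "F A \<le> ennreal (K * L) * H A"
      using K(1) L(1) by (simp add: ennreal_mult mult.assoc)
  qed (use K(1) L(1) in simp)
qed

lemma equiv_norms_iff: "equiv_norms S F G \<longleftrightarrow> norm_dominated S F G \<and> norm_dominated S G F"
proof
  assume "equiv_norms S F G"
  then obtain c C where c: "0 < c" "0 < C" and le: "\<And>A. A \<in> S \<Longrightarrow> ennreal c * G A \<le> F A \<and> F A \<le> ennreal C * G A"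
    by (auto simp: equiv_norms_def)
  have "G A \<le> ennreal (1 / c) * F A" if "A \<in> S" for A
  proof -
    have "G A = ennreal (1 / c) * (ennreal c * G A)"
      using c(1) by (simp add: mult.assoc[symmetric] flip: ennreal_mult)
    also have "\<dots> \<le> ennreal (1 / c) * F A" using le[OF that] by (intro mult_left_mono) auto
    finally show ?thesis .
  qed
  then show "norm_dominated S F G \<and> norm_dominated S G F"
    using c le by (auto intro: norm_dominatedI[of C] norm_dominatedI[of "1 / c"])
next
  assume "norm_dominated S F G \<and> norm_dominated S G F"
  then obtain K L where K: "0 < K" "\<And>A. A \<in> S \<Longrightarrow> F A \<le> ennreal K * G A"
    and L: "0 < L" "\<And>A. A \<in> S \<Longrightarrow> G A \<le> ennreal L * F A"
    by (auto simp: norm_dominated_def)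
  have "ennreal (1 / L) * G A \<le> F A" if "A \<in> S" for A
  proof -
    have "ennreal (1 / L) * G A \<le> ennreal (1 / L) * (ennreal L * F A)"
      using L(2)[OF that] by (intro mult_left_mono) auto
    also have "\<dots> = F A" using L(1) by (simp add: mult.assoc[symmetric] flip: ennreal_mult)
    finally show ?thesis .
  qed
  then show "equiv_norms S F G"
    unfolding equiv_norms_def using K L(1) by (intro exI[of _ "1 / L"] exI[of _ K] conjI) auto
qed

text \<open>The entry at n - s occurs in the Hardy sum with a weight of at least 2^(-l s), which
  makes shifted bounds an instance of the Hardy inequality. The subtraction is truncated, so that
  indices below s refer to entry 0.\<close>

lemma hardy_kernel_shift:
  assumes "0 \<le> l"
  shows "e (n - s) \<le> ennreal (2 powr (l * real s)) * (\<Sum>k. ennreal (hardy_kernel l n k) * e k)"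
proof -
  have "l * real (n - (n - s)) \<le> l * real s" using assms by (intro mult_left_mono) auto
  then have "1 \<le> 2 powr (l * real s) * hardy_kernel l n (n - s)"
    using assms by (auto simp: hardy_kernel_def ge_one_powr_ge_zero simp flip: powr_add)
  then have "1 * e (n - s) \<le> ennreal (2 powr (l * real s) * hardy_kernel l n (n - s)) * e (n - s)"
    by (intro mult_right_mono) auto
  also have "\<dots> = ennreal (2 powr (l * real s)) * (ennreal (hardy_kernel l n (n - s)) * e (n - s))"
    using less_imp_le[OF hardy_kernel_pos] by (simp add: ennreal_mult mult.assoc)
  also have "\<dots> \<le> ennreal (2 powr (l * real s)) * (\<Sum>k. ennreal (hardy_kernel l n k) * e k)"
    by (intro mult_left_mono suminf_ge_term) auto
  finally show ?thesis by simp
qed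

text \<open>For fixed n the kernel is bounded below by 2^(-l n); finiteness of one Hardy sum thus
  gives absolute summability of the blocks.\<close>

lemma hardy_sum_finite:
  assumes "(\<Sum>k. ennreal (hardy_kernel l n k) * ennreal (x k)) \<noteq> top" and "0 \<le> l"
  shows "(\<Sum>k. ennreal (x k)) \<noteq> top"
proof -
  have "ennreal (x k) \<le> ennreal (2 powr (l * real n)) * (ennreal (hardy_kernel l n k) * ennreal (x k))" for k
  proof -
    have "l * real (n - k) \<le> l * real n" using assms(2) by (intro mult_left_mono) auto
    then have "1 \<le> 2 powr (l * real n) * hardy_kernel l n k"
      using assms(2) by (auto simp: hardy_kernel_def ge_one_powr_ge_zero simp flip: powr_add)
    then have "1 * ennreal (x k) \<le> ennreal (2 powr (l * real n) * hardy_kernel l n k) * ennreal (x k)"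
      by (intro mult_right_mono) auto
    then show ?thesis
      using less_imp_le[OF hardy_kernel_pos] by (simp add: ennreal_mult mult.assoc)
  qed
  then have "(\<Sum>k. ennreal (x k)) \<le> (\<Sum>k. ennreal (2 powr (l * real n)) * (ennreal (hardy_kernel l n k) * ennreal (x k)))"
    by (intro suminf_le) auto
  also have "\<dots> < top"
    using assms(1) by (simp add: ennreal_mult_less_top top.not_eq_extremum)
  finally show ?thesis by simp
qed

text \<open>The weights tend to infinity while the weighted terms stay bounded. The index is a
  successor so that the term belongs to a true scale and not to the norm stored at index 0.\<close>

lemma wnorm_finite_small_term:
  assumes "1 \<le> p" "0 < r" "wnorm p r e < \<infinity>" "0 < \<epsilon>"
  shows "\<exists>n. e (Suc n) < ennreal \<epsilon>"
proof -
  define w where "w = enn2real (wnorm p r e)"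
  have w: "wnorm p r e = ennreal w" using assms(3) by (simp add: w_def infinity_ennreal_def)
  have "1 < 2 powr r" using assms(2) by simp
  then obtain n where "w / \<epsilon> < (2 powr r) ^ n" using real_arch_pow by blast
  also have "\<dots> \<le> (2 powr r) ^ Suc n" using \<open>1 < 2 powr r\<close> by (intro power_increasing) auto
  also have "\<dots> = 2 powr (real (Suc n) * r)" by (simp add: powr_power mult.commute del: power_Suc)
  finally have "w < 2 powr (real (Suc n) * r) * \<epsilon>" using assms(4) by (simp add: pos_divide_less_eq)
  then have lt: "ennreal w < ennreal (2 powr (real (Suc n) * r)) * ennreal \<epsilon>"
    using assms(4) by (subst ennreal_mult[symmetric]) (auto simp: ennreal_less_iff w_def)
  have "e (Suc n) < ennreal \<epsilon>"
  proof (rule ccontr)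
    assume "\<not> ?thesis"
    then have "ennreal (2 powr (real (Suc n) * r)) * ennreal \<epsilon> \<le> ennreal (2 powr (real (Suc n) * r)) * e (Suc n)"
      by (intro mult_left_mono) auto
    also have "\<dots> \<le> ennreal w"
      using wnorm_ge_weighted_term[OF assms(1), of "Suc n" r e] by (simp only: w)
    finally show False using lt by simp
  qed
  then show ?thesis ..
qed

context homogeneous_matrix_algebra
begin

section \<open>Errors and moduli bounded by the blocks\<close>

lemma littlewood_paley_block_band:
  assumes "littlewood_paley \<mu>" and "n \<le> k"
  shows "spectrum_in (fmult (\<mu> n) A) (band (2 ^ k))"
proof (rule spectrum_in_fmult_support)
  fix m assume "\<mu> n m \<noteq> 0"
  then have "infnorm (rvec m) < 2 ^ n" using assms(1) by (simp add: littlewood_paley_def)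
  then have "\<bar>rvec m $ j\<bar> < 2 ^ n" for j by (simp add: infnorm_less_iff)
  then have lt: "\<bar>m $ j\<bar> < 2 ^ n" for j
    unfolding rvec_nth by (metis of_int_abs of_int_less_iff of_int_numeral of_int_power)
  have "(2::int) ^ n \<le> 2 ^ k" using assms(2) by (intro power_increasing) auto
  with lt have "\<bar>m $ j\<bar> \<le> 2 ^ k" for j by (meson less_imp_le less_le_trans)
  then show "m \<in> band (2 ^ k)" by (simp add: band_def)
qed

text \<open>Absolute summability makes the partial sums Cauchy. Their entries are eventually
  constant, since the symbols add up to 1 at each frequency, and this identifies the limit.\<close>

lemma littlewood_paley_partial_sums_tendsto:
  assumes \<mu>: "littlewood_paley \<mu>" and mem: "\<And>n. fmult (\<mu> n) A \<in> S"
    and fin: "(\<Sum>n. ennreal (N (fmult (\<mu> n) A))) \<noteq> top"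
  shows "(\<lambda>L. N ((\<Sum>n<L. fmult (\<mu> n) A) - A)) \<longlonglongrightarrow> 0"
proof (rule limit_in_algebra(2))
  let ?b = "\<lambda>n. fmult (\<mu> n) A"
  show "(\<Sum>n<L. ?b n) \<in> S" for L by (intro sum_mem mem)
  have summ: "summable (\<lambda>n. N (?b n))"
    using norm_nonneg[OF mem] fin by (rule summable_suminf_not_top)
  show "\<exists>M. \<forall>m\<ge>M. \<forall>n\<ge>M. N ((\<Sum>i<m. ?b i) - (\<Sum>i<n. ?b i)) < e" if e: "0 < e" for e
  proof -
    have "Cauchy (\<lambda>L. \<Sum>n<L. N (?b n))"
      using summ by (simp add: summable_iff_convergent convergent_Cauchy)
    then obtain M where M: "\<And>m n. M \<le> m \<Longrightarrow> M \<le> n \<Longrightarrow> \<bar>(\<Sum>i<m. N (?b i)) - (\<Sum>i<n. N (?b i))\<bar> < e"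
      using e unfolding Cauchy_def dist_real_def by blast
    have le: "N ((\<Sum>i<m. ?b i) - (\<Sum>i<n. ?b i)) < e" if "M \<le> n" "n \<le> m" for m n
    proof -
      have "(\<Sum>i<m. ?b i) - (\<Sum>i<n. ?b i) = (\<Sum>i\<in>{n..<m}. ?b i)"
        using sum_diff_nat_ivl[of 0 n m ?b] \<open>n \<le> m\<close> by (simp only: atLeast0LessThan le0)
      then have "N ((\<Sum>i<m. ?b i) - (\<Sum>i<n. ?b i)) \<le> (\<Sum>i\<in>{n..<m}. N (?b i))"
        using N_sum_le[OF mem, of "\<lambda>i. i" "{n..<m}"] by (simp only:)
      also have "\<dots> = (\<Sum>i<m. N (?b i)) - (\<Sum>i<n. N (?b i))"
        using sum_diff_nat_ivl[of 0 n m "\<lambda>i. N (?b i)"] \<open>n \<le> m\<close> by (simp only: atLeast0LessThan le0)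
      also have "\<dots> < e" using M[of m n] that by linarith
      finally show ?thesis .
    qed
    have "N ((\<Sum>i<m. ?b i) - (\<Sum>i<n. ?b i)) < e" if "M \<le> m" "M \<le> n" for m n
    proof (cases "n \<le> m")
      case False
      then have "N ((\<Sum>i<n. ?b i) - (\<Sum>i<m. ?b i)) < e" using le that by simp
      then show ?thesis by (subst N_minus_commute) (auto intro: sum_mem mem)
    qed (use le that in simp)
    then show ?thesis by blast
  qed
  show "(\<lambda>L. (\<Sum>n<L. ?b n) k l) \<longlonglongrightarrow> A k l" for k l
  proof (rule tendsto_eventually)
    have "\<forall>\<^sub>F L in sequentially. (\<Sum>n<L. \<mu> n (k - l)) = 1"
      using \<mu> by (simp add: littlewood_paley_def)
    then show "\<forall>\<^sub>F L in sequentially. (\<Sum>n<L. ?b n) k l = A k l"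
      by eventually_elim (simp add: sum_matrix_apply fmult_def flip: sum_distrib_right)
  qed
qed

text \<open>The sum of the blocks below n is a competitor for the n-th error, and the remainder is
  the sum of the blocks from n on, where the kernel is 1. Written as a Hardy sum the bound has the
  same shape as the one for the moduli.\<close>

lemma approx_seq_le_blocks:
  assumes A: "A \<in> S" and \<mu>: "littlewood_paley \<mu>" and mem: "\<And>n. fmult (\<mu> n) A \<in> S" and l: "0 \<le> l"
  shows "dyadic_seq (\<lambda>k. approx_error S N (real k) A) n
         \<le> (\<Sum>k. ennreal (hardy_kernel l n k) * ennreal (N (fmult (\<mu> k) A)))" (is "_ \<le> ?T")
proof (cases "?T = top")
  case False
  let ?b = "\<lambda>n. fmult (\<mu> n) A" and ?X = "\<lambda>L. \<Sum>n<L. fmult (\<mu> n) A"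
  define t where "t = enn2real ?T"
  have t: "?T = ennreal t" "0 \<le> t" using False by (simp_all add: t_def top.not_eq_extremum)
  have X: "?X L \<in> S" for L by (intro sum_mem mem)
  have lim: "(\<lambda>L. N (?X L - A)) \<longlonglongrightarrow> 0"
    by (rule littlewood_paley_partial_sums_tendsto[OF \<mu> mem hardy_sum_finite[OF False l]])
  have "dyadic_seq (\<lambda>k. approx_error S N (real k) A) n \<le> ennreal (N (A - ?X n))"
  proof (cases n)
    case 0
    then show ?thesis
      unfolding dyadic_seq_def by (simp only: nat.case of_nat_0 approx_error_zero lessThan_0 sum.empty diff_zero order_refl)
  next
    case (Suc k)
    have "spectrum_in (?X n) (band (2 ^ k))"
      using Suc by (intro spectrum_in_sum littlewood_paley_block_band[OF \<mu>]) auto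
    then have "?X n \<in> {Y \<in> S. spectrum_in Y (band (2 ^ k))}"
      using X by (intro CollectI conjI)
    from INF_lower[OF this, of "\<lambda>Y. ennreal (N (A - Y))"] show ?thesis
      unfolding dyadic_seq_def Suc nat.case by (subst approx_error_banded) (simp_all only: one_le_power one_le_numeral)
  qed
  also have "N (A - ?X n) \<le> t"
  proof (rule LIMSEQ_le_const)
    show "(\<lambda>L. N (?X L - A) + t) \<longlonglongrightarrow> t" using tendsto_add[OF lim tendsto_const, of t] by simp
    have "N (A - ?X n) \<le> N (?X L - A) + t" if "n \<le> L" for L
    proof -
      have split: "A - ?X n = (A - ?X L) + (\<Sum>i\<in>{n..<L}. ?b i)"
        using sum_diff_nat_ivl[of 0 n L ?b] that by (simp add: atLeast0LessThan algebra_simps)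
      have "N (A - ?X n) \<le> N (A - ?X L) + N (\<Sum>i\<in>{n..<L}. ?b i)"
        unfolding split by (intro norm_triangle diff_mem A X sum_mem mem)
      moreover have "N (\<Sum>i\<in>{n..<L}. ?b i) \<le> (\<Sum>i\<in>{n..<L}. N (?b i))" by (rule N_sum_le[OF mem])
      moreover have "(\<Sum>i\<in>{n..<L}. N (?b i)) \<le> t"
      proof -
        have "ennreal (\<Sum>i\<in>{n..<L}. N (?b i)) = (\<Sum>i\<in>{n..<L}. ennreal (N (?b i)))"
          by (rule sum_ennreal[symmetric]) (rule norm_nonneg[OF mem])
        also have "\<dots> = (\<Sum>i\<in>{n..<L}. ennreal (hardy_kernel l n i) * ennreal (N (?b i)))"
          by (intro sum.cong refl) (simp add: hardy_kernel_def)
        also have "\<dots> \<le> ?T" by (intro sum_le_suminf) auto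
        finally show ?thesis unfolding t(1) using t(2) by (simp only: ennreal_le_iff)
      qed
      moreover have "N (A - ?X L) = N (?X L - A)" by (rule N_minus_commute[OF A X])
      ultimately show ?thesis by linarith
    qed
    then show "\<exists>M. \<forall>L\<ge>M. N (A - ?X n) \<le> N (?X L - A) + t" by blast
  qed
  finally show ?thesis unfolding t(1) by (simp add: ennreal_leI)
qed simp

lemma modulus_le: "A \<in> S \<Longrightarrow> modulus N n h A \<le> ennreal ((action_bound + 1) ^ n) * ennreal (N A)"
  unfolding modulus_def
proof (rule SUP_least)
  fix t assume A: "A \<in> S"
  have "0 \<le> (action_bound + 1) ^ n" using action_bound_pos by simp
  then show "ennreal (N (difference n t A)) \<le> ennreal ((action_bound + 1) ^ n) * ennreal (N A)"
    using difference_bound[OF A, of n t] norm_nonneg[OF A] by (simp add: ennreal_leI flip: ennreal_mult)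
qed

lemma difference_sum: "difference n t (\<Sum>i\<in>I. F i) = (\<Sum>i\<in>I. difference n t (F i))"
  by (simp only: difference_fmult fmult_sum_right)

text \<open>At the scale 2^-(n-1) the blocks from n on are bounded trivially, while a block k < n
  gains (2^k 2^-(n-1))^l by Bernstein's inequality, the decaying part of the kernel. The three
  summands of the constant serve n = 0, the high blocks and the low blocks.\<close>

lemma modulus_seq_le_blocks:
  assumes A: "A \<in> S" and \<mu>: "littlewood_paley \<mu>" and mem: "\<And>n. fmult (\<mu> n) A \<in> S"
  shows "modulus_seq (ennreal (N A)) (\<lambda>h. modulus N l h A) n
         \<le> ennreal (1 + (action_bound + 1) ^ l + (2 * bernstein_const) ^ l)
           * (\<Sum>k. ennreal (hardy_kernel (real l) n k) * ennreal (N (fmult (\<mu> k) A)))" (is "_ \<le> ennreal ?C * ?T")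
proof (cases "?T = top")
  case True
  have "0 < ?C" using action_bound_pos bernstein_const_pos by (simp add: add_pos_nonneg)
  then show ?thesis using True by simp
next
  case False
  let ?b = "\<lambda>n. fmult (\<mu> n) A" and ?X = "\<lambda>L. \<Sum>n<L. fmult (\<mu> n) A"
  let ?D = "(action_bound + 1) ^ l"
  have D: "0 \<le> ?D" "0 \<le> (2 * bernstein_const) ^ l" using action_bound_pos bernstein_const_pos by simp_all
  define t where "t = enn2real ?T"
  have t: "?T = ennreal t" "0 \<le> t" using False by (simp_all add: t_def top.not_eq_extremum)
  have X: "?X L \<in> S" for L by (intro sum_mem mem)
  have lim: "(\<lambda>L. N (?X L - A)) \<longlonglongrightarrow> 0"
    by (rule littlewood_paley_partial_sums_tendsto[OF \<mu> mem hardy_sum_finite[OF False]]) simp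
  show ?thesis
  proof (cases n)
    case 0
    have "ennreal (N A) \<le> ?T"
      using approx_seq_le_blocks[OF A \<mu> mem, of "real l" 0] 0 by (simp add: dyadic_seq_def approx_error_zero)
    also have "\<dots> \<le> ennreal ?C * ?T"
      using D mult_right_mono[of 1 "ennreal ?C" ?T] by simp
    finally show ?thesis using 0 by (simp add: modulus_seq_def)
  next
    case (Suc i)
    have "N (difference l s A) \<le> ?C * t" if s: "norm1 s \<le> 2 powr (- real i)" for s
    proof (rule LIMSEQ_le_const)
      show "(\<lambda>L. ?D * N (?X L - A) + ?C * t) \<longlonglongrightarrow> ?C * t"
        using tendsto_add[OF tendsto_mult_right_zero[OF lim, of ?D] tendsto_const, of "?C * t"] by simp
      have block: "N (difference l s (?b k)) \<le> ?C * (hardy_kernel (real l) n k * N (?b k))" for k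
      proof -
        have "N (difference l s (?b k)) \<le> ?C * hardy_kernel (real l) n k * N (?b k)"
        proof (cases "n \<le> k")
          case True
          have "N (difference l s (?b k)) \<le> ?D * N (?b k)" by (rule difference_bound[OF mem])
          also have "\<dots> \<le> ?C * N (?b k)" using D norm_nonneg[OF mem] by (intro mult_right_mono) auto
          finally show ?thesis using True by (simp add: hardy_kernel_def)
        next
          case nk: False
          have "N (difference l s (?b k)) \<le> (bernstein_const * real (2 ^ k) * norm1 s) ^ l * N (?b k)"
            by (rule bernstein_difference[OF mem littlewood_paley_block_band[OF \<mu> order_refl]]) simp
          also have "\<dots> \<le> (bernstein_const * real (2 ^ k) * 2 powr (- real i)) ^ l * N (?b k)"
            using s bernstein_const_pos norm1_nonneg[of s]
            by (intro mult_right_mono power_mono mult_left_mono norm_nonneg mem) auto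
          also have "(bernstein_const * real (2 ^ k) * 2 powr (- real i)) ^ l = (2 * bernstein_const) ^ l * hardy_kernel (real l) n k"
          proof -
            \<comment> \<open>Since i = n - 1, a factor 2 remains, which goes into
              \<open>2 * bernstein_const\<close>.\<close>
            have "real (2 ^ k) * 2 powr (- real i) = 2 * 2 powr (- real (n - k))"
            proof -
              have "real (2 ^ k) * 2 powr (- real i) = 2 powr (real k + (- real i))"
                unfolding powr_add by (simp add: powr_realpow)
              also have "real k + (- real i) = 1 + (- real (n - k))"
                using nk Suc by (simp add: of_nat_diff)
              also have "2 powr (1 + (- real (n - k))) = 2 * 2 powr (- real (n - k))"
                unfolding powr_add by simp
              finally show ?thesis .
            qed
            then have "(bernstein_const * real (2 ^ k) * 2 powr (- real i)) ^ l = ((2 * bernstein_const) * 2 powr (- real (n - k))) ^ l"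
              by (simp only: mult_ac)
            also have "\<dots> = (2 * bernstein_const) ^ l * (2 powr (- real (n - k))) ^ l" by (rule power_mult_distrib)
            also have "(2 powr (- real (n - k))) ^ l = hardy_kernel (real l) n k"
              using nk by (simp add: hardy_kernel_def powr_power algebra_simps)
            finally show ?thesis .
          qed
          also have "(2 * bernstein_const) ^ l * hardy_kernel (real l) n k * N (?b k) \<le> ?C * hardy_kernel (real l) n k * N (?b k)"
            using D less_imp_le[OF hardy_kernel_pos] norm_nonneg[OF mem] by (intro mult_right_mono) auto
          finally show ?thesis .
        qed
        then show ?thesis by (simp only: mult.assoc)
      qed
      have "N (difference l s A) \<le> ?D * N (?X L - A) + ?C * t" for L
      proof -
        have "difference l s A = difference l s (A - ?X L) + difference l s (?X L)"
          unfolding difference_fmult fmult_diff_right by simp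
        then have "N (difference l s A) \<le> N (difference l s (A - ?X L)) + N (difference l s (?X L))"
          using norm_triangle[OF difference_mem[OF diff_mem[OF A X]] difference_mem[OF X], of l s L l s L] by (simp only:)
        moreover have "N (difference l s (A - ?X L)) \<le> ?D * N (?X L - A)"
          using difference_bound[OF diff_mem[OF A X], of l s L] N_minus_commute[OF A X, of L] by (simp only:)
        moreover have "N (difference l s (?X L)) \<le> ?C * t"
        proof -
          have "N (difference l s (?X L)) \<le> (\<Sum>k<L. N (difference l s (?b k)))"
            unfolding difference_sum by (intro N_sum_le difference_mem mem)
          also have "\<dots> \<le> (\<Sum>k<L. ?C * (hardy_kernel (real l) n k * N (?b k)))" by (intro sum_mono block)
          also have "\<dots> = ?C * (\<Sum>k<L. hardy_kernel (real l) n k * N (?b k))" by (rule sum_distrib_left[symmetric])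
          also have "\<dots> \<le> ?C * t"
          proof (intro mult_left_mono)
            have nn: "0 \<le> hardy_kernel (real l) n k * N (?b k)" for k
              using less_imp_le[OF hardy_kernel_pos] norm_nonneg[OF mem] by simp
            have "ennreal (\<Sum>k<L. hardy_kernel (real l) n k * N (?b k)) = (\<Sum>k<L. ennreal (hardy_kernel (real l) n k) * ennreal (N (?b k)))"
              using nn less_imp_le[OF hardy_kernel_pos] norm_nonneg[OF mem]
              by (subst sum_ennreal[symmetric]) (auto simp: ennreal_mult)
            also have "\<dots> \<le> ?T" by (intro sum_le_suminf) auto
            finally show "(\<Sum>k<L. hardy_kernel (real l) n k * N (?b k)) \<le> t"
              unfolding t(1) using t(2) by (simp only: ennreal_le_iff)
          qed (use D in simp)
          finally show ?thesis .
        qed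
        ultimately show ?thesis by linarith
      qed
      then show "\<exists>M. \<forall>L\<ge>M. N (difference l s A) \<le> ?D * N (?X L - A) + ?C * t" by blast
    qed
    then have "modulus N l (2 powr (- real i)) A \<le> ennreal (?C * t)"
      unfolding modulus_def by (intro SUP_least ennreal_leI) auto
    also have "\<dots> = ennreal ?C * ?T" unfolding t(1) using D t(2) by (intro ennreal_mult) auto
    finally show ?thesis using Suc by (simp add: modulus_seq_def)
  qed
qed

lemma continuous_of_approx_small:
  assumes A: "A \<in> S" and "\<And>\<epsilon>. 0 < \<epsilon> \<Longrightarrow> \<exists>n. dyadic_seq (\<lambda>k. approx_error S N (real k) A) (Suc n) < ennreal \<epsilon>"
  shows "A \<in> continuous_elements"
proof (rule continuous_limit[OF _ A])
  fix e :: real assume e: "0 < e"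
  obtain n where "approx_error S N (real (2 ^ n)) A < ennreal e"
    using assms(2)[OF e] by (auto simp: dyadic_seq_def)
  then have "(INF X\<in>{X \<in> S. spectrum_in X (band (2 ^ n))}. ennreal (N (A - X))) < ennreal e"
    by (subst (asm) approx_error_banded) simp_all
  then obtain X where X: "X \<in> S" "spectrum_in X (band (2 ^ n))" "ennreal (N (A - X)) < ennreal e"
    unfolding INF_less_iff by blast
  then have "N (A - X) < e" using norm_nonneg[OF diff_mem[OF A X(1)]] by (simp only: ennreal_less_iff)
  with banded_continuous[OF X(1,2)] show "\<exists>X\<in>continuous_elements. N (A - X) < e" by blast
qed

section \<open>Blocks bounded by the approximation errors\<close>

text \<open>The symbol at scale k is an integral of characters at the points -x / 2^k against
  \<phi>. Its bound is the L1 norm of \<phi>, whatever k is; index 0 is a side diagonal.\<close>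

lemma smooth_symbol_bounded:
  assumes gen: "dyadic_generator \<phi>"
  shows "\<exists>K>0. \<forall>A\<in>continuous_elements. \<forall>n. fmult (smooth_symbol \<phi> n) A \<in> S \<and> N (fmult (smooth_symbol \<phi> n) A) \<le> K * N A"
proof -
  define I where "I = (LINT x|lborel. cmod (\<phi> x))"
  have I: "0 \<le> I" unfolding I_def by (intro integral_nonneg_AE) simp
  define K where "K = action_bound ^ CARD('a) + action_bound * I"
  have K: "0 < K" using action_bound_pos I by (simp add: K_def add_pos_nonneg)
  have "fmult (smooth_symbol \<phi> n) A \<in> S \<and> N (fmult (smooth_symbol \<phi> n) A) \<le> K * N A"
    if A: "A \<in> continuous_elements" for A n
  proof (cases n)
    case 0
    have "smooth_symbol \<phi> 0 = (\<lambda>x. if x = 0 then 1 else 0)" by (auto simp: smooth_symbol_def)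
    then have "fmult (smooth_symbol \<phi> n) A = side_diag 0 A" using 0 by (simp add: side_diag_fmult)
    moreover have "action_bound ^ CARD('a) * N A \<le> K * N A"
      using action_bound_pos I norm_nonneg[OF continuous_mem[OF A]] by (intro mult_right_mono) (auto simp: K_def)
    ultimately show ?thesis
      using side_diag_continuous[OF A, of 0] continuous_mem by fastforce
  next
    case (Suc k)
    define \<tau> :: "real ^ 'a \<Rightarrow> real ^ 'a" where "\<tau> x = (- (1 / 2 ^ k)) *\<^sub>R x" for x
    have \<tau>: "\<tau> \<in> borel_measurable lborel" unfolding \<tau>_def by measurable
    have "smooth_symbol \<phi> n = (\<lambda>m. LINT x|lborel. \<phi> x * character (\<tau> x) m)"
    proof
      fix m
      have "character (\<tau> x) m = cis (- 2 * pi * (((1 / 2 ^ k) *\<^sub>R rvec m) \<bullet> x))" for x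
        by (simp add: character_def \<tau>_def)
      then show "smooth_symbol \<phi> n m = (LINT x|lborel. \<phi> x * character (\<tau> x) m)"
        unfolding Suc smooth_symbol_def nat.case dyadic_hat_nat[OF gen] fourier_def by simp
    qed
    moreover have "action_bound * I * N A \<le> K * N A"
      using action_bound_pos norm_nonneg[OF continuous_mem[OF A]] by (intro mult_right_mono) (auto simp: K_def)
    ultimately show ?thesis
      using integral_multiplier[OF A generator_integrable[OF gen] \<tau>] unfolding I_def by fastforce
  qed
  with K show ?thesis by blast
qed

text \<open>Index k + 2 is the dyadic scale k + 1, whose support lies in \<open>infnorm\<close>
  above 2^k and so misses the band.\<close>

lemma smooth_symbol_high_pass:
  assumes "dyadic_generator \<phi>" and "m \<in> band (2 ^ k)"
  shows "smooth_symbol \<phi> (Suc (Suc k)) m = 0"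
proof (rule ccontr)
  assume "smooth_symbol \<phi> (Suc (Suc k)) m \<noteq> 0"
  then have "dyadic_hat \<phi> (int (Suc k)) (rvec m) \<noteq> 0" by (simp add: smooth_symbol_def)
  from dyadic_hat_support(1)[OF assms(1) this] have "2 ^ k < infnorm (rvec m)" by simp
  then obtain j where "2 ^ k < \<bar>rvec m $ j\<bar>" unfolding less_infnorm_iff by blast
  then have "2 ^ k < \<bar>m $ j\<bar>"
    unfolding rvec_nth by (metis of_int_abs of_int_less_iff of_int_numeral of_int_power)
  with assms(2) show False by (auto simp: band_def not_le[symmetric])
qed

lemma sharp_symbol_high_pass:
  assumes "m \<in> band (2 ^ k)"
  shows "sharp_symbol (Suc (Suc k)) m = 0"
proof (rule ccontr)
  assume "sharp_symbol (Suc (Suc k)) m \<noteq> 0"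
  then have "2 ^ Suc k \<le> infnorm (rvec m)" by (simp add: sharp_symbol_def split: if_splits)
  moreover have "(2::real) ^ k < 2 ^ Suc k" by simp
  ultimately have "2 ^ k < infnorm (rvec m)" by (rule less_le_trans[rotated])
  then obtain j where "2 ^ k < \<bar>rvec m $ j\<bar>" unfolding less_infnorm_iff by blast
  then have "2 ^ k < \<bar>m $ j\<bar>"
    unfolding rvec_nth by (metis of_int_abs of_int_less_iff of_int_numeral of_int_power)
  with assms show False by (auto simp: band_def not_le[symmetric])
qed

text \<open>Block n annihilates bandwidth 2^(n-2), so that A may be replaced by A - X for every
  competitor X. The multiplier bound is assumed for A and for these differences only, because the
  smooth symbols have been bounded on continuous elements. For n \<le> 1 the index n - 1 is 0 and
  the bound by the norm applies.\<close>

lemma blocks_le_approx_seq: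
  assumes A: "A \<in> S" and K: "0 < K"
    and bound: "\<And>n. N (fmult (\<mu> n) A) \<le> K * N A"
    and bound_diff: "\<And>n X k. X \<in> S \<Longrightarrow> spectrum_in X (band (2 ^ k)) \<Longrightarrow> N (fmult (\<mu> n) (A - X)) \<le> K * N (A - X)"
    and high_pass: "\<And>k m. m \<in> band (2 ^ k) \<Longrightarrow> \<mu> (Suc (Suc k)) m = 0"
  shows "ennreal (N (fmult (\<mu> n) A)) \<le> ennreal K * dyadic_seq (\<lambda>k. approx_error S N (real k) A) (n - 1)"
proof (cases "n - 1")
  case 0
  then show ?thesis
    using bound[of n] K norm_nonneg[OF A]
    by (simp add: dyadic_seq_def approx_error_zero ennreal_leI flip: ennreal_mult)
next
  case (Suc k)
  then have n: "n = Suc (Suc k)" by simp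
  have "ennreal (N (fmult (\<mu> n) A) / K) \<le> (INF X\<in>{X \<in> S. spectrum_in X (band (2 ^ k))}. ennreal (N (A - X)))"
  proof (rule INF_greatest)
    fix X assume "X \<in> {X \<in> S. spectrum_in X (band (2 ^ k))}"
    then have X: "X \<in> S" "spectrum_in X (band (2 ^ k))" by auto
    have "fmult (\<mu> n) X = fmult (\<lambda>_. 0) X"
      unfolding n by (rule fmult_cong_spectrum[OF X(2) high_pass])
    then have "fmult (\<mu> n) (A - X) = fmult (\<mu> n) A"
      unfolding fmult_diff_right by (simp only: fmult_zero diff_zero)
    then have "N (fmult (\<mu> n) A) \<le> K * N (A - X)" using bound_diff[OF X, of n] by (simp only:)
    then show "ennreal (N (fmult (\<mu> n) A) / K) \<le> ennreal (N (A - X))"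
      using K by (intro ennreal_leI) (simp only: pos_divide_le_eq mult.commute)
  qed
  then have "ennreal K * ennreal (N (fmult (\<mu> n) A) / K) \<le> ennreal K * approx_error S N (real (2 ^ k)) A"
    by (subst approx_error_banded) (auto intro: mult_left_mono)
  moreover have "ennreal K * ennreal (N (fmult (\<mu> n) A) / K) = ennreal (N (fmult (\<mu> n) A))"
    using K by (simp flip: ennreal_mult')
  ultimately show ?thesis using Suc by (simp add: dyadic_seq_def)
qed

end

text \<open>An instance of the Hardy inequality; any exponent above r would do, and r + 1 is
  taken.\<close>

lemma wnorm_shift:
  assumes "1 \<le> p" "0 < r"
  shows "\<exists>K>0. \<forall>C e f. (\<forall>n. e n \<le> C * f (n - s)) \<longrightarrow> wnorm p r e \<le> C * (ennreal K * wnorm p r f)"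
proof -
  define l where "l = r + 1"
  obtain K where K: "0 < K" "\<And>C e f. (\<forall>n. e n \<le> C * (\<Sum>k. ennreal (hardy_kernel l n k) * f k)) \<Longrightarrow> wnorm p r e \<le> C * (ennreal K * wnorm p r f)"
    using wnorm_hardy[OF assms, of l] by (auto simp: l_def)
  let ?a = "2 powr (l * real s)"
  have "wnorm p r e \<le> C * (ennreal (?a * K) * wnorm p r f)" if "\<forall>n. e n \<le> C * f (n - s)" for C e f
  proof -
    have "e n \<le> (C * ennreal ?a) * (\<Sum>k. ennreal (hardy_kernel l n k) * f k)" for n
    proof -
      have "e n \<le> C * f (n - s)" using that by blast
      also have "\<dots> \<le> C * (ennreal ?a * (\<Sum>k. ennreal (hardy_kernel l n k) * f k))"
        using assms(2) by (intro mult_left_mono hardy_kernel_shift) (auto simp: l_def)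
      finally show ?thesis by (simp only: mult.assoc)
    qed
    then have "wnorm p r e \<le> (C * ennreal ?a) * (ennreal K * wnorm p r f)" by (intro K(2) allI)
    also have "\<dots> = C * (ennreal (?a * K) * wnorm p r f)"
      using K(1) by (simp add: ennreal_mult mult.assoc)
    finally show ?thesis .
  qed
  then show ?thesis using K(1) by (intro exI[of _ "?a * K"]) auto
qed

context homogeneous_matrix_algebra
begin

lemma diff_continuous:
  assumes "A \<in> continuous_elements" and "B \<in> continuous_elements"
  shows "A - B \<in> continuous_elements"
proof -
  note AB = continuous_mem[OF assms(1)] continuous_mem[OF assms(2)]
  have lim: "((\<lambda>t. N (fmult (\<lambda>m. character t m - 1) A) + N (fmult (\<lambda>m. character t m - 1) B)) \<longlongrightarrow> 0) (nhds 0)"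
    by (intro tendsto_add_zero continuous_tendsto assms filterlim_ident)
  have "norm (N (fmult (\<lambda>m. character t m - 1) (A - B)))
      \<le> N (fmult (\<lambda>m. character t m - 1) A) + N (fmult (\<lambda>m. character t m - 1) B)" for t
    unfolding fmult_diff_right
    using N_diff_le[OF diff1_mem[OF AB(1)] diff1_mem[OF AB(2)], of t t]
      norm_nonneg[OF diff_mem[OF diff1_mem[OF AB(1)] diff1_mem[OF AB(2)]], of t t]
    by (simp only: real_norm_def abs_of_nonneg)
  then have "((\<lambda>t. N (fmult (\<lambda>m. character t m - 1) (A - B))) \<longlongrightarrow> 0) (nhds 0)"
    by (intro Lim_null_comparison[OF always_eventually[OF allI] lim])
  then show ?thesis using diff_mem[OF AB] by (simp only: continuous_elements_def mem_Collect_eq simp_thms)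
qed

section \<open>One-sided bounds between the norms\<close>

context
  fixes p :: ennreal and r :: real
  assumes p: "1 \<le> p" and r: "0 < r"
begin

abbreviation error_seq :: "'a zmat \<Rightarrow> nat \<Rightarrow> ennreal" where
  "error_seq A \<equiv> dyadic_seq (\<lambda>k. approx_error S N (real k) A)"

abbreviation smoothness_order :: nat where
  "smoothness_order \<equiv> nat \<lfloor>r\<rfloor> + 1"

abbreviation moduli :: "'a zmat \<Rightarrow> nat \<Rightarrow> ennreal" where
  "moduli A \<equiv> modulus_seq (ennreal (N A)) (\<lambda>h. modulus N smoothness_order h A)"

abbreviation littlewood_paley_norm :: "(nat \<Rightarrow> int ^ 'a \<Rightarrow> complex) \<Rightarrow> 'a zmat \<Rightarrow> ennreal" where
  "littlewood_paley_norm \<mu> A \<equiv> wnorm p r (\<lambda>n. ext_norm S N (fmult (\<mu> n) A))"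

text \<open>The Hardy inequality for differences of order l asks for r < l, the reason for the order
  in the Besov norm.\<close>

lemma order_gt: "r < real smoothness_order"
  using r by linarith

lemma approx_equiv_error_seq:
  "norm_dominated S (approx_norm S N p r) (\<lambda>A. wnorm p r (error_seq A))"
  "norm_dominated S (\<lambda>A. wnorm p r (error_seq A)) (approx_norm S N p r)"
proof -
  show "norm_dominated S (approx_norm S N p r) (\<lambda>A. wnorm p r (error_seq A))"
    using approx_seq_norm_le[OF p r] approx_error_antimono
    by (intro norm_dominatedI[of 1]) (simp_all add: approx_norm_seq)
  obtain K where "0 < K" "\<And>E. (\<forall>i j. i \<le> j \<longrightarrow> E j \<le> E i) \<Longrightarrow> wnorm p r (dyadic_seq E) \<le> ennreal K * approx_seq_norm p r E"
    using approx_seq_norm_ge[OF p r] by blast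
  then show "norm_dominated S (\<lambda>A. wnorm p r (error_seq A)) (approx_norm S N p r)"
    using approx_error_antimono by (intro norm_dominatedI[of K]) (simp_all add: approx_norm_seq)
qed

lemma besov_equiv_moduli:
  "norm_dominated S (besov_norm N p r) (\<lambda>A. wnorm p r (moduli A))"
  "norm_dominated S (\<lambda>A. wnorm p r (moduli A)) (besov_norm N p r)"
proof -
  have c: "0 \<le> (action_bound + 1) ^ smoothness_order" using action_bound_pos by simp
  obtain K where K: "0 < K" "\<And>a \<omega>. (\<forall>h h'. h \<le> h' \<longrightarrow> \<omega> h \<le> \<omega> h') \<Longrightarrow> (\<forall>h. \<omega> h \<le> ennreal ((action_bound + 1) ^ smoothness_order) * a) \<Longrightarrow>
     besov_seq_norm p r a \<omega> \<le> ennreal K * wnorm p r (modulus_seq a \<omega>) \<and>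
     wnorm p r (modulus_seq a \<omega>) \<le> ennreal K * besov_seq_norm p r a \<omega>"
    using besov_seq_norm_equiv[OF p r c] by blast
  have "besov_norm N p r A \<le> ennreal K * wnorm p r (moduli A) \<and> wnorm p r (moduli A) \<le> ennreal K * besov_norm N p r A"
    if "A \<in> S" for A
    unfolding besov_norm_seq by (intro K(2) allI impI modulus_mono modulus_le that)
  then show "norm_dominated S (besov_norm N p r) (\<lambda>A. wnorm p r (moduli A))"
    "norm_dominated S (\<lambda>A. wnorm p r (moduli A)) (besov_norm N p r)"
    using K(1) by (auto intro: norm_dominatedI[of K])
qed

text \<open>A block outside the algebra makes the norm infinite and domination by it trivial;
  otherwise the block estimates apply.\<close>

lemma littlewood_paley_norm_cases:
  obtains "littlewood_paley_norm \<mu> A = top" | "\<And>n. fmult (\<mu> n) A \<in> S"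
proof (cases "\<forall>n. fmult (\<mu> n) A \<in> S")
  case False
  then obtain n where "fmult (\<mu> n) A \<notin> S" by blast
  then have "littlewood_paley_norm \<mu> A = top"
    using wnorm_ge_term[OF p, of r "\<lambda>n. ext_norm S N (fmult (\<mu> n) A)" n] r
    by (simp add: ext_norm_def infinity_ennreal_def top_unique)
  then show ?thesis by (rule that(1))
qed (use that(2) in blast)

lemma error_seq_dominated:
  assumes \<mu>: "littlewood_paley \<mu>"
  shows "norm_dominated S (\<lambda>A. wnorm p r (error_seq A)) (littlewood_paley_norm \<mu>)"
proof -
  obtain K where K: "0 < K" "\<And>C e f. (\<forall>n. e n \<le> C * (\<Sum>k. ennreal (hardy_kernel (r + 1) n k) * f k)) \<Longrightarrow> wnorm p r e \<le> C * (ennreal K * wnorm p r f)"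
    using wnorm_hardy[OF p r, of "r + 1"] by auto
  show ?thesis
  proof (rule norm_dominatedI[OF K(1)])
    fix A assume A: "A \<in> S"
    show "wnorm p r (error_seq A) \<le> ennreal K * littlewood_paley_norm \<mu> A"
    proof (rule littlewood_paley_norm_cases[of \<mu> A])
      assume "littlewood_paley_norm \<mu> A = top"
      then show ?thesis using K(1) by simp
    next
      assume mem: "\<And>n. fmult (\<mu> n) A \<in> S"
      have "error_seq A n \<le> 1 * (\<Sum>k. ennreal (hardy_kernel (r + 1) n k) * ext_norm S N (fmult (\<mu> k) A))" for n
        using approx_seq_le_blocks[OF A \<mu> mem, of "r + 1" n] r mem by (simp add: ext_norm_def)
      then show ?thesis using K(2)[of "error_seq A" 1] by simp
    qed
  qed
qed

lemma moduli_dominated: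
  assumes \<mu>: "littlewood_paley \<mu>"
  shows "norm_dominated S (\<lambda>A. wnorm p r (moduli A)) (littlewood_paley_norm \<mu>)"
proof -
  let ?l = smoothness_order
  obtain K where K: "0 < K" "\<And>C e f. (\<forall>n. e n \<le> C * (\<Sum>k. ennreal (hardy_kernel (real ?l) n k) * f k)) \<Longrightarrow> wnorm p r e \<le> C * (ennreal K * wnorm p r f)"
    using wnorm_hardy[OF p r order_gt] by blast
  define C where "C = 1 + (action_bound + 1) ^ ?l + (2 * bernstein_const) ^ ?l"
  have C: "0 < C" using action_bound_pos bernstein_const_pos by (simp add: C_def add_pos_nonneg)
  show ?thesis
  proof (rule norm_dominatedI[of "C * K"])
    show "0 < C * K" using K(1) C by simp
    fix A assume A: "A \<in> S"
    have "wnorm p r (moduli A) \<le> ennreal C * (ennreal K * littlewood_paley_norm \<mu> A)"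
    proof (rule littlewood_paley_norm_cases[of \<mu> A])
      assume "littlewood_paley_norm \<mu> A = top"
      then show ?thesis using K(1) C by simp
    next
      assume mem: "\<And>n. fmult (\<mu> n) A \<in> S"
      have ext: "ext_norm S N (fmult (\<mu> k) A) = ennreal (N (fmult (\<mu> k) A))" for k
        using mem by (simp add: ext_norm_def)
      show ?thesis
        unfolding ext C_def by (intro K(2) allI modulus_seq_le_blocks A \<mu> mem)
    qed
    then show "wnorm p r (moduli A) \<le> ennreal (C * K) * littlewood_paley_norm \<mu> A"
      using K(1) C by (simp add: ennreal_mult mult.assoc)
  qed
qed

text \<open>The block bound is required only where the weighted errors are finite, since in the
  smooth case this finiteness is what yields continuity. Elsewhere the right-hand side is
  \<infinity>.\<close>

lemma littlewood_paley_norm_dominated_error_seq: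
  assumes "0 < K"
    and bound: "\<And>A n. A \<in> S \<Longrightarrow> wnorm p r (error_seq A) < \<infinity> \<Longrightarrow>
      ext_norm S N (fmult (\<mu> n) A) \<le> ennreal K * error_seq A (n - 1)"
  shows "norm_dominated S (littlewood_paley_norm \<mu>) (\<lambda>A. wnorm p r (error_seq A))"
proof -
  obtain K' where K': "0 < K'" "\<And>C e f. (\<forall>n. e n \<le> C * f (n - 1)) \<Longrightarrow> wnorm p r e \<le> C * (ennreal K' * wnorm p r f)"
    using wnorm_shift[OF p r, of 1] by blast
  show ?thesis
  proof (rule norm_dominatedI[of "K * K'"])
    show KK: "0 < K * K'" using assms(1) K'(1) by simp
    fix A assume A: "A \<in> S"
    show "littlewood_paley_norm \<mu> A \<le> ennreal (K * K') * wnorm p r (error_seq A)"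
    proof (cases "wnorm p r (error_seq A) < \<infinity>")
      case True
      have "littlewood_paley_norm \<mu> A \<le> ennreal K * (ennreal K' * wnorm p r (error_seq A))"
        by (intro K'(2) allI bound A True)
      then show ?thesis using assms(1) K'(1) by (simp add: ennreal_mult mult.assoc)
    next
      case False
      then have "wnorm p r (error_seq A) = top" by (simp add: infinity_ennreal_def not_less top_unique)
      moreover have "ennreal (K * K') * top = top" using KK by (intro ennreal_top_mult_left) (simp add: ennreal_eq_0_iff not_le)
      ultimately show ?thesis by simp
    qed
  qed
qed

lemma smooth_dominated_error_seq:
  assumes gen: "dyadic_generator \<phi>"
  shows "norm_dominated S (littlewood_paley_norm (smooth_symbol \<phi>)) (\<lambda>A. wnorm p r (error_seq A))"
proof -
  obtain K where K: "0 < K" "\<And>A n. A \<in> continuous_elements \<Longrightarrow> fmult (smooth_symbol \<phi> n) A \<in> S"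
    "\<And>A n. A \<in> continuous_elements \<Longrightarrow> N (fmult (smooth_symbol \<phi> n) A) \<le> K * N A"
    using smooth_symbol_bounded[OF gen] by blast
  show ?thesis
  proof (rule littlewood_paley_norm_dominated_error_seq[OF K(1)])
    fix A n assume A: "A \<in> S" and fin: "wnorm p r (error_seq A) < \<infinity>"
    have cont: "A \<in> continuous_elements"
      by (intro continuous_of_approx_small A wnorm_finite_small_term[OF p r fin])
    have diff: "A - X \<in> continuous_elements" if X: "X \<in> S" "spectrum_in X (band (2 ^ k))" for X k
      by (rule diff_continuous[OF cont banded_continuous[OF X]])
    have "ennreal (N (fmult (smooth_symbol \<phi> n) A)) \<le> ennreal K * error_seq A (n - 1)"
      using K(3) cont diff smooth_symbol_high_pass[OF gen] by (intro blocks_le_approx_seq A K(1)) auto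
    then show "ext_norm S N (fmult (smooth_symbol \<phi> n) A) \<le> ennreal K * error_seq A (n - 1)"
      using K(2)[OF cont] by (simp add: ext_norm_def)
  qed
qed

lemma sharp_dominated_error_seq:
  assumes "solid S N"
  shows "norm_dominated S (littlewood_paley_norm sharp_symbol) (\<lambda>A. wnorm p r (error_seq A))"
proof (rule littlewood_paley_norm_dominated_error_seq[of 1])
  have bnd: "fmult (sharp_symbol n) A \<in> S \<and> N (fmult (sharp_symbol n) A) \<le> 1 * N A" if "A \<in> S" for A n
  proof -
    have "cmod (sharp_symbol n m) \<le> 1" for m :: "int ^ 'a"
      by (cases n) (auto simp: sharp_symbol_def)
    then have "cmod (fmult (sharp_symbol n) A k l) \<le> cmod (A k l)" for k l
      unfolding fmult_def Real_Vector_Spaces.norm_mult by (intro mult_left_le_one_le) auto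
    then show ?thesis using assms that unfolding solid_def mult_1 by blast
  qed
  fix A n assume A: "A \<in> S"
  have "ennreal (N (fmult (sharp_symbol n) A)) \<le> ennreal 1 * error_seq A (n - 1)"
    using bnd A sharp_symbol_high_pass by (intro blocks_le_approx_seq A) (auto intro: diff_mem simp del: mult_1)
  then show "ext_norm S N (fmult (sharp_symbol n) A) \<le> ennreal 1 * error_seq A (n - 1)"
    using bnd[OF A] by (simp add: ext_norm_def)
qed simp

text \<open>A high block n has its frequencies beyond 2h with h = 2^(n-3). The inverse Bernstein
  inequality bounds it by its differences at shifts up to R / h, and these are controlled by the
  modulus of A after a shift of the index that depends on R only.\<close>

lemma smooth_dominated_moduli:
  assumes gen: "dyadic_generator \<phi>"
  shows "norm_dominated S (littlewood_paley_norm (smooth_symbol \<phi>)) (\<lambda>A. wnorm p r (moduli A))"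
proof -
  let ?l = smoothness_order and ?\<mu> = "smooth_symbol \<phi>"
  obtain K where K: "0 < K" "\<And>A n. A \<in> continuous_elements \<Longrightarrow> fmult (?\<mu> n) A \<in> S"
    "\<And>A n. A \<in> continuous_elements \<Longrightarrow> N (fmult (?\<mu> n) A) \<le> K * N A"
    using smooth_symbol_bounded[OF gen] by blast
  have "1 \<le> ?l" by simp
  from inverse_bernstein[OF this]
  obtain R C where R: "0 < R" and C: "0 < C" and inv: "\<forall>h\<ge>1. \<forall>A\<in>S. \<forall>W. \<forall>\<epsilon>.
     spectrum_in A {m \<in> band W. \<exists>j. int (2 * h) \<le> \<bar>m $ j\<bar>} \<longrightarrow>
     (\<forall>t. norm1 t \<le> R / real h \<longrightarrow> N (difference ?l t A) \<le> \<epsilon>) \<longrightarrow> N A \<le> C * \<epsilon>"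
    by (elim exE conjE)
  \<comment> \<open>For h = 2^(s+i) the shifts up to R / h lie within 2^-i. With n = s + i + 3 this
    scale has the index i + 1 = n - (s + 2).\<close>
  obtain s where s: "R < 2 ^ s" using real_arch_pow[of 2 R] by auto
  obtain K' where K': "0 < K'" "\<And>C e f. (\<forall>n. e n \<le> C * f (n - (s + 2))) \<Longrightarrow> wnorm p r e \<le> C * (ennreal K' * wnorm p r f)"
    using wnorm_shift[OF p r, of "s + 2"] by blast
  \<comment> \<open>Covers K for the low blocks, bounded by the norm of A, and C K for the
    others.\<close>
  define L where "L = K * (1 + C)"
  have L: "0 < L" "K \<le> L" "C * K \<le> L" using K(1) C by (auto simp: L_def algebra_simps intro!: add_pos_pos mult_pos_pos)
  have block: "ext_norm S N (fmult (?\<mu> n) A) \<le> ennreal L * moduli A (n - (s + 2))"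
    if A: "A \<in> continuous_elements" for A n
  proof -
    note AS = continuous_mem[OF A]
    have "ennreal (N (fmult (?\<mu> n) A)) \<le> ennreal L * moduli A (n - (s + 2))"
    proof (cases "n \<le> s + 2")
      case True
      have "N (fmult (?\<mu> n) A) \<le> L * N A"
        using K(3)[OF A, of n] mult_right_mono[OF L(2) norm_nonneg[OF AS]] by linarith
      then show ?thesis
        using True L(1) norm_nonneg[OF AS] by (simp add: modulus_seq_def ennreal_leI flip: ennreal_mult)
    next
      case False
      define i where "i = n - (s + 3)"
      have n: "n = Suc (Suc (Suc (s + i)))" "n - (s + 2) = Suc i" using False by (simp_all add: i_def)
      define h :: nat where "h = 2 ^ (s + i)"
      have h: "1 \<le> h" "real h = 2 ^ s * 2 ^ i" by (simp_all add: h_def power_add)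
      define e where "e = enn2real (modulus N ?l (2 powr (- real i)) A)"
      have e: "modulus N ?l (2 powr (- real i)) A = ennreal e"
      proof -
        have "modulus N ?l (2 powr (- real i)) A < top"
          using modulus_le[OF AS] by (rule le_less_trans) (simp add: ennreal_mult_less_top)
        then show ?thesis by (simp add: e_def)
      qed
      have e0: "0 \<le> e" by (simp add: e_def)
      let ?B = "fmult (?\<mu> n) A"
      have "spectrum_in ?B (band (2 ^ n))" by (rule littlewood_paley_block_band[OF littlewood_paley_smooth[OF gen] order_refl])
      moreover have "spectrum_in ?B {m. \<exists>j. int (2 * h) \<le> \<bar>m $ j\<bar>}"
      proof (rule spectrum_in_fmult_support, rule CollectI)
        fix m assume "?\<mu> n m \<noteq> 0"
        then have "dyadic_hat \<phi> (int (Suc (Suc (s + i)))) (rvec m) \<noteq> 0" by (simp add: n(1) smooth_symbol_def)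
        from dyadic_hat_support(1)[OF gen this] have "2 * real h < infnorm (rvec m)"
          by (simp add: h_def)
        then obtain j where "2 * real h < \<bar>rvec m $ j\<bar>" unfolding less_infnorm_iff by blast
        then have "int (2 * h) \<le> \<bar>m $ j\<bar>" unfolding rvec_nth by linarith
        then show "\<exists>j. int (2 * h) \<le> \<bar>m $ j\<bar>" ..
      qed
      ultimately have spec: "spectrum_in ?B {m \<in> band (2 ^ n). \<exists>j. int (2 * h) \<le> \<bar>m $ j\<bar>}"
        by (simp add: spectrum_in_def)
      have small: "N (difference ?l t ?B) \<le> K * e" if t: "norm1 t \<le> R / real h" for t
      proof -
        have "R / real h \<le> 2 ^ s / real h" using s by (intro divide_right_mono) auto
        also have "\<dots> = 2 powr (- real i)" by (simp add: h powr_minus powr_realpow inverse_eq_divide)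
        finally have "norm1 t \<le> 2 powr (- real i)" using t by simp
        then have "ennreal (N (difference ?l t A)) \<le> ennreal e"
          unfolding e[symmetric] modulus_def by (intro SUP_upper) simp
        then have le: "N (difference ?l t A) \<le> e" using e0 by (simp only: ennreal_le_iff)
        \<comment> \<open>The block is moved outside the difference: the differences of A are again
          continuous, so that the multiplier bound applies to them.\<close>
        have "difference ?l t ?B = fmult (?\<mu> n) (difference ?l t A)"
          unfolding difference_fmult by (rule fmult_commute)
        then have "N (difference ?l t ?B) = N (fmult (?\<mu> n) (difference ?l t A))" by (simp only:)
        also have "\<dots> \<le> K * N (difference ?l t A)" by (rule K(3)[OF difference_continuous[OF A]])
        also have "\<dots> \<le> K * e" using le K(1) by (intro mult_left_mono) auto
        finally show ?thesis .
      qed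
      have "N ?B \<le> C * (K * e)"
        by (rule inv[rule_format, OF h(1) K(2)[OF A] spec small])
      also have "\<dots> \<le> L * e" using mult_right_mono[OF L(3) e0] by (simp only: mult.assoc)
      finally have "ennreal (N ?B) \<le> ennreal (L * e)" by (rule ennreal_leI)
      also have "\<dots> = ennreal L * ennreal e" using L(1) e0 by (intro ennreal_mult) auto
      finally show ?thesis
        unfolding n(2) modulus_seq_def nat.case e .
    qed
    then show ?thesis using K(2)[OF A] by (simp add: ext_norm_def)
  qed
  show ?thesis
  proof (rule norm_dominatedI[of "L * K'"])
    show KK: "0 < L * K'" using L(1) K'(1) by simp
    fix A assume A: "A \<in> S"
    show "littlewood_paley_norm ?\<mu> A \<le> ennreal (L * K') * wnorm p r (moduli A)"
    proof (cases "wnorm p r (moduli A) < \<infinity>")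
      case True
      have "A \<in> continuous_elements"
      proof (rule marchaud[OF A, of ?l])
        fix \<epsilon> :: real assume "0 < \<epsilon>"
        then obtain n where n: "moduli A (Suc n) < ennreal \<epsilon>"
          using wnorm_finite_small_term[OF p r True] by blast
        have "N (difference ?l t A) < \<epsilon>" if "norm1 t \<le> 2 powr (- real n)" for t
        proof -
          have "ennreal (N (difference ?l t A)) \<le> moduli A (Suc n)"
            unfolding modulus_seq_def nat.case modulus_def using that by (intro SUP_upper) simp
          also note n
          finally show ?thesis using norm_nonneg[OF difference_mem[OF A]] by (simp only: ennreal_less_iff)
        qed
        then show "\<exists>d>0. \<forall>t. norm1 t \<le> d \<longrightarrow> N (difference ?l t A) < \<epsilon>"
          by (intro exI[of _ "2 powr (- real n)"]) auto
      qed simp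
      then have "littlewood_paley_norm ?\<mu> A \<le> ennreal L * (ennreal K' * wnorm p r (moduli A))"
        by (intro K'(2) allI block)
      then show ?thesis using L(1) K'(1) by (simp add: ennreal_mult mult.assoc)
    next
      case False
      then have "wnorm p r (moduli A) = top" by (simp add: infinity_ennreal_def not_less top_unique)
      moreover have "ennreal (L * K') * top = top" using KK by (intro ennreal_top_mult_left) (simp add: ennreal_eq_0_iff not_le)
      ultimately show ?thesis by simp
    qed
  qed
qed

lemma block_norm_equiv_littlewood_paley_norm:
  assumes "\<And>A n. b A (int n - 1) = fmult (\<mu> n) A"
  shows "norm_dominated S (\<lambda>A. block_norm S N p r (b A)) (littlewood_paley_norm \<mu>)"
    and "norm_dominated S (littlewood_paley_norm \<mu>) (\<lambda>A. block_norm S N p r (b A))"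
proof -
  have eq: "block_norm S N p r (b A) = ennreal (2 powr (- r)) * littlewood_paley_norm \<mu> A" for A
    by (simp only: block_norm_seq[OF p] assms)
  have "ennreal (2 powr r) * ennreal (2 powr (- r)) = 1"
    by (simp flip: ennreal_mult powr_add)
  then have "littlewood_paley_norm \<mu> A = ennreal (2 powr r) * block_norm S N p r (b A)" for A
    unfolding eq by (simp add: mult.assoc[symmetric])
  then show "norm_dominated S (\<lambda>A. block_norm S N p r (b A)) (littlewood_paley_norm \<mu>)"
    "norm_dominated S (littlewood_paley_norm \<mu>) (\<lambda>A. block_norm S N p r (b A))"
    using eq by (auto intro: norm_dominatedI[of "2 powr (- r)"] norm_dominatedI[of "2 powr r"])
qed

text \<open>The approximation and the Besov norm are never compared directly: each dominates the
  smooth Littlewood-Paley norm and is dominated by it. The sharp blocks enter only a chain with the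
  approximation norm.\<close>

lemma approx_norm_equivalences:
  assumes gen: "dyadic_generator \<phi>"
  shows "equiv_norms S (approx_norm S N p r) (besov_norm N p r)"
    and "equiv_norms S (approx_norm S N p r) (\<lambda>A. block_norm S N p r (\<lambda>k. smooth_block \<phi> k A))"
    and "solid S N \<Longrightarrow> equiv_norms S (approx_norm S N p r) (\<lambda>A. block_norm S N p r (\<lambda>k. sharp_block k A))"
proof -
  note trans = norm_dominated_trans
  note smooth = littlewood_paley_smooth[OF gen]
  note approx = approx_equiv_error_seq and besov = besov_equiv_moduli
  note smooth_block = block_norm_equiv_littlewood_paley_norm[of "\<lambda>A k. smooth_block \<phi> k A", OF smooth_block_fmult[OF gen]]
  note sharp_block = block_norm_equiv_littlewood_paley_norm[of "\<lambda>A k. sharp_block k A", OF sharp_block_fmult]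
  show "equiv_norms S (approx_norm S N p r) (besov_norm N p r)"
    unfolding equiv_norms_iff
    using trans[OF approx(1) trans[OF error_seq_dominated[OF smooth] trans[OF smooth_dominated_moduli[OF gen] besov(2)]]]
      trans[OF besov(1) trans[OF moduli_dominated[OF smooth] trans[OF smooth_dominated_error_seq[OF gen] approx(2)]]]
    by (rule conjI)
  show "equiv_norms S (approx_norm S N p r) (\<lambda>A. block_norm S N p r (\<lambda>k. smooth_block \<phi> k A))"
    unfolding equiv_norms_iff
    using trans[OF approx(1) trans[OF error_seq_dominated[OF smooth] smooth_block(2)]]
      trans[OF smooth_block(1) trans[OF smooth_dominated_error_seq[OF gen] approx(2)]]
    by (rule conjI)
  show "equiv_norms S (approx_norm S N p r) (\<lambda>A. block_norm S N p r (\<lambda>k. sharp_block k A))" if "solid S N"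
    unfolding equiv_norms_iff
    using trans[OF approx(1) trans[OF error_seq_dominated[OF littlewood_paley_sharp] sharp_block(2)]]
      trans[OF sharp_block(1) trans[OF sharp_dominated_error_seq[OF that] approx(2)]]
    by (rule conjI)
qed

end

end

lemma equiv_norms_finite:
  assumes "equiv_norms S F G" and "A \<in> S"
  shows "F A < \<infinity> \<longleftrightarrow> G A < \<infinity>"
proof -
  obtain c C where c: "0 < c" "ennreal c * G A \<le> F A" "F A \<le> ennreal C * G A"
    using assms by (auto simp: equiv_norms_def)
  have "G A < top" if "F A < top"
    using le_less_trans[OF c(2) that] c(1) by (auto simp: ennreal_mult_less_top ennreal_eq_0_iff)
  moreover have "F A < top" if "G A < top"
    using c(3) by (rule le_less_trans) (simp add: ennreal_mult_less_top that)
  ultimately show ?thesis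
    unfolding infinity_ennreal_def by blast
qed

theorem proposition3p14:
  fixes S :: "'d::finite zmat set" and N :: "'d zmat \<Rightarrow> real"
    and p :: ennreal and r :: real and \<phi> :: "real ^ 'd \<Rightarrow> complex"
  assumes "homogeneous_matrix_algebra S N"
    and "1 \<le> p" and "0 < r"
    and "dyadic_generator \<phi>"
  shows "approx_space S N p r = besov_space S N p r
    \<and> equiv_norms S (approx_norm S N p r) (besov_norm N p r)
    \<and> equiv_norms S (approx_norm S N p r) (\<lambda>A. block_norm S N p r (\<lambda>k. smooth_block \<phi> k A))
    \<and> (solid S N \<longrightarrow>
         equiv_norms S (approx_norm S N p r) (\<lambda>A. block_norm S N p r (\<lambda>k. sharp_block k A)))"
proof -
  interpret homogeneous_matrix_algebra S N by (rule assms(1))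
  note equiv = approx_norm_equivalences[OF assms(2-4)]
  have "approx_space S N p r = besov_space S N p r"
    using equiv_norms_finite[OF equiv(1)] by (auto simp: approx_space_def besov_space_def)
  with equiv show ?thesis by blast
qed

end
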